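(* In the setting of the context (exact solution $(u,p)$ of (CH), extensions $\tilde u,\tilde p$, numerical solution $U_k^{(n)}$ of (S) computed up to $n=N$ with $T=N\Delta t$), assume that $u\in C^5([0,L]\times[0,T])$ and that the potential function $F$ is in $C^4$. Denote bounds by $$\max_{0\le n\le N}\{\|D\boldsymbol U^{(n)}\|,\|D\boldsymbol u^{(n)}\|\}\le C_1,\qquad \max_{0\le n\le N}\{\|\boldsymbol U^{(n)}\|_{L^\infty_{\rm d}},\|\boldsymbol u^{(n)}\|_{L^\infty_{\rm d}}\}\le C_2,$$ and let $$C_3:=\frac{C_1L^{\frac12}\max_{|\xi|\le C_2}|F'''(\xi)|+\max_{|\xi|\le C_2}|F''(\xi)|}{2}.$$ Fix $B\in(0,\gamma/C_3^2)$. If $\Delta t$ satisfies $\Delta t<B$ $(<\gamma/C_3^2)$, then there exists a constant $C:=C(B)$, dependent on $B$ and independent of $k$ and $n$, such that $$\left\|(\Pi_{\Delta x,\Delta t}U)(\cdot,t)-u(\cdot,t)\right\|_{L^\infty(0,L)}\le C\left((\Delta x)^2+(\Delta t)^2\right)\qquad\text{for all }t\in[0,T],$$ where $\Pi_{\Delta x,\Delta t}U$ is the function interpolating the grid values $U_k^{(n)}$ defined in the context.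
   Context: Let $L>0$, $\gamma>0$, $K,N$ natural numbers, $\Delta x:=L/K$, $\Delta t>0$, $T:=N\Delta t$. $F:\mathbb R\to\mathbb R$ is a sufficiently smooth potential, bounded from below, with derivative $F'$. Continuous problem (CH): $(u,p)$ satisfies $\partial_tu=\partial_x^2p$, $p=-\gamma\partial_x^2u+F'(u)$ for $0<x<L$, with boundary conditions $\partial_tu(0,t)=\partial_xu(0,t)$, $\partial_tu(L,t)=-\partial_xu(L,t)$, $\partial_xp(0,t)=\partial_xp(L,t)=0$, and an initial condition. Assume $(u,p)$ is a solution. Extension of $p$: $\tilde p$ is a function on $[-\Delta x,L+\Delta x]\times[0,T]$ such that $\partial_x^5\tilde p$ exists and is continuous there, $\tilde p(x,t)=p(x,t)$ for $x\in[0,L]$, $\tilde p(-\Delta x,t)=\tilde p(\Delta x,t)$ and $\tilde p(L+\Delta x,t)=\tilde p(L-\Delta x,t)$ for all $t\in[0,T]$. Extension of $u$: $\tilde u$ is an extension of $u$ from $[0,L]\times[0,T]$ to $[-\Delta x,L+\Delta x]\times[0,T]$ that satisfies $\tilde u\in C^4([-\Delta x,L+\Delta x]\times[0,T])$. For example, one may take $\tilde u=u$ for $0\le x\le L$, $\tilde u(x,t)=u(-x,t)+2x\,\partial_xu(0,t)+\frac{x^3}{3}\partial_x^3u(0,t)$ for $-\Delta x\le x<0$, $\tilde u(x,t)=u(2L-x,t)+2(x-L)\partial_xu(L,t)+\frac{(x-L)^3}{3}\partial_x^3u(L,t)$ for $L<x\le L+\Delta x$. Difference operators: $\delta_k^+f_k=\frac{f_{k+1}-f_k}{\Delta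 x}$, $\delta_k^{\langle1\rangle}f_k=\frac{f_{k+1}-f_{k-1}}{2\Delta x}$, $\delta_k^{\langle2\rangle}f_k=\frac{f_{k+1}-2f_k+f_{k-1}}{(\Delta x)^2}$. Difference quotient: $\frac{dF}{d(\xi,\eta)}:=\frac{F(\xi)-F(\eta)}{\xi-\eta}$ if $\xi\ne\eta$, and $:=F'(\eta)$ if $\xi=\eta$. Scheme (S): $U_k^{(n)}$ ($-1\le k\le K+1$, $0\le n\le N$) and $P_k^{(n)}$ ($-1\le k\le K+1$, $0\le n\le N-1$) satisfy, for $n=0,\ldots,N-1$, (1) $\frac{U_k^{(n+1)}-U_k^{(n)}}{\Delta t}=\delta_k^{\langle2\rangle}P_k^{(n)}$ for $k=0,\ldots,K$; (2) $P_k^{(n)}=-\gamma\,\delta_k^{\langle2\rangle}\Big(\frac{U_k^{(n+1)}+U_k^{(n)}}{2}\Big)+\frac{dF}{d(U_k^{(n+1)},U_k^{(n)})}$ for $k=0,\ldots,K$; (3) $\frac{U_0^{(n+1)}-U_0^{(n)}}{\Delta t}=\delta_k^{\langle1\rangle}\Big(\frac{U_k^{(n+1)}+U_k^{(n)}}{2}\Big)\Big|_{k=0}$; (4) $\frac{U_K^{(n+1)}-U_K^{(n)}}{\Delta t}=-\delta_k^{\langle1\rangle}\Big(\frac{U_k^{(n+1)}+U_k^{(n)}}{2}\Big)\Big|_{k=K}$; (5) $\delta_k^{\langle1\rangle}P_k^{(n)}=0$ for $k=0,K$; with initial data $U_k^{(0)}=\tilde u(k\Delta x,0)$, $k=-1,0,\ldots,K+1$.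 Norms: $\|\boldsymbol f\|_{L^\infty_{\rm d}}:=\max_{0\le k\le K}|f_k|$, $\|D\boldsymbol f\|:=\big(\sum_{k=0}^{K-1}|\delta_k^+f_k|^2\Delta x\big)^{1/2}$. Also $\boldsymbol U^{(n)}:=\{U_k^{(n)}\}_{k=0}^K$ and $\boldsymbol u^{(n)}:=\{u(k\Delta x,n\Delta t)\}_{k=0}^K$. Interpolation: for $(x,t)\in[k\Delta x,(k+1)\Delta x]\times[n\Delta t,(n+1)\Delta t]$, $k=0,\ldots,K-1$, $n=0,\ldots,N-1$, $$\begin{aligned}(\Pi_{\Delta x,\Delta t}U)(x,t)&=\Big(k+1-\tfrac{x}{\Delta x}\Big)\Big(n+1-\tfrac{t}{\Delta t}\Big)U_k^{(n)}+\Big(k+1-\tfrac{x}{\Delta x}\Big)\Big(\tfrac{t}{\Delta t}-n\Big)U_k^{(n+1)}\\&\quad+\Big(\tfrac{x}{\Delta x}-k\Big)\Big(n+1-\tfrac{t}{\Delta t}\Big)U_{k+1}^{(n)}+\Big(\tfrac{x}{\Delta x}-k\Big)\Big(\tfrac{t}{\Delta t}-n\Big)U_{k+1}^{(n+1)}.\end{aligned}$$ Equivalently, $\Pi_{\Delta x,\Delta t}$ is the composition (in either order) of piecewise linear interpolation in $x$ and piecewise linear interpolation in $t$. *)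

theory Defs
  imports "HOL-Probability.Essential_Supremum"
begin

definition C_real :: "nat \<Rightarrow> (real \<Rightarrow> real) \<Rightarrow> bool" where
  "C_real m f \<longleftrightarrow>
     (\<forall>j<m. \<forall>x. ((deriv ^^ j) f has_real_derivative (deriv ^^ Suc j) f x) (at x)) \<and>
     continuous_on UNIV ((deriv ^^ m) f)"

text \<open>
  \<open>C_rect m X Y f\<close> is \<open>f \<in> C\<^sup>m(X \<times> Y)\<close> for closed intervals \<open>X\<close> (space) and \<open>Y\<close> (time):
  \<open>D i j\<close> is \<open>\<partial>\<^sub>x\<^sup>i \<partial>\<^sub>t\<^sup>j f\<close>, with one-sided derivatives on the boundary, and all these are
  continuous on the closed rectangle.
\<close>

definition C_rect :: "nat \<Rightarrow> real set \<Rightarrow> real set \<Rightarrow> (real \<Rightarrow> real \<Rightarrow> real) \<Rightarrow> bool" where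
  "C_rect m X Y f \<longleftrightarrow>
     (\<exists>D :: nat \<Rightarrow> nat \<Rightarrow> real \<Rightarrow> real \<Rightarrow> real.
        (\<forall>x\<in>X. \<forall>t\<in>Y. D 0 0 x t = f x t) \<and>
        (\<forall>i j. i + j \<le> m \<longrightarrow> continuous_on (X \<times> Y) (\<lambda>(x, t). D i j x t)) \<and>
        (\<forall>i j. i + j < m \<longrightarrow> (\<forall>x\<in>X. \<forall>t\<in>Y.
           ((\<lambda>y. D i j y t) has_real_derivative D (Suc i) j x t) (at x within X) \<and>
           ((\<lambda>s. D i j x s) has_real_derivative D i (Suc j) x t) (at t within Y))))"

text \<open>\<open>\<partial>\<^sub>x\<^sup>m f\<close> exists and is continuous on \<open>X \<times> Y\<close>; nothing is required of time derivatives.\<close>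

definition C_space :: "nat \<Rightarrow> real set \<Rightarrow> real set \<Rightarrow> (real \<Rightarrow> real \<Rightarrow> real) \<Rightarrow> bool" where
  "C_space m X Y f \<longleftrightarrow>
     (\<exists>D :: nat \<Rightarrow> real \<Rightarrow> real \<Rightarrow> real.
        (\<forall>x\<in>X. \<forall>t\<in>Y. D 0 x t = f x t) \<and>
        (\<forall>i<m. \<forall>x\<in>X. \<forall>t\<in>Y.
           ((\<lambda>y. D i y t) has_real_derivative D (Suc i) x t) (at x within X)) \<and>
        continuous_on (X \<times> Y) (\<lambda>(x, t). D m x t))"

text \<open>
  Classical solution with initial datum \<open>u0\<close>. The functions \<open>ut\<close>, \<open>ux\<close>, \<open>uxx\<close>, \<open>px\<close>, \<open>pxx\<close> are the
  partial derivatives; those taken within a closed interval are one-sided at its end points.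
\<close>

definition CH_solution ::
  "real \<Rightarrow> real \<Rightarrow> real \<Rightarrow> (real \<Rightarrow> real) \<Rightarrow> (real \<Rightarrow> real)
    \<Rightarrow> (real \<Rightarrow> real \<Rightarrow> real) \<Rightarrow> (real \<Rightarrow> real \<Rightarrow> real) \<Rightarrow> bool" where
  "CH_solution L T \<gamma> F u0 u p \<longleftrightarrow>
     (\<exists>ut ux uxx px pxx :: real \<Rightarrow> real \<Rightarrow> real. \<forall>t\<in>{0<..T}.
        (\<forall>x\<in>{0..L}.
           ((\<lambda>s. u x s) has_real_derivative ut x t) (at t within {0..T}) \<and>
           ((\<lambda>y. u y t) has_real_derivative ux x t) (at x within {0..L}) \<and>
           ((\<lambda>y. p y t) has_real_derivative px x t) (at x within {0..L})) \<and>
        (\<forall>x\<in>{0<..<L}.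
           ((\<lambda>y. ux y t) has_real_derivative uxx x t) (at x) \<and>
           ((\<lambda>y. px y t) has_real_derivative pxx x t) (at x) \<and>
           ut x t = pxx x t \<and>
           p x t = - \<gamma> * uxx x t + deriv F (u x t)) \<and>
        ut 0 t = ux 0 t \<and> ut L t = - ux L t \<and>
        px 0 t = 0 \<and> px L t = 0) \<and>
     (\<forall>x\<in>{0..L}. u x 0 = u0 x)"

definition extension_u ::
  "real \<Rightarrow> real \<Rightarrow> real \<Rightarrow> (real \<Rightarrow> real \<Rightarrow> real) \<Rightarrow> (real \<Rightarrow> real \<Rightarrow> real) \<Rightarrow> bool" where
  "extension_u L T \<Delta>x u u_ext \<longleftrightarrow>
     C_rect 4 {- \<Delta>x..L + \<Delta>x} {0..T} u_ext \<and>
     (\<forall>x\<in>{0..L}. \<forall>t\<in>{0..T}. u_ext x t = u x t)"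

definition extension_p ::
  "real \<Rightarrow> real \<Rightarrow> real \<Rightarrow> (real \<Rightarrow> real \<Rightarrow> real) \<Rightarrow> (real \<Rightarrow> real \<Rightarrow> real) \<Rightarrow> bool" where
  "extension_p L T \<Delta>x p p_ext \<longleftrightarrow>
     C_space 5 {- \<Delta>x..L + \<Delta>x} {0..T} p_ext \<and>
     (\<forall>x\<in>{0..L}. \<forall>t\<in>{0..T}. p_ext x t = p x t) \<and>
     (\<forall>t\<in>{0..T}. p_ext (- \<Delta>x) t = p_ext \<Delta>x t \<and> p_ext (L + \<Delta>x) t = p_ext (L - \<Delta>x) t)"

text \<open>Spatial indices are integers because of the ghost points \<open>-1\<close> and \<open>K + 1\<close>.\<close>

definition \<delta>plus :: "real \<Rightarrow> (int \<Rightarrow> real) \<Rightarrow> int \<Rightarrow> real" where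
  "\<delta>plus \<Delta>x f k = (f (k + 1) - f k) / \<Delta>x"

definition \<delta>one :: "real \<Rightarrow> (int \<Rightarrow> real) \<Rightarrow> int \<Rightarrow> real" where
  "\<delta>one \<Delta>x f k = (f (k + 1) - f (k - 1)) / (2 * \<Delta>x)"

definition \<delta>two :: "real \<Rightarrow> (int \<Rightarrow> real) \<Rightarrow> int \<Rightarrow> real" where
  "\<delta>two \<Delta>x f k = (f (k + 1) - 2 * f k + f (k - 1)) / \<Delta>x\<^sup>2"

definition diff_quot :: "(real \<Rightarrow> real) \<Rightarrow> real \<Rightarrow> real \<Rightarrow> real" where
  "diff_quot F \<xi> \<eta> = (if \<xi> \<noteq> \<eta> then (F \<xi> - F \<eta>) / (\<xi> - \<eta>) else deriv F \<eta>)"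

text \<open>\<open>U n k\<close> and \<open>P n k\<close> stand for \<open>U\<^sub>k\<close> and \<open>P\<^sub>k\<close> at time level \<open>n\<close>.\<close>

definition scheme ::
  "real \<Rightarrow> (real \<Rightarrow> real) \<Rightarrow> nat \<Rightarrow> nat \<Rightarrow> real \<Rightarrow> real
    \<Rightarrow> (nat \<Rightarrow> int \<Rightarrow> real) \<Rightarrow> (nat \<Rightarrow> int \<Rightarrow> real) \<Rightarrow> bool" where
  "scheme \<gamma> F K N \<Delta>x \<Delta>t U P \<longleftrightarrow>
     (\<forall>n<N.
        (let V = (\<lambda>k. (U (Suc n) k + U n k) / 2) in
          (\<forall>k\<in>{0..int K}. (U (Suc n) k - U n k) / \<Delta>t = \<delta>two \<Delta>x (P n) k) \<and>
          (\<forall>k\<in>{0..int K}. P n k = - \<gamma> * \<delta>two \<Delta>x V k + diff_quot F (U (Suc n) k) (U n k)) \<and>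
          (U (Suc n) 0 - U n 0) / \<Delta>t = \<delta>one \<Delta>x V 0 \<and>
          (U (Suc n) (int K) - U n (int K)) / \<Delta>t = - \<delta>one \<Delta>x V (int K) \<and>
          \<delta>one \<Delta>x (P n) 0 = 0 \<and> \<delta>one \<Delta>x (P n) (int K) = 0))"

definition norm_Linf_d :: "nat \<Rightarrow> (int \<Rightarrow> real) \<Rightarrow> real" where
  "norm_Linf_d K f = (MAX k\<in>{0..int K}. \<bar>f k\<bar>)"

definition norm_D :: "nat \<Rightarrow> real \<Rightarrow> (int \<Rightarrow> real) \<Rightarrow> real" where
  "norm_D K \<Delta>x f = sqrt (\<Sum>k\<in>{0..int K - 1}. \<bar>\<delta>plus \<Delta>x f k\<bar>\<^sup>2 * \<Delta>x)"

definition norm_Linf :: "real set \<Rightarrow> (real \<Rightarrow> real) \<Rightarrow> ereal" where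
  "norm_Linf S f = esssup (lebesgue_on S) (\<lambda>x. ereal \<bar>f x\<bar>)"

definition bilinear_cell ::
  "real \<Rightarrow> real \<Rightarrow> (nat \<Rightarrow> int \<Rightarrow> real) \<Rightarrow> int \<Rightarrow> nat \<Rightarrow> real \<Rightarrow> real \<Rightarrow> real" where
  "bilinear_cell \<Delta>x \<Delta>t U k n x t =
     (of_int k + 1 - x / \<Delta>x) * (of_nat n + 1 - t / \<Delta>t) * U n k +
     (of_int k + 1 - x / \<Delta>x) * (t / \<Delta>t - of_nat n) * U (Suc n) k +
     (x / \<Delta>x - of_int k) * (of_nat n + 1 - t / \<Delta>t) * U n (k + 1) +
     (x / \<Delta>x - of_int k) * (t / \<Delta>t - of_nat n) * U (Suc n) (k + 1)"

text \<open>
  A point shared by several closed cells is attributed to one of them; by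
  \<open>interpolant_on_cell\<close> below the choice does not matter.
\<close>

definition interpolant ::
  "nat \<Rightarrow> nat \<Rightarrow> real \<Rightarrow> real \<Rightarrow> (nat \<Rightarrow> int \<Rightarrow> real) \<Rightarrow> real \<Rightarrow> real \<Rightarrow> real" where
  "interpolant K N \<Delta>x \<Delta>t U x t =
     bilinear_cell \<Delta>x \<Delta>t U
       (min \<lfloor>x / \<Delta>x\<rfloor> (int K - 1)) (nat (min \<lfloor>t / \<Delta>t\<rfloor> (int N - 1))) x t"

lemma linear_cell_unique:
  fixes g :: "int \<Rightarrow> real" and a :: real
  assumes "k < M" "of_int k \<le> a" "a \<le> of_int k + 1" "j = min \<lfloor>a\<rfloor> (M - 1)"
  shows "(of_int j + 1 - a) * g j + (a - of_int j) * g (j + 1) =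
         (of_int k + 1 - a) * g k + (a - of_int k) * g (k + 1)"
proof (cases "a = of_int k + 1")
  case True
  then have a: "a = of_int (k + 1)" by simp
  then have fl: "\<lfloor>a\<rfloor> = k + 1" by (simp only: floor_of_int)
  from fl assms have "j = k \<or> j = k + 1" by auto
  then show ?thesis using True by auto
next
  case False
  then have "\<lfloor>a\<rfloor> = k" using assms by linarith
  then have "j = k" using assms by simp
  then show ?thesis by simp
qed

lemma bilinear_cell_split:
  "bilinear_cell \<Delta>x \<Delta>t U k n x t =
     (of_int k + 1 - x / \<Delta>x) *
       ((of_nat n + 1 - t / \<Delta>t) * U n k + (t / \<Delta>t - of_nat n) * U (Suc n) k) +
     (x / \<Delta>x - of_int k) *
       ((of_nat n + 1 - t / \<Delta>t) * U n (k + 1) + (t / \<Delta>t - of_nat n) * U (Suc n) (k + 1))"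
  unfolding bilinear_cell_def by (simp only: distrib_left mult.assoc add.assoc)

lemma interpolant_on_cell:
  fixes k n :: nat
  assumes "\<Delta>x > 0" "\<Delta>t > 0" "k < K" "n < N"
    and x: "x \<in> {real k * \<Delta>x..(real k + 1) * \<Delta>x}"
    and t: "t \<in> {real n * \<Delta>t..(real n + 1) * \<Delta>t}"
  shows "interpolant K N \<Delta>x \<Delta>t U x t = bilinear_cell \<Delta>x \<Delta>t U (int k) n x t"
proof -
  define j where "j = min \<lfloor>x / \<Delta>x\<rfloor> (int K - 1)"
  define m where "m = min \<lfloor>t / \<Delta>t\<rfloor> (int N - 1)"
  have xb: "of_int (int k) \<le> x / \<Delta>x" "x / \<Delta>x \<le> of_int (int k) + 1"
    using x assms(1) by (auto simp: field_simps)
  have tb: "of_int (int n) \<le> t / \<Delta>t" "t / \<Delta>t \<le> of_int (int n) + 1"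
    using t assms(2) by (auto simp: field_simps)
  have "0 \<le> m" unfolding m_def using tb assms(4) by linarith
  then have rm: "real (nat m) = of_int m" and sm: "Suc (nat m) = nat (m + 1)" by auto
  have T: "(of_nat (nat m) + 1 - t / \<Delta>t) * U (nat m) i + (t / \<Delta>t - of_nat (nat m)) * U (Suc (nat m)) i
      = (of_nat n + 1 - t / \<Delta>t) * U n i + (t / \<Delta>t - of_nat n) * U (Suc n) i" for i
    using linear_cell_unique[OF _ tb m_def, of "\<lambda>q. U (nat q) i"] assms(4)
    by (simp add: rm sm nat_add_distrib)
  show ?thesis
    unfolding interpolant_def j_def[symmetric] m_def[symmetric] bilinear_cell_split T
    using linear_cell_unique[OF _ xb j_def, of "\<lambda>i. (of_nat n + 1 - t / \<Delta>t) * U n i + (t / \<Delta>t - of_nat n) * U (Suc n) i"]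
      assms(3) by simp
qed

text \<open>The suprema are maxima when the derivatives of \<open>F\<close> are continuous and \<open>C2 \<ge> 0\<close>.\<close>

definition C3_const :: "real \<Rightarrow> (real \<Rightarrow> real) \<Rightarrow> real \<Rightarrow> real \<Rightarrow> real" where
  "C3_const L F C1 C2 =
     (C1 * sqrt L * (SUP \<xi>\<in>{\<xi>. \<bar>\<xi>\<bar> \<le> C2}. \<bar>(deriv ^^ 3) F \<xi>\<bar>)
        + (SUP \<xi>\<in>{\<xi>. \<bar>\<xi>\<bar> \<le> C2}. \<bar>(deriv ^^ 2) F \<xi>\<bar>)) / 2"

end

theory Submission
  imports Defs
begin

text \<open>
  The ghost values of the scheme can be eliminated: what is left is a Neumann Laplacian, trapezoidal
  weights, and boundary terms from the dynamic boundary condition. In this form neither extension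
  enters, which is why the constant cannot depend on them. The exact solution satisfies the same
  equations up to residuals of order \<open>\<epsilon> = \<Delta>x\<^sup>2 + \<Delta>t\<^sup>2\<close>, with the exact pressure
  \<open>- \<gamma> u\<^sub>x\<^sub>x + F'(u)\<close> taken at the midpoint of a time step. The energy identity for the error then
  gives \<open>\<parallel>D e\<parallel>\<^sup>2 = O(\<epsilon>\<^sup>2)\<close> by Gronwall's inequality, the discrete mass of the error is \<open>O(\<epsilon>)\<close>, and a
  discrete Sobolev inequality turns both into a maximum norm bound. Gronwall's inequality needs a
  small time step, and the residuals need \<open>K \<ge> 2\<close>; in the remaining cases \<open>\<epsilon>\<close> is bounded below, and
  the bound \<open>C2\<close> on both solutions already gives the estimate.
\<close>

section \<open>Summation by parts on the grid\<close>

text \<open>The obstacle is the boundary: in half cells the flux residual of the exact solution is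
  only O(\<epsilon>) at the two end nodes, while it is O(h \<epsilon>) at an inner node. Every
  residual is therefore measured in the norm that its partner in the energy identity permits. The
  flux residual is paired with the pressure error q and needs just an l1 bound, because q is bounded
  pointwise: the pressure equation tested with 1 controls its mean, the dissipation controls its
  gradient. The boundary residual is paired with the velocity of the error at the ends, and the
  dynamic condition dissipates \<gamma> times the square of that velocity. The nonlinear term must
  be differenced in space, and its first difference contains the error itself times increments of
  both solutions; this is how \<open>C1\<close> enters the growth rate. Regularity is spent
  sparingly: since p_xx = u_t, four derivatives of p cost only u_txx, and the fifth space derivative
  of u is needed just for the increments of the inner pressure residual.\<close>

definition trap_weight :: "nat \<Rightarrow> real \<Rightarrow> nat \<Rightarrow> real" where
  "trap_weight K h k = (if k < K then h / 2 else 0) + (if 0 < k then h / 2 else 0)"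

text \<open>A missing neighbour contributes no flux, which is the effect of a reflected ghost value:
  for \<open>1 \<le> K\<close>, \<open>trap_weight K h k\<close> times the second difference of the
  reflected function is \<open>neumann_lap K f k / h\<close> at every node. Both definitions are
  sums over the adjacent cells that exist, so that sums over nodes turn into sums over
  cells.\<close>

definition neumann_lap :: "nat \<Rightarrow> (nat \<Rightarrow> real) \<Rightarrow> nat \<Rightarrow> real" where
  "neumann_lap K f k =
     (if k < K then f (Suc k) - f k else 0) - (if 0 < k then f k - f (k - 1) else 0)"

text \<open>This is \<open>norm_D\<close> with the powers of \<open>h\<close> collected outside the
  root. The form with \<open>L2_set\<close> makes the Minkowski and Cauchy-Schwarz inequalities
  directly applicable.\<close>

definition diff_norm :: "nat \<Rightarrow> real \<Rightarrow> (nat \<Rightarrow> real) \<Rightarrow> real" where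
  "diff_norm K h f = L2_set (\<lambda>k. f (Suc k) - f k) {..<K} / sqrt h"

lemma sum_atMost_split_forward:
  fixes f :: "nat \<Rightarrow> real"
  shows "(\<Sum>k\<le>K. if k < K then f k else 0) = (\<Sum>k<K. f k)"
  by (subst sum.inter_restrict[symmetric] sum.mono_neutral_cong_right[of _ "{..<K}"]; auto)

lemma sum_atMost_split_backward:
  fixes f :: "nat \<Rightarrow> real"
  shows "(\<Sum>k\<le>K. if 0 < k then f k else 0) = (\<Sum>k<K. f (Suc k))"
  by (cases K) (simp_all add: sum.atMost_Suc_shift lessThan_Suc_atMost del: sum.atMost_Suc)

text \<open>Each cell difference occurs twice, with \<open>w k\<close> and with
  \<open>- w (Suc k)\<close>; no boundary term arises because no flux leaves at the ends. The choice
  \<open>w = 1\<close> expresses conservation of mass.\<close>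

lemma sum_neumann_lap:
  "(\<Sum>k\<le>K. neumann_lap K f k * w k) = - (\<Sum>k<K. (f (Suc k) - f k) * (w (Suc k) - w k))"
proof -
  have "neumann_lap K f k * w k = (if k < K then (f (Suc k) - f k) * w k else 0)
      - (if 0 < k then (f k - f (k - 1)) * w k else 0)" for k
    by (auto simp: neumann_lap_def algebra_simps)
  then have "(\<Sum>k\<le>K. neumann_lap K f k * w k) =
      (\<Sum>k<K. (f (Suc k) - f k) * w k) - (\<Sum>k<K. (f (Suc k) - f k) * w (Suc k))"
    by (simp add: sum_subtractf sum_atMost_split_forward
      sum_atMost_split_backward[of "\<lambda>k. (f k - f (k - 1)) * w k"])
  then show ?thesis
    by (simp add: sum_subtractf sum_negf[symmetric] algebra_simps flip: sum.distrib)
qed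

lemma sum_trap_weight:
  "(\<Sum>k\<le>K. trap_weight K h k * f k) = (\<Sum>k<K. h / 2 * (f k + f (Suc k)))"
proof -
  have "trap_weight K h k * f k = (if k < K then h / 2 * f k else 0)
      + (if 0 < k then h / 2 * f k else 0)" for k
    by (auto simp: trap_weight_def algebra_simps)
  then show ?thesis
    by (simp add: sum.distrib sum_atMost_split_forward
      sum_atMost_split_backward[of "\<lambda>k. h / 2 * f k"] algebra_simps)
qed

lemma trap_weight_nonneg: "0 \<le> h \<Longrightarrow> 0 \<le> trap_weight K h k"
  by (auto simp: trap_weight_def)

lemma sum_trap_weight_const: "(\<Sum>k\<le>K. trap_weight K h k * c) = real K * h * c"
  by (simp add: sum_trap_weight)

lemma abs_sum_trap_weight_le:
  assumes "0 \<le> h" and "\<And>k. k \<le> K \<Longrightarrow> \<bar>f k\<bar> \<le> c"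
  shows "\<bar>\<Sum>k\<le>K. trap_weight K h k * f k\<bar> \<le> real K * h * c"
proof -
  have "\<bar>\<Sum>k\<le>K. trap_weight K h k * f k\<bar> \<le> (\<Sum>k\<le>K. trap_weight K h k * c)"
    by (rule order_trans[OF sum_abs])
      (auto intro!: sum_mono mult_left_mono simp: abs_mult trap_weight_nonneg assms)
  then show ?thesis by (simp add: sum_trap_weight_const)
qed

text \<open>The pairing for the flux residual, which is controlled in l1 while its partners are
  controlled pointwise.\<close>

lemma abs_sum_mult_le:
  fixes r q :: "nat \<Rightarrow> real"
  assumes "(\<Sum>k\<le>K. \<bar>r k\<bar>) \<le> a" and "\<And>k. k \<le> K \<Longrightarrow> \<bar>q k\<bar> \<le> b"
  shows "\<bar>\<Sum>k\<le>K. r k * q k\<bar> \<le> a * b"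
proof -
  have b: "0 \<le> b" using assms(2)[of 0] by simp
  have "\<bar>\<Sum>k\<le>K. r k * q k\<bar> \<le> (\<Sum>k\<le>K. \<bar>r k\<bar> * b)"
    by (rule order_trans[OF sum_abs]) (auto intro!: sum_mono mult_left_mono simp: abs_mult assms)
  also have "\<dots> \<le> a * b"
    unfolding sum_distrib_right[symmetric] using assms(1) b by (rule mult_right_mono)
  finally show ?thesis .
qed

lemma sum_boundary:
  fixes f :: "nat \<Rightarrow> real"
  assumes "1 \<le> K"
  shows "(\<Sum>k\<le>K. if k = 0 \<or> k = K then f k else 0) = f 0 + f K"
proof -
  have "(\<Sum>k\<le>K. if k = 0 \<or> k = K then f k else 0) = (\<Sum>k\<in>{0, K}. f k)"
    by (rule sum.mono_neutral_cong_right) auto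
  with assms show ?thesis by simp
qed

section \<open>The discrete gradient norm, total variation and a Sobolev inequality\<close>

lemma diff_norm_nonneg: "0 \<le> h \<Longrightarrow> 0 \<le> diff_norm K h f"
  by (simp add: diff_norm_def)

lemma diff_norm_sq:
  "0 < h \<Longrightarrow> (diff_norm K h f)\<^sup>2 = (\<Sum>k<K. (f (Suc k) - f k)\<^sup>2) / h"
  by (simp add: diff_norm_def power_divide L2_set_def sum_nonneg)

lemma diff_norm_Cauchy:
  assumes "0 < h"
  shows "\<bar>\<Sum>k<K. (f (Suc k) - f k) * (w (Suc k) - w k)\<bar> / h \<le> diff_norm K h f * diff_norm K h w"
proof -
  have "\<bar>\<Sum>k<K. (f (Suc k) - f k) * (w (Suc k) - w k)\<bar>
      \<le> (\<Sum>k<K. \<bar>f (Suc k) - f k\<bar> * \<bar>w (Suc k) - w k\<bar>)"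
    by (rule order_trans[OF sum_abs]) (simp add: abs_mult)
  also have "\<dots> \<le> L2_set (\<lambda>k. f (Suc k) - f k) {..<K} * L2_set (\<lambda>k. w (Suc k) - w k) {..<K}"
    by (rule L2_set_mult_ineq)
  finally show ?thesis using assms by (simp add: diff_norm_def divide_right_mono)
qed

text \<open>Cauchy-Schwarz against the constant 1, whose l2 norm over \<open>K\<close> cells is sqrt
  K; the total variation thus costs the square root of the length \<open>K * h\<close>.\<close>

lemma sum_abs_diff_le:
  assumes "0 < h"
  shows "(\<Sum>k<K. \<bar>f (Suc k) - f k\<bar>) \<le> sqrt (real K * h) * diff_norm K h f"
proof -
  have "(\<Sum>k<K. \<bar>1\<bar> * \<bar>f (Suc k) - f k\<bar>)
      \<le> L2_set (\<lambda>k. 1) {..<K} * L2_set (\<lambda>k. f (Suc k) - f k) {..<K}"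
    by (rule L2_set_mult_ineq)
  also have "\<dots> = sqrt (real K * h) * diff_norm K h f"
    using assms by (simp add: diff_norm_def L2_set_def real_sqrt_mult)
  finally show ?thesis by simp
qed

lemma abs_diff_le_sum_steps:
  fixes f :: "nat \<Rightarrow> real"
  assumes "i \<le> K" "j \<le> K"
  shows "\<bar>f j - f i\<bar> \<le> (\<Sum>k<K. \<bar>f (Suc k) - f k\<bar>)"
proof -
  have le: "\<bar>f b - f a\<bar> \<le> (\<Sum>k<K. \<bar>f (Suc k) - f k\<bar>)" if "a \<le> b" "b \<le> K" for a b
  proof -
    have "\<bar>f b - f a\<bar> \<le> (\<Sum>k=a..<b. \<bar>f (Suc k) - f k\<bar>)"
      using sum_Suc_diff'[OF that(1), of f] by (metis sum_abs)
    also have "\<dots> \<le> (\<Sum>k<K. \<bar>f (Suc k) - f k\<bar>)"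
      by (rule sum_mono2) (use that in auto)
    finally show ?thesis .
  qed
  show ?thesis using le[of i j] le[of j i] assms by (cases "i \<le> j") (auto simp: abs_minus_commute)
qed

text \<open>The weights add up to \<open>L\<close>, so \<open>f j\<close> is the weighted mean of
  \<open>f\<close> plus the weighted mean of the differences \<open>f j - f k\<close>, each at most
  the total variation. The mean must be carried along because \<open>diff_norm\<close> vanishes on
  constants.\<close>

lemma discrete_Sobolev:
  assumes "0 < h" "1 \<le> K" "L = real K * h" "j \<le> K"
  shows "\<bar>f j\<bar> \<le> \<bar>\<Sum>k\<le>K. trap_weight K h k * f k\<bar> / L + sqrt L * diff_norm K h f"
proof -
  let ?S = "sqrt L * diff_norm K h f"
  have L: "0 < L" using assms by simp
  have *: "L * f j = (\<Sum>k\<le>K. trap_weight K h k * f k) + (\<Sum>k\<le>K. trap_weight K h k * (f j - f k))"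
    using sum_trap_weight_const[of K h "f j"] assms(3)
    by (simp add: algebra_simps sum_subtractf)
  have "\<bar>\<Sum>k\<le>K. trap_weight K h k * (f j - f k)\<bar> \<le> L * ?S"
    unfolding assms(3)
    using abs_diff_le_sum_steps[of _ K j f] sum_abs_diff_le[OF assms(1), of f K] assms
    by (intro abs_sum_trap_weight_le) (auto intro: order_trans)
  with * have "\<bar>L * f j\<bar> \<le> \<bar>\<Sum>k\<le>K. trap_weight K h k * f k\<bar> + L * ?S" by linarith
  then have "\<bar>f j\<bar> \<le> (\<bar>\<Sum>k\<le>K. trap_weight K h k * f k\<bar> + L * ?S) / L"
    using L by (simp add: abs_mult field_simps)
  then show ?thesis using L by (simp add: add_divide_distrib)
qed

text \<open>Minkowski's inequality. The function \<open>g\<close> collects the part of the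
  increments that is not itself made of increments of \<open>e0\<close> and
  \<open>e1\<close>.\<close>

lemma diff_norm_le:
  assumes h: "0 < h" and ab: "0 \<le> a" "0 \<le> b"
    and "\<And>k. k < K \<Longrightarrow> \<bar>f (Suc k) - f k\<bar> \<le>
      a * (\<bar>e0 (Suc k) - e0 k\<bar> + \<bar>e1 (Suc k) - e1 k\<bar>) + b * g k"
  shows "diff_norm K h f \<le> a * (diff_norm K h e0 + diff_norm K h e1) + b * (L2_set g {..<K} / sqrt h)"
proof -
  let ?d = "\<lambda>e k. \<bar>e (Suc k) - e k :: real\<bar>"
  have L: "L2_set (?d e) {..<K} = L2_set (\<lambda>k. e (Suc k) - e k) {..<K}" for e
    by (simp add: L2_set_def)
  have "L2_set (\<lambda>k. f (Suc k) - f k) {..<K} = L2_set (?d f) {..<K}" by (simp add: L)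
  also have "\<dots> \<le> L2_set (\<lambda>k. (a * ?d e0 k + a * ?d e1 k) + b * g k) {..<K}"
    using assms(4) by (intro L2_set_mono) (auto simp: algebra_simps)
  also have "\<dots> \<le> L2_set (\<lambda>k. a * ?d e0 k + a * ?d e1 k) {..<K} + L2_set (\<lambda>k. b * g k) {..<K}"
    by (rule L2_set_triangle_ineq)
  also have "\<dots> \<le> (L2_set (\<lambda>k. a * ?d e0 k) {..<K} + L2_set (\<lambda>k. a * ?d e1 k) {..<K})
      + L2_set (\<lambda>k. b * g k) {..<K}"
    by (intro add_right_mono L2_set_triangle_ineq)
  also have "\<dots> = a * (L2_set (\<lambda>k. e0 (Suc k) - e0 k) {..<K} + L2_set (\<lambda>k. e1 (Suc k) - e1 k) {..<K})
      + b * L2_set g {..<K}"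
    using ab by (simp add: L2_set_right_distrib[symmetric] L algebra_simps)
  finally have "L2_set (\<lambda>k. f (Suc k) - f k) {..<K} / sqrt h \<le> \<dots> / sqrt h"
    using h by (intro divide_right_mono) auto
  then show ?thesis by (simp add: diff_norm_def add_divide_distrib distrib_left)
qed

section \<open>The energy estimate\<close>

text \<open>The constant that the energy argument leaves. \<open>m\<close> is the Sobolev factor for
  both errors together and \<open>c\<close> adds up the coefficients of all cross terms. Young's
  inequality leaves c^2/4 after absorbing the pressure gradient and c^2/(2 \<gamma>) after absorbing
  the two boundary velocities. The 3 comes from squaring a sum of three terms, and 2/\<gamma> from
  the factor of the energy difference.\<close>

definition energy_rate :: "real \<Rightarrow> real \<Rightarrow> real \<Rightarrow> real \<Rightarrow> real \<Rightarrow> real" where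
  "energy_rate L \<gamma> R M G =
     (let m = 2 * R / L + sqrt L;
          c = R * (\<gamma> / L) + R * sqrt L + R * (2 * R / L + M * m + R) +
              (M + M * m * G + sqrt L * R) + R * (M * m + R) + R
      in 2 / \<gamma> * (3 * (c\<^sup>2 / 4 + c\<^sup>2 / (2 * \<gamma>) + c)))"

lemma Young_absorb:
  fixes X Y c a :: real
  assumes "0 < a"
  shows "c * Y * X \<le> a * X\<^sup>2 + c\<^sup>2 * Y\<^sup>2 / (4 * a)"
proof -
  have "0 \<le> (2 * a * X - c * Y)\<^sup>2" by simp
  then have "4 * a * (c * Y * X) \<le> 4 * a * (a * X\<^sup>2) + c\<^sup>2 * Y\<^sup>2"
    by (simp add: power2_eq_square algebra_simps)
  then show ?thesis using assms by (simp add: field_simps)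
qed

text \<open>
  The first evolution equation is tested with \<open>q\<close> and the second with the time difference of \<open>e\<close>.
  What remains, the product of \<open>D - s\<close> with that time difference, has no sign and no bound of its
  own; testing the first equation with \<open>D - s\<close> turns it into a product of first differences, which
  is why first differences of \<open>D\<close> and \<open>s\<close> must be controlled.
\<close>

lemma energy_step:
  fixes e0 e1 q \<rho> s \<sigma> D g :: "nat \<Rightarrow> real"
  assumes K: "1 \<le> K" and h: "0 < h" and L: "L = real K * h" and \<gamma>: "0 < \<gamma>" and dt: "0 < dt"
    and nn: "0 \<le> \<epsilon>" "0 \<le> R" "0 \<le> M" "0 \<le> G"
    and A: "\<And>k. k \<le> K \<Longrightarrow>
      trap_weight K h k * ((e1 k - e0 k) / dt) = neumann_lap K q k / h - \<rho> k"
    and B: "\<And>k. k \<le> K \<Longrightarrow>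
      trap_weight K h k * q k = - \<gamma> * neumann_lap K (\<lambda>k. (e1 k + e0 k) / 2) k / h
        + (if k = 0 \<or> k = K then \<gamma> * ((e1 k - e0 k) / dt) - \<sigma> k else 0)
        + trap_weight K h k * (D k - s k)"
    and \<rho>: "(\<Sum>k\<le>K. \<bar>\<rho> k\<bar>) \<le> R * \<epsilon>"
    and s: "\<And>k. k \<le> K \<Longrightarrow> \<bar>s k\<bar> \<le> R * \<epsilon>"
    and ds: "\<And>k. k < K \<Longrightarrow> \<bar>s (Suc k) - s k\<bar> \<le> h * (R * \<epsilon>)"
    and \<sigma>: "\<And>k. k \<le> K \<Longrightarrow> \<bar>\<sigma> k\<bar> \<le> R * \<epsilon>"
    and D: "\<And>k. k \<le> K \<Longrightarrow> \<bar>D k\<bar> \<le> M * (\<bar>e0 k\<bar> + \<bar>e1 k\<bar>)"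
    and dD: "\<And>k. k < K \<Longrightarrow> \<bar>D (Suc k) - D k\<bar> \<le>
      M * (\<bar>e0 (Suc k) - e0 k\<bar> + \<bar>e1 (Suc k) - e1 k\<bar>) + M * (\<bar>e0 k\<bar> + \<bar>e1 k\<bar>) * g k"
    and g: "\<And>k. 0 \<le> g k" "L2_set g {..<K} / sqrt h \<le> G"
    and mean: "\<bar>\<Sum>k\<le>K. trap_weight K h k * e0 k\<bar> \<le> R * \<epsilon>"
      "\<bar>\<Sum>k\<le>K. trap_weight K h k * e1 k\<bar> \<le> R * \<epsilon>"
  shows "(diff_norm K h e1)\<^sup>2 - (diff_norm K h e0)\<^sup>2
    \<le> energy_rate L \<gamma> R M G * dt * (\<epsilon>\<^sup>2 + (diff_norm K h e0)\<^sup>2 + (diff_norm K h e1)\<^sup>2)"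
proof -
  define \<omega> where "\<omega> = trap_weight K h"
  define a0 where "a0 = diff_norm K h e0"
  define a1 where "a1 = diff_norm K h e1"
  define X where "X = diff_norm K h q"
  define v where "v k = (e1 k - e0 k) / dt" for k
  \<comment> \<open>The ends are the only nodes where the energy identity controls the velocity
    \<open>v\<close>, through \<gamma> times its square from the dynamic boundary condition.\<close>
  define b where "b = \<bar>v 0\<bar> + \<bar>v K\<bar>"
  define y where "y = \<epsilon> + a0 + a1"
  define z where "z k = D k - s k" for k
  define m where "m = 2 * R / L + sqrt L"
  define c where "c = R * (\<gamma> / L) + R * sqrt L + R * (2 * R / L + M * m + R) +
              (M + M * m * G + sqrt L * R) + R * (M * m + R) + R"
  have rate: "energy_rate L \<gamma> R M G = 2 / \<gamma> * (3 * (c\<^sup>2 / 4 + c\<^sup>2 / (2 * \<gamma>) + c))"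
    by (simp add: energy_rate_def Let_def c_def m_def)
  have L0: "0 < L" using K h L by simp
  have m0: "0 \<le> m" using L0 nn by (simp add: m_def)
  have c0: "0 \<le> c" using L0 nn m0 \<gamma> by (simp add: c_def)
  have a: "0 \<le> a0" "0 \<le> a1" "0 \<le> X" using h by (simp_all add: a0_def a1_def X_def diff_norm_nonneg)
  have y: "\<epsilon> \<le> y" "a0 + a1 \<le> y" "0 \<le> y" using a nn by (simp_all add: y_def)
  have b0: "0 \<le> b" by (simp add: b_def)
  have Ry: "R * \<epsilon> \<le> R * y" using y(1) nn(2) by (rule mult_left_mono)
  have Ry0: "0 \<le> R * y" using nn y by simp
  have e: "\<bar>e0 k\<bar> + \<bar>e1 k\<bar> \<le> m * y" if "k \<le> K" for k
  proof -
    have "\<bar>e0 k\<bar> \<le> R * \<epsilon> / L + sqrt L * a0"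
      using discrete_Sobolev[OF h K L that, of e0] divide_right_mono[OF mean(1) less_imp_le[OF L0]]
      by (simp add: a0_def)
    moreover have "\<bar>e1 k\<bar> \<le> R * \<epsilon> / L + sqrt L * a1"
      using discrete_Sobolev[OF h K L that, of e1] divide_right_mono[OF mean(2) less_imp_le[OF L0]]
      by (simp add: a1_def)
    ultimately have "\<bar>e0 k\<bar> + \<bar>e1 k\<bar> \<le> 2 * (R * \<epsilon>) / L + sqrt L * (a0 + a1)"
      by (simp add: distrib_left)
    also have "\<dots> \<le> 2 * (R * y) / L + sqrt L * y"
      using Ry y L0 by (intro add_mono divide_right_mono mult_left_mono) (use nn in auto)
    finally show ?thesis by (simp add: m_def algebra_simps)
  qed
  have D': "\<bar>D k\<bar> \<le> M * m * y" if "k \<le> K" for k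
    using D[OF that] mult_left_mono[OF e[OF that] nn(3)] by (simp add: mult.assoc)
  have z: "\<bar>z k\<bar> \<le> (M * m + R) * y" if "k \<le> K" for k
    using D'[OF that] s[OF that] Ry abs_triangle_ineq4[of "D k" "s k"]
    by (simp add: z_def distrib_right)
  \<comment> \<open>The error, bounded pointwise by \<open>m * y\<close>, multiplies
    \<open>g\<close>, which is bounded only in l2. The constant \<open>h * (R * \<epsilon>)\<close>
    has l2 norm sqrt K times itself, hence the factor sqrt L after division by sqrt h.\<close>
  have dz: "diff_norm K h z \<le> (M + M * m * G + sqrt L * R) * y"
  proof -
    have gG: "L2_set (\<lambda>k. M * (m * y) * g k + h * (R * \<epsilon>)) {..<K} / sqrt h
        \<le> M * (m * y) * G + sqrt L * (R * \<epsilon>)"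
    proof -
      have "L2_set (\<lambda>k. M * (m * y) * g k + h * (R * \<epsilon>)) {..<K}
        \<le> L2_set (\<lambda>k. M * (m * y) * g k) {..<K} + L2_set (\<lambda>k. h * (R * \<epsilon>)) {..<K}"
        by (rule L2_set_triangle_ineq)
      also have "\<dots> = M * (m * y) * L2_set g {..<K} + sqrt (real K) * (h * (R * \<epsilon>))"
        using nn m0 y h
        by (simp add: L2_set_right_distrib[symmetric]) (simp add: L2_set_def real_sqrt_mult)
      finally have "L2_set (\<lambda>k. M * (m * y) * g k + h * (R * \<epsilon>)) {..<K} / sqrt h
        \<le> (M * (m * y) * L2_set g {..<K} + sqrt (real K) * (h * (R * \<epsilon>))) / sqrt h"
        using h by (intro divide_right_mono) auto
      also have "\<dots> = M * (m * y) * (L2_set g {..<K} / sqrt h) + sqrt L * (R * \<epsilon>)"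
        using h real_sqrt_mult_self[of h] unfolding L
        by (simp add: real_sqrt_mult field_simps)
      also have "\<dots> \<le> M * (m * y) * G + sqrt L * (R * \<epsilon>)"
        using g(2) nn m0 y by (intro add_right_mono mult_left_mono) auto
      finally show ?thesis .
    qed
    have "\<bar>z (Suc k) - z k\<bar> \<le> M * (\<bar>e0 (Suc k) - e0 k\<bar> + \<bar>e1 (Suc k) - e1 k\<bar>)
        + 1 * (M * (m * y) * g k + h * (R * \<epsilon>))" if "k < K" for k
    proof -
      have "M * (\<bar>e0 k\<bar> + \<bar>e1 k\<bar>) * g k \<le> M * (m * y) * g k"
        using e[of k] that nn g(1) by (intro mult_right_mono mult_left_mono) auto
      then show ?thesis using dD[OF that] ds[OF that] unfolding z_def mult_1 by linarith
    qed
    then have "diff_norm K h z \<le> M * (a0 + a1)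
        + 1 * (L2_set (\<lambda>k. M * (m * y) * g k + h * (R * \<epsilon>)) {..<K} / sqrt h)"
      unfolding a0_def a1_def using nn by (intro diff_norm_le[OF h]) auto
    also have "\<dots> \<le> M * y + (M * (m * y) * G + sqrt L * (R * y))"
    proof -
      have "M * (a0 + a1) \<le> M * y" "sqrt L * (R * \<epsilon>) \<le> sqrt L * (R * y)"
        using y Ry L0 nn by (simp_all add: mult_left_mono)
      then show ?thesis using gG by linarith
    qed
    finally show ?thesis by (simp add: algebra_simps)
  qed
  have lin: "(\<Sum>k\<le>K. neumann_lap K f k / h * w k)
      = - (\<Sum>k<K. (f (Suc k) - f k) * (w (Suc k) - w k)) / h" for f w
  proof -
    have "(\<Sum>k\<le>K. neumann_lap K f k / h * w k) = (\<Sum>k\<le>K. neumann_lap K f k * w k) / h"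
      by (simp add: sum_divide_distrib)
    then show ?thesis by (simp only: sum_neumann_lap)
  qed
  have testA: "(\<Sum>k\<le>K. \<omega> k * v k * w k)
      = - (\<Sum>k<K. (q (Suc k) - q k) * (w (Suc k) - w k)) / h - (\<Sum>k\<le>K. \<rho> k * w k)" for w
  proof -
    have "(\<Sum>k\<le>K. \<omega> k * v k * w k) = (\<Sum>k\<le>K. neumann_lap K q k / h * w k - \<rho> k * w k)"
      using A by (intro sum.cong refl) (simp add: \<omega>_def v_def left_diff_distrib)
    then show ?thesis by (simp only: sum_subtractf lin)
  qed
  have testB: "(\<Sum>k\<le>K. \<omega> k * q k * w k)
      = \<gamma> * ((\<Sum>k<K. ((e1 (Suc k) + e0 (Suc k)) / 2 - (e1 k + e0 k) / 2) * (w (Suc k) - w k)) / h)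
        + (\<gamma> * (v 0 * w 0 + v K * w K) - (\<sigma> 0 * w 0 + \<sigma> K * w K)) + (\<Sum>k\<le>K. \<omega> k * z k * w k)" for w
  proof -
    have "(\<Sum>k\<le>K. \<omega> k * q k * w k) = (\<Sum>k\<le>K.
        - \<gamma> * (neumann_lap K (\<lambda>k. (e1 k + e0 k) / 2) k / h * w k)
        + (if k = 0 \<or> k = K then \<gamma> * (v k * w k) - \<sigma> k * w k else 0) + \<omega> k * z k * w k)"
    proof (rule sum.cong[OF refl])
      fix k assume "k \<in> {..K}"
      then have "\<omega> k * q k = - \<gamma> * neumann_lap K (\<lambda>k. (e1 k + e0 k) / 2) k / h
        + (if k = 0 \<or> k = K then \<gamma> * v k - \<sigma> k else 0) + \<omega> k * z k"
        using B[of k] by (simp add: \<omega>_def v_def z_def)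
      from arg_cong[OF this, of "\<lambda>x. x * w k"] show "\<omega> k * q k * w k = - \<gamma> * (neumann_lap K (\<lambda>k. (e1 k + e0 k) / 2) k / h * w k)
        + (if k = 0 \<or> k = K then \<gamma> * (v k * w k) - \<sigma> k * w k else 0) + \<omega> k * z k * w k"
        by (simp add: algebra_simps)
    qed
    also have "\<dots> = - \<gamma> * (\<Sum>k\<le>K. neumann_lap K (\<lambda>k. (e1 k + e0 k) / 2) k / h * w k)
        + (\<gamma> * (v 0 * w 0) - \<sigma> 0 * w 0 + (\<gamma> * (v K * w K) - \<sigma> K * w K)) + (\<Sum>k\<le>K. \<omega> k * z k * w k)"
      by (simp only: sum.distrib sum_boundary[OF K] sum_distrib_left)
    finally show ?thesis unfolding lin by (simp add: algebra_simps)
  qed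
  have \<sigma>y: "\<bar>\<sigma> k\<bar> \<le> R * y" if "k \<le> K" for k using \<sigma>[OF that] Ry by simp
  \<comment> \<open>Testing the pressure equation with 1 removes the gradient term. What remains are
    velocities and residuals at the ends and the mean of \<open>z\<close>; the uncontrolled inner
    values of \<open>v\<close> do not occur.\<close>
  have mean_q: "\<bar>\<Sum>k\<le>K. \<omega> k * q k\<bar> \<le> \<gamma> * b + 2 * (R * y) + L * ((M * m + R) * y)"
  proof -
    have "\<bar>\<Sum>k\<le>K. \<omega> k * z k\<bar> \<le> L * ((M * m + R) * y)"
      unfolding \<omega>_def L using z h by (intro abs_sum_trap_weight_le) auto
    moreover have "\<bar>\<gamma> * (v 0 + v K)\<bar> \<le> \<gamma> * b"
      using \<gamma> by (simp add: abs_mult b_def)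
    moreover have "\<bar>\<sigma> 0\<bar> \<le> R * y" "\<bar>\<sigma> K\<bar> \<le> R * y" using \<sigma>y by auto
    ultimately show ?thesis using testB[of "\<lambda>k. 1"] by simp
  qed
  have q: "\<bar>q k\<bar> \<le> \<gamma> / L * b + (2 * R / L + M * m + R) * y + sqrt L * X" if "k \<le> K" for k
  proof -
    have "\<bar>q k\<bar> \<le> (\<gamma> * b + 2 * (R * y) + L * ((M * m + R) * y)) / L + sqrt L * X"
      using discrete_Sobolev[OF h K L that, of q] divide_right_mono[OF mean_q less_imp_le[OF L0]]
      by (simp add: X_def \<omega>_def)
    also have "\<dots> = \<gamma> / L * b + (2 * R / L + M * m + R) * y + sqrt L * X"
      using L0 by (simp add: field_simps)
    finally show ?thesis .
  qed
  have XX: "(\<Sum>k<K. (q (Suc k) - q k) * (q (Suc k) - q k)) / h = X\<^sup>2"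
    unfolding X_def diff_norm_sq[OF h] by (simp add: power2_eq_square)
  \<comment> \<open>An average times a difference is half a difference of squares: averaging the two
    time levels makes the energy telescope exactly.\<close>
  have dE: "(\<Sum>k<K. ((e1 (Suc k) + e0 (Suc k)) / 2 - (e1 k + e0 k) / 2) * (v (Suc k) - v k)) / h
      = (a1\<^sup>2 - a0\<^sup>2) / (2 * dt)"
  proof -
    have "((e1 (Suc k) + e0 (Suc k)) / 2 - (e1 k + e0 k) / 2) * (v (Suc k) - v k)
      = ((e1 (Suc k) - e1 k)\<^sup>2 - (e0 (Suc k) - e0 k)\<^sup>2) / (2 * dt)" for k
      using dt by (simp add: v_def power2_eq_square field_simps)
    then have "(\<Sum>k<K. ((e1 (Suc k) + e0 (Suc k)) / 2 - (e1 k + e0 k) / 2) * (v (Suc k) - v k))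
      = ((\<Sum>k<K. (e1 (Suc k) - e1 k)\<^sup>2) - (\<Sum>k<K. (e0 (Suc k) - e0 k)\<^sup>2)) / (2 * dt)"
      by (simp only: sum_subtractf sum_divide_distrib[symmetric])
    also have "\<dots> / h = (a1\<^sup>2 - a0\<^sup>2) / (2 * dt)"
      using h by (simp only: a0_def a1_def diff_norm_sq diff_divide_distrib divide_divide_eq_left mult.commute)
    finally show ?thesis .
  qed
  have id: "X\<^sup>2 + \<gamma> * ((a1\<^sup>2 - a0\<^sup>2) / (2 * dt)) + \<gamma> * ((v 0)\<^sup>2 + (v K)\<^sup>2)
     = - (\<Sum>k\<le>K. \<rho> k * q k) + (\<sigma> 0 * v 0 + \<sigma> K * v K)
       + (\<Sum>k<K. (q (Suc k) - q k) * (z (Suc k) - z k)) / h + (\<Sum>k\<le>K. \<rho> k * z k)"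
  proof -
    have "(\<Sum>k\<le>K. \<omega> k * v k * q k) = (\<Sum>k\<le>K. \<omega> k * q k * v k)"
      "(\<Sum>k\<le>K. \<omega> k * v k * z k) = (\<Sum>k\<le>K. \<omega> k * z k * v k)"
      by (simp_all add: mult_ac)
    moreover have "(\<Sum>k\<le>K. \<omega> k * v k * q k) = - X\<^sup>2 - (\<Sum>k\<le>K. \<rho> k * q k)"
      using testA[of q] XX by (simp only: minus_divide_left[symmetric])
    moreover have "(\<Sum>k\<le>K. \<omega> k * q k * v k) = \<gamma> * ((a1\<^sup>2 - a0\<^sup>2) / (2 * dt))
        + (\<gamma> * ((v 0)\<^sup>2 + (v K)\<^sup>2) - (\<sigma> 0 * v 0 + \<sigma> K * v K)) + (\<Sum>k\<le>K. \<omega> k * z k * v k)"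
      using testB[of v] dE by (simp only: power2_eq_square)
    moreover have "(\<Sum>k\<le>K. \<omega> k * v k * z k)
        = - ((\<Sum>k<K. (q (Suc k) - q k) * (z (Suc k) - z k)) / h) - (\<Sum>k\<le>K. \<rho> k * z k)"
      using testA[of z] by (simp only: minus_divide_left[symmetric])
    ultimately show ?thesis by linarith
  qed
  have t1: "\<bar>\<Sum>k\<le>K. \<rho> k * q k\<bar>
      \<le> R * y * (\<gamma> / L * b + (2 * R / L + M * m + R) * y + sqrt L * X)"
    using \<rho> Ry q by (intro abs_sum_mult_le) auto
  have t2: "\<bar>\<Sum>k\<le>K. \<rho> k * z k\<bar> \<le> R * y * ((M * m + R) * y)"
    using \<rho> Ry z by (intro abs_sum_mult_le) auto
  have t3: "\<bar>(\<Sum>k<K. (q (Suc k) - q k) * (z (Suc k) - z k)) / h\<bar>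
      \<le> X * ((M + M * m * G + sqrt L * R) * y)"
    using diff_norm_Cauchy[OF h, of q z K] mult_left_mono[OF dz a(3)] h by (simp add: X_def)
  have t4: "\<bar>\<sigma> 0 * v 0 + \<sigma> K * v K\<bar> \<le> R * y * b"
  proof -
    have "\<bar>\<sigma> 0 * v 0\<bar> \<le> R * y * \<bar>v 0\<bar>" "\<bar>\<sigma> K * v K\<bar> \<le> R * y * \<bar>v K\<bar>"
      unfolding abs_mult using \<sigma>y by (auto intro!: mult_right_mono)
    then show ?thesis by (simp add: b_def distrib_left)
  qed
  have "X\<^sup>2 + \<gamma> * ((a1\<^sup>2 - a0\<^sup>2) / (2 * dt)) + \<gamma> * ((v 0)\<^sup>2 + (v K)\<^sup>2)
      \<le> c * y * (X + b + y)"
  proof -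
    define T where "T = R * y * (\<gamma> / L * b + (2 * R / L + M * m + R) * y + sqrt L * X)
        + R * y * ((M * m + R) * y) + X * ((M + M * m * G + sqrt L * R) * y) + R * y * b"
    have "X\<^sup>2 + \<gamma> * ((a1\<^sup>2 - a0\<^sup>2) / (2 * dt)) + \<gamma> * ((v 0)\<^sup>2 + (v K)\<^sup>2) \<le> T"
      using id t1 t2 t3 t4 unfolding T_def by linarith
    also have "T \<le> c * y * (X + b + y)"
    proof -
      define c1 where "c1 = R * (\<gamma> / L)"
      define c2 where "c2 = R * sqrt L"
      define c3 where "c3 = R * (2 * R / L + M * m + R)"
      define c4 where "c4 = M + M * m * G + sqrt L * R"
      define c5 where "c5 = R * (M * m + R)"
      have nn': "0 \<le> c1" "0 \<le> c2" "0 \<le> c3" "0 \<le> c4" "0 \<le> c5"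
        using nn \<gamma> L0 m0 by (simp_all add: c1_def c2_def c3_def c4_def c5_def)
      have cs: "c = c1 + c2 + c3 + c4 + c5 + R"
        by (simp only: c_def c1_def c2_def c3_def c4_def c5_def)
      have le: "c1 + R \<le> c" "c3 + c5 \<le> c" "c2 + c4 \<le> c"
        using nn' nn by (simp_all add: cs)
      have "T = y * ((c1 + R) * b + (c3 + c5) * y + (c2 + c4) * X)"
        by (simp add: T_def c1_def c2_def c3_def c4_def c5_def algebra_simps)
      also have "\<dots> \<le> y * (c * b + c * y + c * X)"
        by (intro mult_left_mono add_mono mult_right_mono le y(3) b0 a(3))
      finally show ?thesis by (simp add: algebra_simps)
    qed
    finally show ?thesis .
  qed
  also have "\<dots> = c * y * X + c * y * \<bar>v 0\<bar> + c * y * \<bar>v K\<bar> + c * y\<^sup>2"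
    by (simp add: b_def algebra_simps power2_eq_square)
  \<comment> \<open>Young's inequality with weight 1 for \<open>X\<close> and weight \<gamma> at
    each end. The squares it produces are exactly the dissipative terms on the left and cancel
    against them.\<close>
  also have "\<dots> \<le> X\<^sup>2 + \<gamma> * ((v 0)\<^sup>2 + (v K)\<^sup>2) + (c\<^sup>2 / 4 + c\<^sup>2 / (2 * \<gamma>) + c) * y\<^sup>2"
  proof -
    have "(c\<^sup>2 / 4 + c\<^sup>2 / (2 * \<gamma>) + c) * y\<^sup>2
        = c\<^sup>2 * y\<^sup>2 / 4 + 2 * (c\<^sup>2 * y\<^sup>2 / (4 * \<gamma>)) + c * y\<^sup>2"
      by (simp add: algebra_simps)
    then show ?thesis
      using Young_absorb[of 1 c y X] Young_absorb[OF \<gamma>, of c y "\<bar>v 0\<bar>"]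
        Young_absorb[OF \<gamma>, of c y "\<bar>v K\<bar>"]
      by (simp add: distrib_left)
  qed
  finally have "\<gamma> * ((a1\<^sup>2 - a0\<^sup>2) / (2 * dt)) \<le> (c\<^sup>2 / 4 + c\<^sup>2 / (2 * \<gamma>) + c) * y\<^sup>2" by simp
  also have "\<dots> \<le> (c\<^sup>2 / 4 + c\<^sup>2 / (2 * \<gamma>) + c) * (3 * (\<epsilon>\<^sup>2 + a0\<^sup>2 + a1\<^sup>2))"
  proof -
    have "0 \<le> (\<epsilon> - a0)\<^sup>2 + (\<epsilon> - a1)\<^sup>2 + (a0 - a1)\<^sup>2" by simp
    then have "y\<^sup>2 \<le> 3 * (\<epsilon>\<^sup>2 + a0\<^sup>2 + a1\<^sup>2)"
      by (simp add: y_def power2_eq_square algebra_simps)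
    then show ?thesis using c0 \<gamma> by (intro mult_left_mono) auto
  qed
  finally have "\<gamma> * ((a1\<^sup>2 - a0\<^sup>2) / (2 * dt))
      \<le> (c\<^sup>2 / 4 + c\<^sup>2 / (2 * \<gamma>) + c) * (3 * (\<epsilon>\<^sup>2 + a0\<^sup>2 + a1\<^sup>2))" .
  from mult_left_mono[OF this, of "2 / \<gamma> * dt"]
  have "a1\<^sup>2 - a0\<^sup>2 \<le> 2 / \<gamma> * dt * ((c\<^sup>2 / 4 + c\<^sup>2 / (2 * \<gamma>) + c) * (3 * (\<epsilon>\<^sup>2 + a0\<^sup>2 + a1\<^sup>2)))"
    using \<gamma> dt by simp
  then show ?thesis unfolding rate a0_def a1_def by (simp only: mult_ac)
qed

section \<open>Gronwall and Taylor estimates\<close>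

text \<open>The recursion is implicit, as \<open>y (Suc n)\<close> also stands on the right. Adding
  \<open>a\<close> to \<open>y\<close> makes it homogeneous with factor (1 + \<kappa>) / (1 -
  \<kappa>), which smallness of \<kappa> turns into 1 + 4 \<kappa>.\<close>

lemma discrete_Gronwall:
  fixes y :: "nat \<Rightarrow> real"
  assumes "0 \<le> a" "y 0 \<le> 0" "0 \<le> \<kappa>" "\<kappa> \<le> 1 / 2"
    and step: "\<And>n. n < N \<Longrightarrow> y (Suc n) - y n \<le> \<kappa> * (a + y n + y (Suc n))"
    and pos: "\<And>n. n \<le> N \<Longrightarrow> 0 \<le> y n"
    and "n \<le> N"
  shows "y n \<le> exp (4 * \<kappa> * real n) * a"
proof -
  have "y n + a \<le> (1 + 4 * \<kappa>) ^ n * a" using \<open>n \<le> N\<close>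
  proof (induction n)
    case 0
    then show ?case using assms by simp
  next
    case (Suc n)
    \<comment> \<open>The right side exceeds the left by 2 \<kappa> (1 - 2 \<kappa>), which is where
      \<open>\<kappa> \<le> 1 / 2\<close> is needed.\<close>
    have *: "(1 + \<kappa>) \<le> (1 + 4 * \<kappa>) * (1 - \<kappa>)"
      using mult_left_mono[OF assms(4,3)] by (simp add: algebra_simps)
    have "(y (Suc n) + a) * (1 - \<kappa>) \<le> (1 + \<kappa>) * (y n + a)"
      using step[of n] Suc.prems mult_nonneg_nonneg[OF assms(3,1)] by (simp add: algebra_simps)
    also have "\<dots> \<le> (1 + 4 * \<kappa>) * (1 - \<kappa>) * (y n + a)"
      using * pos[of n] Suc.prems assms(1) by (intro mult_right_mono) auto
    finally have "(y (Suc n) + a) * (1 - \<kappa>) \<le> ((1 + 4 * \<kappa>) * (y n + a)) * (1 - \<kappa>)"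
      by (simp add: mult_ac)
    then have "y (Suc n) + a \<le> (1 + 4 * \<kappa>) * (y n + a)"
      using assms(4) by (simp add: mult_le_cancel_right)
    also have "\<dots> \<le> (1 + 4 * \<kappa>) * ((1 + 4 * \<kappa>) ^ n * a)"
      using Suc assms(3) by (intro mult_left_mono) auto
    finally show ?case by simp
  qed
  also have "(1 + 4 * \<kappa>) ^ n * a \<le> exp (4 * \<kappa>) ^ n * a"
    using assms by (intro mult_right_mono power_mono exp_ge_add_one_self) auto
  also have "exp (4 * \<kappa>) ^ n = exp (4 * \<kappa> * real n)"
    by (simp add: exp_of_nat_mult[symmetric] mult.commute)
  finally show ?thesis using assms(1) by simp
qed

text \<open>A family of derivatives instead of iterated \<open>deriv\<close>: at the ends of
  \<open>S\<close> they are one-sided, and a derivative may be listed under any formula equal to it,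
  so that u_t can take the place of p_xx. The highest one is bounded because it alone enters the
  Taylor remainder.\<close>

definition derivs_on :: "nat \<Rightarrow> real set \<Rightarrow> (nat \<Rightarrow> real \<Rightarrow> real) \<Rightarrow> real \<Rightarrow> bool" where
  "derivs_on m S f B \<longleftrightarrow>
     (\<forall>i<m. \<forall>x\<in>S. (f i has_real_derivative f (Suc i) x) (at x within S)) \<and>
     (\<forall>x\<in>S. \<bar>f m x\<bar> \<le> B)"

lemma derivs_on_Taylor:
  assumes "derivs_on (Suc n) S f B" "convex S" "w \<in> S" "z \<in> S"
  shows "\<bar>f 0 z - (\<Sum>i\<le>n. f i w * (z - w) ^ i / fact i)\<bar> \<le> B * \<bar>z - w\<bar> ^ Suc n"
proof -
  have "norm (f 0 z - (\<Sum>i\<le>n. f i w * (z - w) ^ i / fact i)) \<le> B * norm (z - w) ^ Suc n / fact n"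
    using assms by (intro field_Taylor[where S = S]) (auto simp: derivs_on_def)
  \<comment> \<open>The factorial is given up, since only the order of the remainder
    matters.\<close>
  also have "\<dots> \<le> B * norm (z - w) ^ Suc n / 1"
  proof -
    have "\<bar>f (Suc n) w\<bar> \<le> B" using assms by (auto simp: derivs_on_def)
    then have "0 \<le> B" by linarith
    then show ?thesis by (intro divide_left_mono) auto
  qed
  finally show ?thesis by simp
qed

lemma derivs_on_Taylor_2:
  assumes "derivs_on 2 S f B" "convex S" "w \<in> S" "w + d \<in> S"
  shows "\<bar>f 0 (w + d) - f 0 w - f 1 w * d\<bar> \<le> B * d\<^sup>2"
  using derivs_on_Taylor[of 1 S f B w "w + d"] assms
  by (simp add: numeral_2_eq_2 algebra_simps)

lemma derivs_on_Taylor_3: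
  assumes "derivs_on 3 S f B" "convex S" "w \<in> S" "w + d \<in> S"
  shows "\<bar>f 0 (w + d) - f 0 w - f 1 w * d - f 2 w * d\<^sup>2 / 2\<bar> \<le> B * \<bar>d\<bar> ^ 3"
  using derivs_on_Taylor[of 2 S f B w "w + d"] assms
  by (simp add: numeral_3_eq_3 numeral_2_eq_2 algebra_simps)

lemma derivs_on_Taylor_4:
  assumes "derivs_on 4 S f B" "convex S" "w \<in> S" "w + d \<in> S"
  shows "\<bar>f 0 (w + d) - f 0 w - f 1 w * d - f 2 w * d\<^sup>2 / 2 - f 3 w * d ^ 3 / 6\<bar> \<le> B * \<bar>d\<bar> ^ 4"
proof -
  have *: "(\<Sum>i\<le>3. f i w * d ^ i / fact i) = f 0 w + f 1 w * d + f 2 w * d\<^sup>2 / 2 + f 3 w * d ^ 3 / 6"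
    by (simp add: numeral_3_eq_3 numeral_2_eq_2 fact_numeral)
  show ?thesis using derivs_on_Taylor[of 3 S f B w "w + d"] assms unfolding add_diff_cancel_left' *
    by (simp add: algebra_simps)
qed

lemma midpoint_average_error:
  assumes "derivs_on 2 S f B" "convex S" "w \<in> S" "w + d \<in> S" "w - d \<in> S"
  shows "\<bar>(f 0 (w + d) + f 0 (w - d)) / 2 - f 0 w\<bar> \<le> B * d\<^sup>2"
proof -
  have *: "\<bar>f 0 (w - d) - f 0 w + f 1 w * d\<bar> \<le> B * d\<^sup>2"
    using derivs_on_Taylor_2[OF assms(1-3), of "- d"] assms(5) by simp
  note T = derivs_on_Taylor_2[OF assms(1-4)]
  show ?thesis
    using * T unfolding add_divide_distrib by linarith
qed

text \<open>The even terms cancel in the difference, which leaves a cubic remainder to be divided by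
  \<open>2 * d\<close>.\<close>

lemma central_difference_error:
  assumes "derivs_on 3 S f B" "convex S" "w \<in> S" "w + d \<in> S" "w - d \<in> S" "0 < d"
  shows "\<bar>(f 0 (w + d) - f 0 (w - d)) / (2 * d) - f 1 w\<bar> \<le> B * d\<^sup>2"
proof -
  have 1: "\<bar>f 0 (w + d) - f 0 w - f 1 w * d - f 2 w * d\<^sup>2 / 2\<bar> \<le> B * d ^ 3"
    using derivs_on_Taylor_3[OF assms(1-4)] assms(6) by simp
  have 2: "\<bar>f 0 (w - d) - f 0 w + f 1 w * d - f 2 w * d\<^sup>2 / 2\<bar> \<le> B * d ^ 3"
    using derivs_on_Taylor_3[OF assms(1-3), of "- d"] assms(5,6) by simp
  have "\<bar>f 0 (w + d) - f 0 (w - d) - 2 * (f 1 w * d)\<bar> \<le> 2 * (B * d ^ 3)"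
    using 1 2 by linarith
  then have "\<bar>f 0 (w + d) - f 0 (w - d) - 2 * d * f 1 w\<bar> \<le> 2 * (B * d ^ 3)" by (simp add: mult_ac)
  then have "\<bar>f 0 (w + d) - f 0 (w - d) - 2 * d * f 1 w\<bar> / (2 * d) \<le> 2 * (B * d ^ 3) / (2 * d)"
    using assms(6) by (intro divide_right_mono) auto
  also have "\<dots> = B * d\<^sup>2" using assms(6) by (simp add: power2_eq_square power3_eq_cube)
  also have "\<bar>f 0 (w + d) - f 0 (w - d) - 2 * d * f 1 w\<bar> / (2 * d)
      = \<bar>(f 0 (w + d) - f 0 (w - d) - 2 * d * f 1 w) / (2 * d)\<bar>"
    using assms(6) by (simp add: abs_divide)
  also have "(f 0 (w + d) - f 0 (w - d) - 2 * d * f 1 w) / (2 * d)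
      = (f 0 (w + d) - f 0 (w - d)) / (2 * d) - f 1 w"
    using assms(6) by (simp add: diff_divide_distrib)
  finally show ?thesis .
qed

text \<open>The odd terms cancel in the sum, the cubic one included. The two quartic remainders
  account for the factor 2.\<close>

lemma second_difference_error:
  assumes "derivs_on 4 S f B" "convex S" "w \<in> S" "w + d \<in> S" "w - d \<in> S" "0 < d"
  shows "\<bar>(f 0 (w + d) - 2 * f 0 w + f 0 (w - d)) / d\<^sup>2 - f 2 w\<bar> \<le> 2 * B * d\<^sup>2"
proof -
  have 1: "\<bar>f 0 (w + d) - f 0 w - f 1 w * d - f 2 w * d\<^sup>2 / 2 - f 3 w * d ^ 3 / 6\<bar> \<le> B * d ^ 4"
    using derivs_on_Taylor_4[OF assms(1-4)] assms(6) by simp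
  have 2: "\<bar>f 0 (w - d) - f 0 w + f 1 w * d - f 2 w * d\<^sup>2 / 2 + f 3 w * d ^ 3 / 6\<bar> \<le> B * d ^ 4"
    using derivs_on_Taylor_4[OF assms(1-3), of "- d"] assms(5,6) by simp
  have "\<bar>f 0 (w + d) - 2 * f 0 w + f 0 (w - d) - f 2 w * d\<^sup>2\<bar> \<le> 2 * (B * d ^ 4)"
    using 1 2 by linarith
  then have *: "\<bar>f 0 (w + d) - 2 * f 0 w + f 0 (w - d) - d\<^sup>2 * f 2 w\<bar> \<le> 2 * (B * d ^ 4)"
    by (simp add: mult.commute)
  have "(f 0 (w + d) - 2 * f 0 w + f 0 (w - d)) / d\<^sup>2 - f 2 w
      = (f 0 (w + d) - 2 * f 0 w + f 0 (w - d) - d\<^sup>2 * f 2 w) / d\<^sup>2"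
    using assms(6) by (simp add: diff_divide_distrib)
  then have "\<bar>(f 0 (w + d) - 2 * f 0 w + f 0 (w - d)) / d\<^sup>2 - f 2 w\<bar> \<le> 2 * (B * d ^ 4) / d\<^sup>2"
    using divide_right_mono[OF *, of "d\<^sup>2"] by simp
  also have "\<dots> = 2 * B * d\<^sup>2" using assms(6) by (simp add: power2_eq_square power4_eq_xxxx)
  finally show ?thesis .
qed

text \<open>Both values are expanded about the left end; interpolation reproduces the linear part,
  and one remainder for each value gives the factor 2.\<close>

lemma linear_interpolation_error:
  assumes "derivs_on 2 {a..a + h} f B" "0 \<le> \<theta>" "\<theta> \<le> 1" "0 \<le> h"
  shows "\<bar>(1 - \<theta>) * f 0 a + \<theta> * f 0 (a + h) - f 0 (a + \<theta> * h)\<bar> \<le> 2 * B * h\<^sup>2"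
proof -
  have th: "0 \<le> \<theta> * h" "\<theta> * h \<le> h" using assms by (simp_all add: mult_left_le_one_le)
  have B: "0 \<le> B" using assms th by (force simp: derivs_on_def)
  have 1: "\<bar>f 0 (a + h) - f 0 a - f 1 a * h\<bar> \<le> B * h\<^sup>2"
    using assms by (intro derivs_on_Taylor_2[where S = "{a..a + h}"]) auto
  have 2: "\<bar>f 0 (a + \<theta> * h) - f 0 a - f 1 a * (\<theta> * h)\<bar> \<le> B * (\<theta> * h)\<^sup>2"
    using assms th by (intro derivs_on_Taylor_2[where S = "{a..a + h}"]) auto
  have 3: "\<bar>\<theta> * (f 0 (a + h) - f 0 a - f 1 a * h)\<bar> \<le> B * h\<^sup>2"
    using mult_mono[OF assms(3) 1] assms(2) by (simp add: abs_mult)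
  have 4: "B * (\<theta> * h)\<^sup>2 \<le> B * h\<^sup>2" using th B by (intro mult_left_mono power_mono) auto
  have "(1 - \<theta>) * f 0 a + \<theta> * f 0 (a + h) - f 0 (a + \<theta> * h)
    = \<theta> * (f 0 (a + h) - f 0 a - f 1 a * h) - (f 0 (a + \<theta> * h) - f 0 a - f 1 a * (\<theta> * h))"
    by (simp add: algebra_simps)
  then show ?thesis using 2 3 4 by linarith
qed

section \<open>Difference quotients of the potential\<close>

text \<open>
  A difference quotient is half the average of \<open>F'\<close> along the segment, symmetrised about its
  midpoint. The mean value theorem in the dilation parameter \<open>\<eta>\<close> treats a linear combination
  of difference quotients with one common \<open>\<eta>\<close>, so that cancellations between them survive.
\<close>

definition sym_avg :: "(real \<Rightarrow> real) \<Rightarrow> real \<Rightarrow> real \<Rightarrow> real \<Rightarrow> real" where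
  "sym_avg g \<eta> a b = (g ((a + b) / 2 + \<eta> * (a - b)) + g ((a + b) / 2 - \<eta> * (a - b))) / 2"

lemma sym_avg_same: "sym_avg g \<eta> a a = g a"
  by (simp add: sym_avg_def)

lemma diff_quot_same: "diff_quot F a a = deriv F a"
  by (simp add: diff_quot_def)

text \<open>Four pairs suffice for every later combination. A pair \<open>c\<close>,
  \<open>c\<close> stands for \<open>deriv F c\<close>, and smaller combinations are padded with
  pairs \<open>0\<close>, \<open>0\<close>, which cancel.\<close>

lemma diff_quot_mean_value:
  assumes F: "\<And>x. (F has_real_derivative deriv F x) (at x)"
  obtains \<eta> where "0 < \<eta>" "\<eta> < 1 / 2"
    "diff_quot F a1 b1 - diff_quot F a2 b2 - (diff_quot F a3 b3 - diff_quot F a4 b4)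
     = sym_avg (deriv F) \<eta> a1 b1 - sym_avg (deriv F) \<eta> a2 b2
       - (sym_avg (deriv F) \<eta> a3 b3 - sym_avg (deriv F) \<eta> a4 b4)"
proof -
  \<comment> \<open>A primitive in \<eta> of \<open>2 * sym_avg (deriv F) \<eta> a b\<close>, rising
    from 0 at \<eta> = 0 to the difference quotient at \<eta> = 1/2. The second branch is the limit
    of the first as \<open>a\<close> tends to \<open>b\<close>.\<close>
  define I where "I a b \<eta> =
    (if a \<noteq> b then (F ((a + b) / 2 + \<eta> * (a - b)) - F ((a + b) / 2 - \<eta> * (a - b))) / (a - b)
     else 2 * \<eta> * deriv F b)" for a b \<eta>
  have I: "(I a b has_real_derivative 2 * sym_avg (deriv F) \<eta> a b) (at \<eta>)" for a b \<eta>
  proof (cases "a = b")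
    case True
    then show ?thesis unfolding I_def sym_avg_def by (auto intro!: derivative_eq_intros)
  next
    case False
    have "((\<lambda>\<eta>. F ((a + b) / 2 + \<eta> * (a - b)) - F ((a + b) / 2 - \<eta> * (a - b)))
        has_real_derivative deriv F ((a + b) / 2 + \<eta> * (a - b)) * (a - b)
          - deriv F ((a + b) / 2 - \<eta> * (a - b)) * (- (a - b))) (at \<eta>)"
      by (rule DERIV_diff; rule DERIV_chain2[OF F]; auto intro!: derivative_eq_intros)
    from DERIV_cdivide[OF this, of "a - b"] False show ?thesis
      unfolding I_def sym_avg_def
      by (simp only: mult_minus_right diff_minus_eq_add distrib_right[symmetric]) (simp add: add_divide_distrib)
  qed
  have I0: "I a b 0 = 0" for a b by (simp add: I_def)
  have I1: "I a b (1 / 2) = diff_quot F a b" for a b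
    by (simp add: I_def diff_quot_def field_simps)
  let ?J = "\<lambda>\<eta>. I a1 b1 \<eta> - I a2 b2 \<eta> - (I a3 b3 \<eta> - I a4 b4 \<eta>)"
  let ?J' = "\<lambda>\<eta>. 2 * sym_avg (deriv F) \<eta> a1 b1 - 2 * sym_avg (deriv F) \<eta> a2 b2
    - (2 * sym_avg (deriv F) \<eta> a3 b3 - 2 * sym_avg (deriv F) \<eta> a4 b4)"
  have J: "(?J has_real_derivative ?J' \<eta>) (at \<eta>)" for \<eta>
    by (intro DERIV_diff I)
  have "\<exists>\<eta>>0. \<eta> < 1 / 2 \<and> ?J (1 / 2) - ?J 0 = (1 / 2 - 0) * ?J' \<eta>"
    by (rule MVT2) (auto intro: J)
  then show ?thesis using that by (auto simp: I0 I1)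
qed

lemma abs_convex_le:
  fixes a b r :: real
  assumes "\<bar>a\<bar> \<le> r" "\<bar>b\<bar> \<le> r" "0 \<le> \<theta>" "\<theta> \<le> 1"
  shows "\<bar>\<theta> * a + (1 - \<theta>) * b\<bar> \<le> r"
proof -
  have "\<bar>\<theta> * a\<bar> \<le> \<theta> * r" "\<bar>(1 - \<theta>) * b\<bar> \<le> (1 - \<theta>) * r"
    using assms by (simp_all add: abs_mult mult_left_mono)
  moreover have "r = \<theta> * r + (1 - \<theta>) * r" by (simp add: algebra_simps)
  ultimately show ?thesis by linarith
qed

text \<open>For \<eta> between 0 and 1/2 the two arguments are convex combinations of
  \<open>a\<close> and \<open>b\<close>, so a bound \<open>r\<close> on \<open>a\<close> and
  \<open>b\<close> carries over.\<close>

lemma sym_avg_convex: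
  "sym_avg g \<eta> a b = (g ((1/2 + \<eta>) * a + (1 - (1/2 + \<eta>)) * b) + g ((1/2 - \<eta>) * a + (1 - (1/2 - \<eta>)) * b)) / 2"
proof -
  have "(a + b) / 2 + \<eta> * (a - b) = (1/2 + \<eta>) * a + (1 - (1/2 + \<eta>)) * b"
    "(a + b) / 2 - \<eta> * (a - b) = (1/2 - \<eta>) * a + (1 - (1/2 - \<eta>)) * b"
    by (simp_all add: field_simps)
  then show ?thesis by (simp only: sym_avg_def)
qed

lemma abs_half_sum_le:
  fixes s t R :: real
  shows "\<bar>s\<bar> \<le> R \<Longrightarrow> \<bar>t\<bar> \<le> R \<Longrightarrow> \<bar>(s + t) / 2\<bar> \<le> R"
  by simp

text \<open>The mean value theorem is applied to the difference of \<open>g\<close> along both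
  segments at once. With one common parameter the two slopes are taken at corresponding points,
  whose distance is controlled by \<open>\<bar>X1 - X0\<bar>\<close> and
  \<open>\<bar>x1 - x0\<bar>\<close> and not by the lengths of the segments.\<close>

lemma four_point_difference:
  fixes g g' :: "real \<Rightarrow> real"
  assumes g: "\<And>x. \<bar>x\<bar> \<le> r \<Longrightarrow> (g has_real_derivative g' x) (at x)"
    and M: "\<And>x. \<bar>x\<bar> \<le> r \<Longrightarrow> \<bar>g' x\<bar> \<le> M"
    and Lip: "\<And>x y. \<bar>x\<bar> \<le> r \<Longrightarrow> \<bar>y\<bar> \<le> r \<Longrightarrow> \<bar>g' x - g' y\<bar> \<le> M * \<bar>x - y\<bar>"
    and r: "\<bar>X1\<bar> \<le> r" "\<bar>x1\<bar> \<le> r" "\<bar>X0\<bar> \<le> r" "\<bar>x0\<bar> \<le> r"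
  shows "\<bar>g X1 - g x1 - (g X0 - g x0)\<bar>
    \<le> M * \<bar>(X1 - x1) - (X0 - x0)\<bar> + M * \<bar>X0 - x0\<bar> * (\<bar>X1 - X0\<bar> + \<bar>x1 - x0\<bar>)"
proof -
  define p where "p X x \<theta> = \<theta> * X + (1 - \<theta>) * x" for X x \<theta> :: real
  have pr: "\<bar>p X x \<theta>\<bar> \<le> r" if "\<bar>X\<bar> \<le> r" "\<bar>x\<bar> \<le> r" "0 \<le> \<theta>" "\<theta> \<le> 1" for X x \<theta>
    unfolding p_def using that by (rule abs_convex_le)
  have dp: "((\<lambda>\<theta>. g (p X x \<theta>)) has_real_derivative g' (p X x \<theta>) * (X - x)) (at \<theta>)"
    if "\<bar>X\<bar> \<le> r" "\<bar>x\<bar> \<le> r" "0 \<le> \<theta>" "\<theta> \<le> 1" for X x \<theta>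
    by (rule DERIV_chain2[of g _ "p X x"], rule g[OF pr[OF that]]) (auto simp: p_def[abs_def] intro!: derivative_eq_intros)
  let ?f = "\<lambda>\<theta>. g (p X1 x1 \<theta>) - g (p X0 x0 \<theta>)"
  have "\<exists>\<theta>>0. \<theta> < 1 \<and> ?f 1 - ?f 0
      = (1 - 0) * (g' (p X1 x1 \<theta>) * (X1 - x1) - g' (p X0 x0 \<theta>) * (X0 - x0))"
    by (rule MVT2) (auto intro!: DERIV_diff dp r)
  then obtain \<theta> where \<theta>: "0 < \<theta>" "\<theta> < 1" and eq: "g X1 - g x1 - (g X0 - g x0)
      = g' (p X1 x1 \<theta>) * (X1 - x1) - g' (p X0 x0 \<theta>) * (X0 - x0)"
    by (auto simp: p_def algebra_simps)
  define P where "P = p X1 x1 \<theta>"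
  define Q where "Q = p X0 x0 \<theta>"
  have PQ: "\<bar>P\<bar> \<le> r" "\<bar>Q\<bar> \<le> r" unfolding P_def Q_def using \<theta> r by (auto intro!: pr)
  have M0: "0 \<le> M" using M[OF PQ(1)] by linarith
  have "\<bar>P - Q\<bar> \<le> \<bar>X1 - X0\<bar> + \<bar>x1 - x0\<bar>"
  proof -
    have "P - Q = \<theta> * (X1 - X0) + (1 - \<theta>) * (x1 - x0)" by (simp add: P_def Q_def p_def algebra_simps)
    then show ?thesis
      using \<theta> by (auto intro!: abs_convex_le)
  qed
  then have d: "\<bar>g' P - g' Q\<bar> \<le> M * (\<bar>X1 - X0\<bar> + \<bar>x1 - x0\<bar>)"
    using Lip[OF PQ] mult_left_mono M0 by (meson order_trans)
  have "g X1 - g x1 - (g X0 - g x0) = g' P * ((X1 - x1) - (X0 - x0)) + (g' P - g' Q) * (X0 - x0)"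
    unfolding eq P_def[symmetric] Q_def[symmetric] by (simp add: algebra_simps)
  also have "\<bar>\<dots>\<bar> \<le> \<bar>g' P\<bar> * \<bar>(X1 - x1) - (X0 - x0)\<bar> + \<bar>g' P - g' Q\<bar> * \<bar>X0 - x0\<bar>"
    by (metis abs_mult abs_triangle_ineq)
  also have "\<dots> \<le> M * \<bar>(X1 - x1) - (X0 - x0)\<bar> + (M * (\<bar>X1 - X0\<bar> + \<bar>x1 - x0\<bar>)) * \<bar>X0 - x0\<bar>"
    using M[OF PQ(1)] d by (intro add_mono mult_right_mono) auto
  finally show ?thesis by (simp add: mult_ac)
qed

text \<open>\<open>r\<close> is meant to bound both solutions. The same \<open>M\<close> later
  bounds the derivatives of the exact solution too, so that the constants involve one symbol for all
  of them.\<close>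

locale potential =
  fixes F :: "real \<Rightarrow> real" and r M :: real
  assumes C4: "C_real 4 F"
    and bound: "\<And>i x. i \<le> 4 \<Longrightarrow> \<bar>x\<bar> \<le> r \<Longrightarrow> \<bar>(deriv ^^ i) F x\<bar> \<le> M"
begin

lemma deriv_F: "i < 4 \<Longrightarrow> ((deriv ^^ i) F has_real_derivative (deriv ^^ Suc i) F x) (at x)"
  using C4 by (auto simp: C_real_def)

lemma F_deriv: "(F has_real_derivative deriv F x) (at x)"
  using deriv_F[of 0 x] by simp

lemma deriv_deriv: "(deriv F has_real_derivative (deriv ^^ 2) F x) (at x)"
  using deriv_F[of 1 x] by (simp add: numeral_2_eq_2)

lemma derivs_on_F:
  assumes "i + m \<le> 4"
  shows "derivs_on m {-r..r} (\<lambda>j. (deriv ^^ (i + j)) F) M"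
  unfolding derivs_on_def using assms
  by (auto intro!: bound has_field_derivative_at_within deriv_F[simplified])

lemma Lipschitz_F:
  assumes "i < 4" "\<bar>x\<bar> \<le> r" "\<bar>y\<bar> \<le> r"
  shows "\<bar>(deriv ^^ i) F x - (deriv ^^ i) F y\<bar> \<le> M * \<bar>x - y\<bar>"
  using derivs_on_Taylor[OF derivs_on_F[of i "Suc 0"], of y x] assms by (auto simp: abs_le_iff)

lemma diff_quot_Lipschitz:
  assumes r: "\<bar>A\<bar> \<le> r" "\<bar>B\<bar> \<le> r" "\<bar>a\<bar> \<le> r" "\<bar>b\<bar> \<le> r"
  shows "\<bar>diff_quot F A B - diff_quot F a b\<bar> \<le> M * (\<bar>A - a\<bar> + \<bar>B - b\<bar>)" (is "_ \<le> ?R")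
proof -
  have M0: "0 \<le> M" using bound[of 0 a] r by force
  obtain \<eta> where \<eta>: "0 < \<eta>" "\<eta> < 1 / 2" and eq:
    "diff_quot F A B - diff_quot F a b = sym_avg (deriv F) \<eta> A B - sym_avg (deriv F) \<eta> a b"
    using diff_quot_mean_value[OF F_deriv, of A B a b 0 0 0 0]
    by (metis diff_self diff_zero)
  let ?d = "\<lambda>\<theta>. deriv F (\<theta> * A + (1 - \<theta>) * B) - deriv F (\<theta> * a + (1 - \<theta>) * b)"
  have *: "\<bar>?d \<theta>\<bar> \<le> M * (\<bar>A - a\<bar> + \<bar>B - b\<bar>)" if \<theta>: "0 \<le> \<theta>" "\<theta> \<le> 1" for \<theta>
  proof -
    have "\<bar>deriv F (\<theta> * A + (1 - \<theta>) * B) - deriv F (\<theta> * a + (1 - \<theta>) * b)\<bar>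
        \<le> M * \<bar>(\<theta> * A + (1 - \<theta>) * B) - (\<theta> * a + (1 - \<theta>) * b)\<bar>"
      using Lipschitz_F[of 1] abs_convex_le[OF _ _ \<theta>] r by simp
    also have "(\<theta> * A + (1 - \<theta>) * B) - (\<theta> * a + (1 - \<theta>) * b) = \<theta> * (A - a) + (1 - \<theta>) * (B - b)"
      by (simp add: algebra_simps)
    also have "M * \<bar>\<theta> * (A - a) + (1 - \<theta>) * (B - b)\<bar> \<le> M * (\<bar>A - a\<bar> + \<bar>B - b\<bar>)"
      using M0 \<theta> by (intro mult_left_mono abs_convex_le) auto
    finally show ?thesis .
  qed
  have "0 \<le> 1 / 2 + \<eta>" "1 / 2 + \<eta> \<le> 1" "0 \<le> 1 / 2 - \<eta>" "1 / 2 - \<eta> \<le> 1" using \<eta> by auto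
  from *[OF this(1,2)] *[OF this(3,4)]
  have "\<bar>(?d (1 / 2 + \<eta>) + ?d (1 / 2 - \<eta>)) / 2\<bar> \<le> ?R"
    by (rule abs_half_sum_le)
  then show ?thesis
    unfolding eq sym_avg_convex by (simp add: diff_divide_distrib add_divide_distrib)
qed

text \<open>With neighbouring nodes as indices 0 and 1 this bounds the first difference in space of
  the nonlinear error. Applying \<open>diff_quot_Lipschitz\<close> separately at the two nodes would
  lose the smallness of the increments.\<close>

lemma diff_quot_four_point:
  assumes r: "\<bar>A0\<bar> \<le> r" "\<bar>B0\<bar> \<le> r" "\<bar>a0\<bar> \<le> r" "\<bar>b0\<bar> \<le> r"
    "\<bar>A1\<bar> \<le> r" "\<bar>B1\<bar> \<le> r" "\<bar>a1\<bar> \<le> r" "\<bar>b1\<bar> \<le> r"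
  shows "\<bar>diff_quot F A1 B1 - diff_quot F a1 b1 - (diff_quot F A0 B0 - diff_quot F a0 b0)\<bar>
    \<le> M * (\<bar>(A1 - a1) - (A0 - a0)\<bar> + \<bar>(B1 - b1) - (B0 - b0)\<bar>)
      + M * (\<bar>A0 - a0\<bar> + \<bar>B0 - b0\<bar>)
          * (\<bar>A1 - A0\<bar> + \<bar>B1 - B0\<bar> + \<bar>a1 - a0\<bar> + \<bar>b1 - b0\<bar>)" (is "_ \<le> ?R")
proof -
  have M0: "0 \<le> M" using bound[of 0 a0] r by force
  obtain \<eta> where \<eta>: "0 < \<eta>" "\<eta> < 1 / 2" and eq:
    "diff_quot F A1 B1 - diff_quot F a1 b1 - (diff_quot F A0 B0 - diff_quot F a0 b0)
      = sym_avg (deriv F) \<eta> A1 B1 - sym_avg (deriv F) \<eta> a1 b1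
       - (sym_avg (deriv F) \<eta> A0 B0 - sym_avg (deriv F) \<eta> a0 b0)"
    by (rule diff_quot_mean_value[OF F_deriv])
  define p where "p \<theta> x y = \<theta> * x + (1 - \<theta>) * y" for \<theta> x y :: real
  let ?d = "\<lambda>\<theta>. deriv F (p \<theta> A1 B1) - deriv F (p \<theta> a1 b1)
      - (deriv F (p \<theta> A0 B0) - deriv F (p \<theta> a0 b0))"
  have *: "\<bar>?d \<theta>\<bar> \<le> ?R" if \<theta>: "0 \<le> \<theta>" "\<theta> \<le> 1" for \<theta>
  proof -
    have pr: "\<bar>p \<theta> x y\<bar> \<le> r" if "\<bar>x\<bar> \<le> r" "\<bar>y\<bar> \<le> r" for x y
      unfolding p_def using that \<theta> by (rule abs_convex_le)
    have pp: "\<bar>p \<theta> x y\<bar> \<le> \<bar>x\<bar> + \<bar>y\<bar>" for x y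
      unfolding p_def using \<theta> by (intro abs_convex_le) auto
    have pd: "p \<theta> x y - p \<theta> x' y' = p \<theta> (x - x') (y - y')" for x y x' y'
      by (simp add: p_def algebra_simps)
    have "\<bar>deriv F (p \<theta> A1 B1) - deriv F (p \<theta> a1 b1)
        - (deriv F (p \<theta> A0 B0) - deriv F (p \<theta> a0 b0))\<bar>
      \<le> M * \<bar>(p \<theta> A1 B1 - p \<theta> a1 b1) - (p \<theta> A0 B0 - p \<theta> a0 b0)\<bar>
        + M * \<bar>p \<theta> A0 B0 - p \<theta> a0 b0\<bar> * (\<bar>p \<theta> A1 B1 - p \<theta> A0 B0\<bar> + \<bar>p \<theta> a1 b1 - p \<theta> a0 b0\<bar>)"
      by (rule four_point_difference[of r _ "(deriv ^^ 2) F"];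
        (rule deriv_deriv | rule pr, rule r, rule r | rule bound, simp, assumption
          | rule Lipschitz_F, simp, assumption, assumption))
    also have "\<dots> \<le> M * (\<bar>(A1 - a1) - (A0 - a0)\<bar> + \<bar>(B1 - b1) - (B0 - b0)\<bar>)
      + M * (\<bar>A0 - a0\<bar> + \<bar>B0 - b0\<bar>)
          * ((\<bar>A1 - A0\<bar> + \<bar>B1 - B0\<bar>) + (\<bar>a1 - a0\<bar> + \<bar>b1 - b0\<bar>))"
      unfolding pd using M0
      by (intro add_mono mult_mono mult_left_mono pp) auto
    finally show ?thesis by (simp add: add.assoc)
  qed
  have "0 \<le> 1 / 2 + \<eta>" "1 / 2 + \<eta> \<le> 1" "0 \<le> 1 / 2 - \<eta>" "1 / 2 - \<eta> \<le> 1" using \<eta> by auto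
  from *[OF this(1,2)] *[OF this(3,4)]
  have "\<bar>(?d (1 / 2 + \<eta>) + ?d (1 / 2 - \<eta>)) / 2\<bar> \<le> ?R"
    by (rule abs_half_sum_le)
  also have "(?d (1 / 2 + \<eta>) + ?d (1 / 2 - \<eta>)) / 2
      = sym_avg (deriv F) \<eta> A1 B1 - sym_avg (deriv F) \<eta> a1 b1
        - (sym_avg (deriv F) \<eta> A0 B0 - sym_avg (deriv F) \<eta> a0 b0)"
    unfolding sym_avg_convex p_def diff_divide_distrib add_divide_distrib by simp
  finally show ?thesis unfolding eq .
qed

end

context potential
begin

text \<open>Symmetry about the midpoint removes the linear term of the expansion, so the deviation
  is quadratic in the length of the segment.\<close>

lemma sym_avg_midpoint:
  assumes "i \<le> 2" "\<bar>a\<bar> \<le> r" "\<bar>b\<bar> \<le> r" "0 \<le> \<eta>" "\<eta> \<le> 1 / 2"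
  shows "\<bar>sym_avg ((deriv ^^ i) F) \<eta> a b - (deriv ^^ i) F ((a + b) / 2)\<bar> \<le> M * (a - b)\<^sup>2"
proof -
  have "\<bar>(a + b) / 2\<bar> \<le> r" using assms by simp
  moreover have "\<bar>(a + b) / 2 + \<eta> * (a - b)\<bar> \<le> r" "\<bar>(a + b) / 2 - \<eta> * (a - b)\<bar> \<le> r"
    using abs_convex_le[of a r b "1/2 + \<eta>"] abs_convex_le[of a r b "1/2 - \<eta>"] assms
    by (simp_all add: field_simps)
  ultimately have "\<bar>sym_avg ((deriv ^^ i) F) \<eta> a b - (deriv ^^ i) F ((a + b) / 2)\<bar>
      \<le> M * (\<eta> * (a - b))\<^sup>2"
    using midpoint_average_error[OF derivs_on_F[of i 2], of "(a + b) / 2" "\<eta> * (a - b)"] assms(1)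
    by (simp add: sym_avg_def abs_le_iff)
  also have "\<dots> \<le> M * (a - b)\<^sup>2"
  proof -
    have "\<eta>\<^sup>2 \<le> 1" using assms(4,5) by (simp add: power_le_one_iff abs_square_le_1)
    moreover have "0 \<le> M" using bound[of 0 a] assms by force
    ultimately show ?thesis by (simp add: power_mult_distrib mult_left_mono mult_left_le_one_le)
  qed
  finally show ?thesis .
qed

text \<open>\<open>a\<close>, \<open>b\<close> and \<open>c\<close> will be the exact solution at
  the new, old and middle time as functions of position, and \<delta> the time step. The first claim
  is the usual second-order accuracy; the second gains the distance of \<open>x\<close> and
  \<open>y\<close> by differentiating in position.\<close>

lemma diff_quot_consistency:
  fixes a b c a' b' c' :: "real \<Rightarrow> real"
  assumes S: "convex S" "x \<in> S" "y \<in> S" and \<delta>: "0 \<le> \<delta>"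
    and deriv: "\<And>z. z \<in> S \<Longrightarrow> (a has_real_derivative a' z) (at z within S)"
      "\<And>z. z \<in> S \<Longrightarrow> (b has_real_derivative b' z) (at z within S)"
      "\<And>z. z \<in> S \<Longrightarrow> (c has_real_derivative c' z) (at z within S)"
    and range: "\<And>z. z \<in> S \<Longrightarrow> \<bar>a z\<bar> \<le> r" "\<And>z. z \<in> S \<Longrightarrow> \<bar>b z\<bar> \<le> r"
      "\<And>z. z \<in> S \<Longrightarrow> \<bar>c z\<bar> \<le> r" "\<And>z. z \<in> S \<Longrightarrow> \<bar>c' z\<bar> \<le> M"
    and diff: "\<And>z. z \<in> S \<Longrightarrow> \<bar>a z - b z\<bar> \<le> M * \<delta>" "\<And>z. z \<in> S \<Longrightarrow> \<bar>a' z - b' z\<bar> \<le> M * \<delta>"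
    and mid: "\<And>z. z \<in> S \<Longrightarrow> \<bar>(a z + b z) / 2 - c z\<bar> \<le> M * \<delta>\<^sup>2"
      "\<And>z. z \<in> S \<Longrightarrow> \<bar>(a' z + b' z) / 2 - c' z\<bar> \<le> M * \<delta>\<^sup>2"
  shows "\<bar>diff_quot F (a x) (b x) - deriv F (c x)\<bar> \<le> M\<^sup>2 * (1 + M)\<^sup>2 * \<delta>\<^sup>2"
    and "\<bar>(diff_quot F (a x) (b x) - deriv F (c x)) - (diff_quot F (a y) (b y) - deriv F (c y))\<bar>
      \<le> M\<^sup>2 * (1 + M)\<^sup>2 * \<delta>\<^sup>2 * \<bar>x - y\<bar>"
proof -
  have M0: "0 \<le> M" using range(4)[OF S(2)] by linarith
  have near: "\<bar>sym_avg ((deriv ^^ i) F) \<eta> (a z) (b z) - (deriv ^^ i) F (c z)\<bar>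
      \<le> (M ^ 3 + M\<^sup>2) * \<delta>\<^sup>2"
    if "i \<le> 2" "z \<in> S" "0 \<le> \<eta>" "\<eta> \<le> 1 / 2" for i z \<eta>
  proof -
    have "(a z - b z)\<^sup>2 \<le> (M * \<delta>)\<^sup>2"
      using diff(1)[OF that(2)] M0 \<delta> by (simp add: abs_le_square_iff[symmetric])
    from mult_left_mono[OF this M0]
    have "\<bar>sym_avg ((deriv ^^ i) F) \<eta> (a z) (b z) - (deriv ^^ i) F ((a z + b z) / 2)\<bar> \<le> M * (M * \<delta>)\<^sup>2"
      using sym_avg_midpoint[OF that(1) range(1,2)[OF that(2)] that(3,4)] by linarith
    moreover have "\<bar>(deriv ^^ i) F ((a z + b z) / 2) - (deriv ^^ i) F (c z)\<bar> \<le> M * (M * \<delta>\<^sup>2)"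
    proof -
      have "\<bar>(a z + b z) / 2\<bar> \<le> r"
        using range(1,2)[OF that(2)] by simp
      from Lipschitz_F[OF _ this range(3)[OF that(2)], of i]
        mult_left_mono[OF mid(1)[OF that(2)] M0] that(1) show ?thesis by simp
    qed
    ultimately have "\<bar>sym_avg ((deriv ^^ i) F) \<eta> (a z) (b z) - (deriv ^^ i) F (c z)\<bar>
      \<le> M * (M * \<delta>)\<^sup>2 + M * (M * \<delta>\<^sup>2)" by linarith
    then show ?thesis by (simp add: power2_eq_square power3_eq_cube algebra_simps)
  qed
  obtain \<eta>1 where "0 < \<eta>1" "\<eta>1 < 1 / 2" and "diff_quot F (a x) (b x) - deriv F (c x)
      = sym_avg (deriv F) \<eta>1 (a x) (b x) - deriv F (c x)"
    using diff_quot_mean_value[OF F_deriv, of "a x" "b x" "c x" "c x" 0 0 0 0]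
    by (metis diff_quot_same sym_avg_same diff_self diff_zero)
  then have "\<bar>diff_quot F (a x) (b x) - deriv F (c x)\<bar> \<le> (M ^ 3 + M\<^sup>2) * \<delta>\<^sup>2"
    using near[of 1 x \<eta>1] S(2) by simp
  also have "\<dots> \<le> M\<^sup>2 * (1 + M)\<^sup>2 * \<delta>\<^sup>2"
  proof (rule mult_right_mono)
    show "M ^ 3 + M\<^sup>2 \<le> M\<^sup>2 * (1 + M)\<^sup>2"
      using M0 by (simp add: power2_eq_square power3_eq_cube algebra_simps)
  qed simp
  finally show "\<bar>diff_quot F (a x) (b x) - deriv F (c x)\<bar> \<le> M\<^sup>2 * (1 + M)\<^sup>2 * \<delta>\<^sup>2" .
  \<comment> \<open>One \<eta> serves both positions, so the left side is the increment of a single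
    differentiable function of position.\<close>
  obtain \<eta> where \<eta>: "0 < \<eta>" "\<eta> < 1 / 2" and eq:
    "(diff_quot F (a x) (b x) - deriv F (c x)) - (diff_quot F (a y) (b y) - deriv F (c y))
      = (sym_avg (deriv F) \<eta> (a x) (b x) - deriv F (c x)) - (sym_avg (deriv F) \<eta> (a y) (b y) - deriv F (c y))"
    using diff_quot_mean_value[OF F_deriv, of "a x" "b x" "c x" "c x" "a y" "b y" "c y" "c y"]
    by (metis diff_quot_same sym_avg_same)
  define p where "p z = (a z + b z) / 2 + \<eta> * (a z - b z)" for z
  define m where "m z = (a z + b z) / 2 - \<eta> * (a z - b z)" for z
  define p' where "p' z = (a' z + b' z) / 2 + \<eta> * (a' z - b' z)" for z
  define m' where "m' z = (a' z + b' z) / 2 - \<eta> * (a' z - b' z)" for z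
  define F2 where "F2 = (deriv ^^ 2) F"
  define f' where "f' z = (F2 (p z) * p' z + F2 (m z) * m' z) / 2 - F2 (c z) * c' z" for z
  let ?f = "\<lambda>z. sym_avg (deriv F) \<eta> (a z) (b z) - deriv F (c z)"
  have f: "(?f has_real_derivative f' z) (at z within S)" if z: "z \<in> S" for z
  proof -
    have "(p has_real_derivative p' z) (at z within S)" "(m has_real_derivative m' z) (at z within S)"
      unfolding p_def[abs_def] m_def[abs_def] p'_def m'_def
      using deriv[OF z] by (auto intro!: derivative_eq_intros)
    then show ?thesis
      using deriv(3)[OF z] unfolding sym_avg_def p_def[symmetric] m_def[symmetric] f'_def F2_def
      by (intro DERIV_diff DERIV_cdivide DERIV_add DERIV_chain2[OF deriv_deriv]) auto
  qed
  have f'_le: "\<bar>f' z\<bar> \<le> M\<^sup>2 * (1 + M)\<^sup>2 * \<delta>\<^sup>2" if z: "z \<in> S" for z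
  proof -
    have pm: "\<bar>p z\<bar> \<le> r" "\<bar>m z\<bar> \<le> r"
      unfolding p_def m_def
      using abs_convex_le[OF range(1,2)[OF z], of "1/2 + \<eta>"] abs_convex_le[OF range(1,2)[OF z], of "1/2 - \<eta>"] \<eta>
      by (simp_all add: field_simps)
    define A where "A = sym_avg F2 \<eta> (a z) (b z)"
    have A: "A = (F2 (p z) + F2 (m z)) / 2" by (simp add: A_def sym_avg_def p_def m_def)
    have A_le: "\<bar>A\<bar> \<le> M"
      unfolding A F2_def using bound[of 2] pm by (intro abs_half_sum_le) auto
    have AF: "\<bar>A - F2 (c z)\<bar> \<le> (M ^ 3 + M\<^sup>2) * \<delta>\<^sup>2"
      unfolding A_def F2_def using near[of 2 z \<eta>] z \<eta> by simp
    have "\<bar>F2 (p z) - F2 (m z)\<bar> \<le> M * \<bar>p z - m z\<bar>"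
      unfolding F2_def using Lipschitz_F[of 2] pm by simp
    also have "\<bar>p z - m z\<bar> = 2 * \<eta> * \<bar>a z - b z\<bar>"
    proof -
      have "p z - m z = 2 * \<eta> * (a z - b z)" by (simp add: p_def m_def)
      then show ?thesis using \<eta> by (simp add: abs_mult)
    qed
    also have "\<dots> \<le> 1 * (M * \<delta>)" using diff(1)[OF z] \<eta> by (intro mult_mono) auto
    finally have FF: "\<bar>F2 (p z) - F2 (m z)\<bar> \<le> M * (M * \<delta>)" using M0 by (simp add: mult_left_mono)
    have "\<bar>\<eta> * (a' z - b' z) / 2\<bar> \<le> M * \<delta>"
    proof -
      have "\<bar>\<eta> * (a' z - b' z) / 2\<bar> = \<eta> / 2 * \<bar>a' z - b' z\<bar>" using \<eta> by (simp add: abs_mult)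
      also have "\<dots> \<le> 1 * (M * \<delta>)" using diff(2)[OF z] \<eta> by (intro mult_mono) auto
      finally show ?thesis by simp
    qed
    then have t3: "\<bar>\<eta> * (a' z - b' z) / 2 * (F2 (p z) - F2 (m z))\<bar> \<le> (M * \<delta>) * (M * (M * \<delta>))"
      unfolding abs_mult[of "\<eta> * (a' z - b' z) / 2"] using FF M0 \<delta> by (intro mult_mono) auto
    have t1: "\<bar>A * ((a' z + b' z) / 2 - c' z)\<bar> \<le> M * (M * \<delta>\<^sup>2)"
      unfolding abs_mult using A_le mid(2)[OF z] M0 by (intro mult_mono) auto
    have t2: "\<bar>(A - F2 (c z)) * c' z\<bar> \<le> (M ^ 3 + M\<^sup>2) * \<delta>\<^sup>2 * M"
      unfolding abs_mult using AF range(4)[OF z] M0 by (intro mult_mono) auto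
    \<comment> \<open>A splitting into parts even and odd in \<eta>. The even part is compared with
      its value at the midpoint, the odd part is a product of two factors of order \<delta>. The
      coefficients of \<delta>^2 are M^2, M^4 + M^3 and M^3, with sum M^2 (1 + M)^2.\<close>
    have "f' z = A * ((a' z + b' z) / 2 - c' z) + (A - F2 (c z)) * c' z
        + \<eta> * (a' z - b' z) / 2 * (F2 (p z) - F2 (m z))"
      unfolding A f'_def p'_def m'_def by (simp add: field_simps)
    then have "\<bar>f' z\<bar> \<le> M * (M * \<delta>\<^sup>2) + (M ^ 3 + M\<^sup>2) * \<delta>\<^sup>2 * M + (M * \<delta>) * (M * (M * \<delta>))"
      using t1 t2 t3 by linarith
    also have "\<dots> = M\<^sup>2 * (1 + M)\<^sup>2 * \<delta>\<^sup>2"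
      by (simp add: power2_eq_square power3_eq_cube algebra_simps)
    finally show ?thesis .
  qed
  have "derivs_on (Suc 0) S (\<lambda>i. if i = 0 then ?f else f') (M\<^sup>2 * (1 + M)\<^sup>2 * \<delta>\<^sup>2)"
    using f f'_le by (auto simp: derivs_on_def)
  from derivs_on_Taylor[OF this S(1) S(3) S(2)]
  show "\<bar>(diff_quot F (a x) (b x) - deriv F (c x)) - (diff_quot F (a y) (b y) - deriv F (c y))\<bar>
      \<le> M\<^sup>2 * (1 + M)\<^sup>2 * \<delta>\<^sup>2 * \<bar>x - y\<bar>"
    unfolding eq by simp
qed

end

section \<open>Consistency\<close>

text \<open>\<open>D i j\<close> stands for the derivative of u of order \<open>i\<close> in space
  and \<open>j\<close> in time. The pressure is absent: \<open>pressure\<close> says that p_x,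
  written in terms of u, has derivative u_t up to the end points.\<close>

locale CH_regular = potential +
  fixes L T \<gamma> :: real and D :: "nat \<Rightarrow> nat \<Rightarrow> real \<Rightarrow> real \<Rightarrow> real"
  assumes pos: "0 < L" "0 < T" "0 < \<gamma>"
    and deriv_x: "\<And>i j x t. i + j < 5 \<Longrightarrow> x \<in> {0..L} \<Longrightarrow> t \<in> {0..T} \<Longrightarrow>
      ((\<lambda>y. D i j y t) has_real_derivative D (Suc i) j x t) (at x within {0..L})"
    and deriv_t: "\<And>i j x t. i + j < 5 \<Longrightarrow> x \<in> {0..L} \<Longrightarrow> t \<in> {0..T} \<Longrightarrow>
      ((\<lambda>s. D i j x s) has_real_derivative D i (Suc j) x t) (at t within {0..T})"
    and D_bound: "\<And>i j x t. i + j \<le> 5 \<Longrightarrow> x \<in> {0..L} \<Longrightarrow> t \<in> {0..T} \<Longrightarrow> \<bar>D i j x t\<bar> \<le> M"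
    and D_range: "\<And>x t. x \<in> {0..L} \<Longrightarrow> t \<in> {0..T} \<Longrightarrow> \<bar>D 0 0 x t\<bar> \<le> r"
    and pressure: "\<And>x t. x \<in> {0..L} \<Longrightarrow> t \<in> {0<..T} \<Longrightarrow>
      ((\<lambda>y. - \<gamma> * D 3 0 y t + (deriv ^^ 2) F (D 0 0 y t) * D 1 0 y t)
        has_real_derivative D 0 1 x t) (at x within {0..L})"
    and pressure_bc: "\<And>x t. x \<in> {0, L} \<Longrightarrow> t \<in> {0<..T} \<Longrightarrow>
      - \<gamma> * D 3 0 x t + (deriv ^^ 2) F (D 0 0 x t) * D 1 0 x t = 0"
    and dynamic_bc: "\<And>t. t \<in> {0<..T} \<Longrightarrow> D 0 1 0 t = D 1 0 0 t"
      "\<And>t. t \<in> {0<..T} \<Longrightarrow> D 0 1 L t = - D 1 0 L t"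
begin

definition pr :: "real \<Rightarrow> real \<Rightarrow> real" where
  "pr x t = - \<gamma> * D 2 0 x t + deriv F (D 0 0 x t)"

text \<open>From order two on, the derivatives of the pressure are read off p_xx = u_t. The fourth
  is then u_txx, whereas differentiating \<open>pr\<close> four times would take six space
  derivatives of u.\<close>

definition pr_derivs :: "real \<Rightarrow> nat \<Rightarrow> real \<Rightarrow> real" where
  "pr_derivs t l x = (if l = 0 then pr x t
     else if l = 1 then - \<gamma> * D 3 0 x t + (deriv ^^ 2) F (D 0 0 x t) * D 1 0 x t
     else D (l - 2) 1 x t)"

definition mean_derivs :: "real \<Rightarrow> real \<Rightarrow> nat \<Rightarrow> real \<Rightarrow> real" where
  "mean_derivs t0 t1 l x = (D l 0 x t1 + D l 0 x t0) / 2"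

lemma M_nonneg: "0 \<le> M"
  using D_bound[of 0 0 0 0] pos by force

lemma derivs_on_x:
  assumes "i + j + m \<le> 5" "t \<in> {0..T}"
  shows "derivs_on m {0..L} (\<lambda>l x. D (i + l) j x t) M"
  unfolding derivs_on_def using assms by (auto intro!: D_bound deriv_x[simplified])

lemma derivs_on_t:
  assumes "i + j + m \<le> 5" "x \<in> {0..L}"
  shows "derivs_on m {0..T} (\<lambda>l t. D i (j + l) x t) M"
  unfolding derivs_on_def using assms by (auto intro!: D_bound deriv_t[simplified])

lemma derivs_on_mean:
  assumes "i + m \<le> 5" "t0 \<in> {0..T}" "t1 \<in> {0..T}"
  shows "derivs_on m {0..L} (\<lambda>l. mean_derivs t0 t1 (i + l)) M"
  unfolding derivs_on_def mean_derivs_def[abs_def]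
proof (intro conjI allI impI ballI)
  fix l x assume "l < m" "x \<in> {0..L}"
  then show "((\<lambda>x. (D (i + l) 0 x t1 + D (i + l) 0 x t0) / 2) has_real_derivative
      (D (i + Suc l) 0 x t1 + D (i + Suc l) 0 x t0) / 2) (at x within {0..L})"
    using assms by (intro DERIV_cdivide DERIV_add) (auto intro!: deriv_x[simplified])
next
  fix x assume "x \<in> {0..L}"
  then show "\<bar>(D (i + m) 0 x t1 + D (i + m) 0 x t0) / 2\<bar> \<le> M"
    using assms by (intro abs_half_sum_le D_bound) auto
qed

text \<open>The condition \<open>2 \<le> m\<close> makes the top derivative one of u_t, which
  \<open>M\<close> bounds; p and p_x carry no such assumption.\<close>

lemma derivs_on_pr:
  assumes "t \<in> {0<..T}" "m \<le> 4" "2 \<le> m"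
  shows "derivs_on m {0..L} (pr_derivs t) M"
  unfolding derivs_on_def
proof (intro conjI allI impI ballI)
  fix l x assume l: "l < m" and x: "x \<in> {0..L}"
  consider "l = 0" | "l = 1" | "2 \<le> l" by linarith
  then show "(pr_derivs t l has_real_derivative pr_derivs t (Suc l) x) (at x within {0..L})"
  proof cases
    case 1
    have "((\<lambda>x. - \<gamma> * D 2 0 x t + deriv F (D 0 0 x t)) has_real_derivative
        - \<gamma> * D (Suc 2) 0 x t + (deriv ^^ 2) F (D 0 0 x t) * D (Suc 0) 0 x t) (at x within {0..L})"
      using assms x
      by (intro DERIV_add DERIV_cmult DERIV_chain2[OF deriv_deriv] deriv_x) auto
    then show ?thesis using 1 by (simp add: pr_derivs_def[abs_def] pr_def numeral_3_eq_3 numeral_2_eq_2)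
  next
    case 2
    then show ?thesis using pressure[OF x assms(1)] by (simp add: pr_derivs_def[abs_def])
  next
    case 3
    then have "((\<lambda>x. D (l - 2) 1 x t) has_real_derivative D (Suc (l - 2)) 1 x t) (at x within {0..L})"
      using assms x l by (intro deriv_x) auto
    moreover have "Suc (l - 2) = Suc l - 2" using 3 by simp
    ultimately show ?thesis using 3 by (simp only: pr_derivs_def[abs_def]) simp
  qed
next
  fix x assume "x \<in> {0..L}"
  then show "\<bar>pr_derivs t m x\<bar> \<le> M"
    using assms D_bound[of "m - 2" 1 x t] by (simp add: pr_derivs_def)
qed

section \<open>Residuals of the exact solution over one time step\<close>

context
  fixes t0 dt :: real
  assumes dt: "0 < dt" "0 \<le> t0" "t0 + dt \<le> T"
begin

lemma times: "t0 \<in> {0..T}" "t0 + dt \<in> {0..T}" "t0 + dt / 2 \<in> {0..T}" "t0 + dt / 2 \<in> {0<..T}"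
  using dt by auto

lemma half_dt_sq: "M * (dt / 2)\<^sup>2 \<le> M * dt\<^sup>2"
  using M_nonneg dt by (intro mult_left_mono power_mono) auto

text \<open>About the middle of the step both averages and difference quotients in time are accurate
  to second order; hence all residuals compare with values at \<open>t0 + dt / 2\<close>.\<close>

lemma mean_error:
  assumes "i + j \<le> 3" "x \<in> {0..L}"
  shows "\<bar>(D i j x (t0 + dt) + D i j x t0) / 2 - D i j x (t0 + dt / 2)\<bar> \<le> M * dt\<^sup>2"
  using midpoint_average_error[OF derivs_on_t[of i j 2 x], of "t0 + dt / 2" "dt / 2"]
    assms times half_dt_sq by (simp add: add.commute[of dt t0])

lemma time_difference_error:
  assumes "i + j \<le> 2" "x \<in> {0..L}"
  shows "\<bar>(D i j x (t0 + dt) - D i j x t0) / dt - D i (Suc j) x (t0 + dt / 2)\<bar> \<le> M * dt\<^sup>2"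
  using central_difference_error[OF derivs_on_t[of i j 3 x], of "t0 + dt / 2" "dt / 2"]
    assms times half_dt_sq dt by (simp add: add.commute[of dt t0])

lemma time_difference_le:
  assumes "i + j \<le> 4" "x \<in> {0..L}"
  shows "\<bar>D i j x (t0 + dt) - D i j x t0\<bar> \<le> M * dt"
  using derivs_on_Taylor[OF derivs_on_t[of i j "Suc 0" x], of t0 "t0 + dt"] assms times dt by simp

abbreviation "v \<equiv> mean_derivs t0 (t0 + dt)"

definition potential_residual :: "real \<Rightarrow> real" where
  "potential_residual x =
    diff_quot F (D 0 0 x (t0 + dt)) (D 0 0 x t0) - deriv F (D 0 0 x (t0 + dt / 2))"

lemma potential_residual:
  assumes "x \<in> {0..L}" "y \<in> {0..L}"
  shows "\<bar>potential_residual x\<bar> \<le> M\<^sup>2 * (1 + M)\<^sup>2 * dt\<^sup>2"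
    and "\<bar>potential_residual x - potential_residual y\<bar> \<le> M\<^sup>2 * (1 + M)\<^sup>2 * dt\<^sup>2 * \<bar>x - y\<bar>"
proof -
  have d: "((\<lambda>x. D 0 0 x t) has_real_derivative D (Suc 0) 0 z t) (at z within {0..L})"
    if "z \<in> {0..L}" "t \<in> {0..T}" for z t using that by (intro deriv_x) auto
  have "\<bar>D 0 0 z (t0 + dt) - D 0 0 z t0\<bar> \<le> M * dt"
    "\<bar>D (Suc 0) 0 z (t0 + dt) - D (Suc 0) 0 z t0\<bar> \<le> M * dt"
    "\<bar>(D 0 0 z (t0 + dt) + D 0 0 z t0) / 2 - D 0 0 z (t0 + dt / 2)\<bar> \<le> M * dt\<^sup>2"
    "\<bar>(D (Suc 0) 0 z (t0 + dt) + D (Suc 0) 0 z t0) / 2 - D (Suc 0) 0 z (t0 + dt / 2)\<bar> \<le> M * dt\<^sup>2"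
    "\<bar>D (Suc 0) 0 z (t0 + dt / 2)\<bar> \<le> M"
    if "z \<in> {0..L}" for z
    using that times by (intro time_difference_le mean_error D_bound; simp)+
  note facts = this d[OF _ times(1)] d[OF _ times(2)] d[OF _ times(3)]
    D_range[OF _ times(1)] D_range[OF _ times(2)] D_range[OF _ times(3)]
  note concl = diff_quot_consistency[of "{0..L}" x y dt "\<lambda>x. D 0 0 x (t0 + dt)"
      "\<lambda>x. D (Suc 0) 0 x (t0 + dt)" "\<lambda>x. D 0 0 x t0" "\<lambda>x. D (Suc 0) 0 x t0"
      "\<lambda>x. D 0 0 x (t0 + dt / 2)" "\<lambda>x. D (Suc 0) 0 x (t0 + dt / 2)",
      OF convex_closed_interval assms less_imp_le[OF dt(1)]]
  show "\<bar>potential_residual x\<bar> \<le> M\<^sup>2 * (1 + M)\<^sup>2 * dt\<^sup>2"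
    unfolding potential_residual_def by (rule concl(1)) (rule facts; assumption)+
  show "\<bar>potential_residual x - potential_residual y\<bar> \<le> M\<^sup>2 * (1 + M)\<^sup>2 * dt\<^sup>2 * \<bar>x - y\<bar>"
    unfolding potential_residual_def by (rule concl(2)) (rule facts; assumption)+
qed

text \<open>The index \<open>i\<close> counts space derivatives: \<open>space_residual h 1\<close>
  is the derivative of \<open>space_residual h 0\<close>, so one bound yields both size and
  Lipschitz constant. For \<open>i = 1\<close> it takes the fifth derivative of u.\<close>

definition space_residual :: "real \<Rightarrow> nat \<Rightarrow> real \<Rightarrow> real" where
  "space_residual h i x =
    (v i (x + h) - 2 * v i x + v i (x - h)) / h\<^sup>2 - D (i + 2) 0 x (t0 + dt / 2)"

lemma space_residual_le:
  assumes "0 < h" "x \<in> {h..L - h}" "i \<le> 1"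
  shows "\<bar>space_residual h i x\<bar> \<le> 2 * M * (h\<^sup>2 + dt\<^sup>2)"
proof -
  have "\<bar>(v i (x + h) - 2 * v i x + v i (x - h)) / h\<^sup>2 - v (i + 2) x\<bar> \<le> 2 * M * h\<^sup>2"
    using second_difference_error[OF derivs_on_mean[of i 4, OF _ times(1,2)], of x h] assms
    by simp
  moreover have "\<bar>v (i + 2) x - D (i + 2) 0 x (t0 + dt / 2)\<bar> \<le> M * dt\<^sup>2"
    unfolding mean_derivs_def using assms by (intro mean_error) auto
  moreover have "M * dt\<^sup>2 \<le> 2 * M * dt\<^sup>2" using M_nonneg by simp
  ultimately show ?thesis unfolding space_residual_def by (simp add: distrib_left)
qed

lemma space_residual_Lipschitz:
  assumes h: "0 < h" and x: "x \<in> {h..L - h}" and y: "y \<in> {h..L - h}"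
  shows "\<bar>space_residual h 0 x - space_residual h 0 y\<bar> \<le> 2 * M * (h\<^sup>2 + dt\<^sup>2) * \<bar>x - y\<bar>"
proof -
  \<comment> \<open>On the interval from h to L - h the stencil stays inside the domain. Where it
    touches an end, the derivative is one-sided and is inherited by restriction.\<close>
  have shift: "((\<lambda>x. v 0 (x + c)) has_real_derivative v 1 (z + c)) (at z within {h..L - h})"
    if "z \<in> {h..L - h}" "c \<in> {- h..h}" for z c
  proof -
    have "(v 0 has_real_derivative v 1 (z + c)) (at (z + c) within {0..L})"
      using derivs_on_mean[of 0 1, OF _ times(1,2)] that by (auto simp: derivs_on_def)
    then have "(v 0 has_real_derivative v 1 (z + c)) (at (z + c) within (\<lambda>x. x + c) ` {h..L - h})"
      by (rule has_field_derivative_subset) (use that in auto)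
    moreover have "((\<lambda>x. x + c) has_real_derivative 1) (at z within {h..L - h})"
      by (auto intro!: derivative_eq_intros)
    ultimately have "(v 0 \<circ> (\<lambda>x. x + c) has_real_derivative v 1 (z + c) * 1) (at z within {h..L - h})"
      by (rule DERIV_image_chain)
    then show ?thesis by (simp add: o_def)
  qed
  have "(space_residual h 0 has_real_derivative space_residual h 1 z) (at z within {h..L - h})"
    if z: "z \<in> {h..L - h}" for z
  proof -
    have "((\<lambda>x. D 2 0 x (t0 + dt / 2)) has_real_derivative D (Suc 2) 0 z (t0 + dt / 2))
        (at z within {h..L - h})"
      using z h times by (intro has_field_derivative_subset[OF deriv_x]) auto
    moreover have "1 + 2 = Suc 2" by simp
    ultimately show ?thesis
      using shift[OF z, of h] shift[OF z, of 0] shift[OF z, of "- h"] h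
      unfolding space_residual_def[abs_def]
      by (simp only: add_0_left diff_conv_add_uminus)
        (intro DERIV_add DERIV_minus DERIV_cdivide DERIV_cmult, auto)
  qed
  then have "derivs_on (Suc 0) {h..L - h} (space_residual h) (2 * M * (h\<^sup>2 + dt\<^sup>2))"
    using space_residual_le[OF h, of _ 1] by (auto simp: derivs_on_def)
  from derivs_on_Taylor[OF this convex_closed_interval y x] show ?thesis by simp
qed

definition residual :: "real \<Rightarrow> real \<Rightarrow> real" where
  "residual h x = pr x (t0 + dt / 2) + \<gamma> * ((v 0 (x + h) - 2 * v 0 x + v 0 (x - h)) / h\<^sup>2)
     - diff_quot F (D 0 0 x (t0 + dt)) (D 0 0 x t0)"

lemma residual_split: "residual h x = \<gamma> * space_residual h 0 x - potential_residual x"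
  by (simp add: residual_def space_residual_def potential_residual_def pr_def algebra_simps numeral_2_eq_2)

definition residual_const :: real where
  "residual_const = 2 * \<gamma> * M + M\<^sup>2 * (1 + M)\<^sup>2"

lemma residual_const_nonneg: "0 \<le> residual_const"
  using M_nonneg pos by (simp add: residual_const_def)

lemma potential_residual_le:
  assumes "x \<in> {0..L}"
  shows "\<bar>potential_residual x\<bar> \<le> residual_const * (h\<^sup>2 + dt\<^sup>2)"
proof -
  have "M\<^sup>2 * (1 + M)\<^sup>2 * dt\<^sup>2 \<le> residual_const * (h\<^sup>2 + dt\<^sup>2)"
    unfolding residual_const_def using M_nonneg pos by (intro mult_mono) auto
  then show ?thesis using potential_residual(1)[OF assms assms] by linarith
qed

lemma residual_le:
  assumes h: "0 < h" and x: "x \<in> {h..L - h}"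
  shows "\<bar>residual h x\<bar> \<le> residual_const * (h\<^sup>2 + dt\<^sup>2)"
proof -
  have "\<bar>\<gamma> * space_residual h 0 x\<bar> \<le> \<gamma> * (2 * M * (h\<^sup>2 + dt\<^sup>2))"
    using space_residual_le[OF h x, of 0] pos by (simp add: abs_mult)
  moreover have "\<bar>potential_residual x\<bar> \<le> M\<^sup>2 * (1 + M)\<^sup>2 * dt\<^sup>2"
    using potential_residual(1)[of x x] h x by auto
  moreover have "M\<^sup>2 * (1 + M)\<^sup>2 * dt\<^sup>2 \<le> M\<^sup>2 * (1 + M)\<^sup>2 * (h\<^sup>2 + dt\<^sup>2)"
    by (intro mult_left_mono) auto
  ultimately have "\<bar>residual h x\<bar> \<le> \<gamma> * (2 * M * (h\<^sup>2 + dt\<^sup>2)) + M\<^sup>2 * (1 + M)\<^sup>2 * (h\<^sup>2 + dt\<^sup>2)"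
    unfolding residual_split by linarith
  then show ?thesis by (simp add: residual_const_def algebra_simps)
qed

lemma residual_Lipschitz:
  assumes h: "0 < h" and x: "x \<in> {h..L - h}" and y: "y \<in> {h..L - h}"
  shows "\<bar>residual h x - residual h y\<bar> \<le> residual_const * (h\<^sup>2 + dt\<^sup>2) * \<bar>x - y\<bar>"
proof -
  have "\<bar>\<gamma> * (space_residual h 0 x - space_residual h 0 y)\<bar> \<le> \<gamma> * (2 * M * (h\<^sup>2 + dt\<^sup>2) * \<bar>x - y\<bar>)"
    using space_residual_Lipschitz[OF h x y] pos by (simp add: abs_mult)
  moreover have "\<bar>potential_residual x - potential_residual y\<bar> \<le> M\<^sup>2 * (1 + M)\<^sup>2 * dt\<^sup>2 * \<bar>x - y\<bar>"
    using potential_residual(2)[of x y] h x y by auto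
  moreover have "M\<^sup>2 * (1 + M)\<^sup>2 * dt\<^sup>2 * \<bar>x - y\<bar> \<le> M\<^sup>2 * (1 + M)\<^sup>2 * (h\<^sup>2 + dt\<^sup>2) * \<bar>x - y\<bar>"
    by (intro mult_right_mono mult_left_mono) auto
  ultimately have "\<bar>residual h x - residual h y\<bar>
      \<le> \<gamma> * (2 * M * (h\<^sup>2 + dt\<^sup>2) * \<bar>x - y\<bar>) + M\<^sup>2 * (1 + M)\<^sup>2 * (h\<^sup>2 + dt\<^sup>2) * \<bar>x - y\<bar>"
    unfolding residual_split right_diff_distrib by linarith
  then show ?thesis by (simp add: residual_const_def algebra_simps)
qed

text \<open>\<open>sg\<close> points into the interval, which treats both ends together. As p_x = 0
  at the end, the one-sided difference quotient of p is h/2 p_xx = h/2 u_t up to O(h^2), matching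
  half a cell of mass. Inner residuals have one more factor h, but there are about L/h of them, so
  in l1 both kinds have the same order.\<close>

lemma flux_residual_boundary:
  assumes h: "0 < h" "h \<le> L" and sg: "sg = 1 \<or> sg = - 1" and x: "x \<in> {0, L}" "x + sg * h \<in> {0..L}"
  shows "\<bar>h / 2 * ((D 0 0 x (t0 + dt) - D 0 0 x t0) / dt)
      - (pr (x + sg * h) (t0 + dt / 2) - pr x (t0 + dt / 2)) / h\<bar> \<le> (L + 1) * M * (h\<^sup>2 + dt\<^sup>2)"
proof -
  have x': "x \<in> {0..L}" using x pos by auto
  have d: "\<bar>sg * h\<bar> = h" "(sg * h)\<^sup>2 = h\<^sup>2" using sg h by auto
  let ?g = "\<lambda>y. pr y (t0 + dt / 2)"
  have "\<bar>?g (x + sg * h) - ?g x - D 0 1 x (t0 + dt / 2) * h\<^sup>2 / 2\<bar> \<le> M * h ^ 3"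
    using derivs_on_Taylor_3[OF derivs_on_pr[OF times(4), of 3] convex_closed_interval x' x(2)]
      pressure_bc[OF x(1) times(4)] by (simp add: pr_derivs_def d)
  from divide_right_mono[OF this, of h] h
  have "\<bar>(?g (x + sg * h) - ?g x - D 0 1 x (t0 + dt / 2) * h\<^sup>2 / 2) / h\<bar> \<le> M * h\<^sup>2"
    by (simp add: abs_divide power2_eq_square power3_eq_cube)
  moreover have "(?g (x + sg * h) - ?g x - D 0 1 x (t0 + dt / 2) * h\<^sup>2 / 2) / h
      = (?g (x + sg * h) - ?g x) / h - h / 2 * D 0 1 x (t0 + dt / 2)"
    using h by (simp add: diff_divide_distrib power2_eq_square)
  moreover have "\<bar>h / 2 * ((D 0 0 x (t0 + dt) - D 0 0 x t0) / dt - D 0 1 x (t0 + dt / 2))\<bar>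
      \<le> L * (M * dt\<^sup>2)"
    unfolding abs_mult using time_difference_error[of 0 0 x] x' h M_nonneg
    by (intro mult_mono) auto
  ultimately have "\<bar>h / 2 * ((D 0 0 x (t0 + dt) - D 0 0 x t0) / dt) - (?g (x + sg * h) - ?g x) / h\<bar>
      \<le> L * (M * dt\<^sup>2) + M * h\<^sup>2"
    unfolding right_diff_distrib by linarith
  also have "\<dots> \<le> (L + 1) * M * (h\<^sup>2 + dt\<^sup>2)"
    using M_nonneg pos by (simp add: algebra_simps)
  finally show ?thesis .
qed

text \<open>The one-sided difference quotient of the averaged solution is sg u_x + h/2 u_xx up to
  O(h^2). The first part is u_t by the dynamic condition and cancels the velocity; the second turns
  half a cell of pressure into half a cell of F'(u).\<close>

lemma pressure_residual_boundary:
  assumes h: "0 < h" "h \<le> L" and sg: "sg = 1 \<or> sg = - 1" and x: "x \<in> {0..L}" "x + sg * h \<in> {0..L}"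
    and bc: "D 0 1 x (t0 + dt / 2) = sg * D 1 0 x (t0 + dt / 2)"
    and s: "\<bar>s\<bar> \<le> residual_const * (h\<^sup>2 + dt\<^sup>2)"
  shows "\<bar>h / 2 * pr x (t0 + dt / 2) + \<gamma> * ((v 0 (x + sg * h) - v 0 x) / h)
      - \<gamma> * ((D 0 0 x (t0 + dt) - D 0 0 x t0) / dt)
      - h / 2 * (diff_quot F (D 0 0 x (t0 + dt)) (D 0 0 x t0) + s)\<bar>
    \<le> (\<gamma> * M * (3 + L) + L * residual_const) * (h\<^sup>2 + dt\<^sup>2)"
proof -
  define E where "E = h\<^sup>2 + dt\<^sup>2"
  have E: "0 \<le> E" by (simp add: E_def)
  have d: "\<bar>sg * h\<bar> = h" "(sg * h)\<^sup>2 = h\<^sup>2" "sg * h / h = sg" using sg h by auto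
  \<comment> \<open>\<open>t1\<close> is the Taylor remainder in space, \<open>t2\<close> and
    \<open>t3\<close> move averages to the middle time, \<open>t4\<close> does so for the time
    difference. \<open>t3\<close> alone carries h/2, estimated by \<open>L\<close>, whence the
    factor \<open>3 + L\<close>.\<close>
  define t1 where "t1 = (v 0 (x + sg * h) - v 0 x) / h - sg * v 1 x - h / 2 * v 2 x"
  define t2 where "t2 = sg * (v 1 x - D 1 0 x (t0 + dt / 2))"
  define t3 where "t3 = h / 2 * (v 2 x - D 2 0 x (t0 + dt / 2))"
  define t4 where "t4 = (D 0 0 x (t0 + dt) - D 0 0 x t0) / dt - D 0 1 x (t0 + dt / 2)"
  have "\<bar>v 0 (x + sg * h) - v 0 x - v 1 x * (sg * h) - v 2 x * h\<^sup>2 / 2\<bar> \<le> M * h ^ 3"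
    using derivs_on_Taylor_3[OF derivs_on_mean[of 0 3, unfolded add_0, OF _ times(1,2)] convex_closed_interval x]
    by (simp add: d)
  from divide_right_mono[OF this, of h] h
  have "\<bar>(v 0 (x + sg * h) - v 0 x - v 1 x * (sg * h) - v 2 x * h\<^sup>2 / 2) / h\<bar> \<le> M * h\<^sup>2"
    by (simp add: abs_divide power2_eq_square power3_eq_cube)
  moreover have "(v 0 (x + sg * h) - v 0 x - v 1 x * (sg * h) - v 2 x * h\<^sup>2 / 2) / h = t1"
    using h by (simp add: t1_def diff_divide_distrib power2_eq_square)
  moreover have "M * h\<^sup>2 \<le> M * E" using M_nonneg by (simp add: E_def mult_left_mono)
  ultimately have t1: "\<bar>t1\<bar> \<le> M * E" by linarith
  have MdE: "M * dt\<^sup>2 \<le> M * E" using M_nonneg by (simp add: E_def mult_left_mono)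
  have t2: "\<bar>t2\<bar> \<le> M * E"
    using mean_error[of 1 0 x] MdE x sg by (auto simp: t2_def mean_derivs_def abs_mult)
  have t3: "\<bar>t3\<bar> \<le> L * (M * E)"
    unfolding t3_def abs_mult using mean_error[of 2 0 x] MdE x h pos
    by (intro mult_mono) (auto simp: mean_derivs_def)
  have t4: "\<bar>t4\<bar> \<le> M * E"
    using time_difference_error[of 0 0 x] MdE x by (simp add: t4_def)
  have "\<bar>t1 + t2 + t3 - t4\<bar> \<le> M * E + M * E + L * (M * E) + M * E"
    using t1 t2 t3 t4 by linarith
  then have "\<bar>\<gamma> * (t1 + t2 + t3 - t4)\<bar> \<le> \<gamma> * (M * E + M * E + L * (M * E) + M * E)"
    using pos unfolding abs_mult by simp
  moreover have "\<bar>h / 2 * potential_residual x\<bar> \<le> L / 2 * (residual_const * E)"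
    "\<bar>h / 2 * s\<bar> \<le> L / 2 * (residual_const * E)"
    unfolding abs_mult E_def using potential_residual_le[OF x(1), of h] s h residual_const_nonneg
    by (auto intro!: mult_mono)
  moreover have "h / 2 * pr x (t0 + dt / 2) + \<gamma> * ((v 0 (x + sg * h) - v 0 x) / h)
      - \<gamma> * ((D 0 0 x (t0 + dt) - D 0 0 x t0) / dt)
      - h / 2 * (diff_quot F (D 0 0 x (t0 + dt)) (D 0 0 x t0) + s)
    = \<gamma> * (t1 + t2 + t3 - t4) - h / 2 * potential_residual x - h / 2 * s"
    unfolding t1_def t2_def t3_def t4_def pr_def potential_residual_def bc
    by (simp add: algebra_simps diff_divide_distrib add_divide_distrib)
  ultimately have "\<bar>h / 2 * pr x (t0 + dt / 2) + \<gamma> * ((v 0 (x + sg * h) - v 0 x) / h)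
      - \<gamma> * ((D 0 0 x (t0 + dt) - D 0 0 x t0) / dt)
      - h / 2 * (diff_quot F (D 0 0 x (t0 + dt)) (D 0 0 x t0) + s)\<bar>
    \<le> \<gamma> * (M * E + M * E + L * (M * E) + M * E) + L / 2 * (residual_const * E) + L / 2 * (residual_const * E)"
    by linarith
  also have "\<dots> = (\<gamma> * M * (3 + L) + L * residual_const) * E" by (simp add: algebra_simps)
  finally show ?thesis unfolding E_def .
qed

text \<open>The summands serve the flux, the inner pressure residual and the boundary residual. In
  the first, inner nodes contribute 4 L M and the two end nodes 2 (L + 1) M.\<close>

definition consistency_const :: real where
  "consistency_const = (6 * L + 2) * M + residual_const + (\<gamma> * M * (3 + L) + L * residual_const)"

lemma consistency_const_ge:
  "(6 * L + 2) * M \<le> consistency_const" "residual_const \<le> consistency_const"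
  "\<gamma> * M * (3 + L) + L * residual_const \<le> consistency_const"
  using M_nonneg pos residual_const_nonneg by (simp_all add: consistency_const_def)

text \<open>
  The residual of the pressure equation is extended constantly into the two boundary cells, so
  that its first differences stay small; the mismatch there goes into the boundary term \<open>\<sigma>\<close>,
  which needs no such bound.
\<close>

lemma consistency:
  assumes K: "2 \<le> K" and h: "h = L / real K"
  obtains \<rho> s \<sigma> :: "nat \<Rightarrow> real" where
    "\<And>k. k \<le> K \<Longrightarrow> trap_weight K h k * ((D 0 0 (real k * h) (t0 + dt) - D 0 0 (real k * h) t0) / dt)
      = neumann_lap K (\<lambda>k. pr (real k * h) (t0 + dt / 2)) k / h + \<rho> k"
    "\<And>k. k \<le> K \<Longrightarrow> trap_weight K h k * pr (real k * h) (t0 + dt / 2)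
      = - \<gamma> * neumann_lap K (\<lambda>k. (D 0 0 (real k * h) (t0 + dt) + D 0 0 (real k * h) t0) / 2) k / h
        + (if k = 0 \<or> k = K
           then \<gamma> * ((D 0 0 (real k * h) (t0 + dt) - D 0 0 (real k * h) t0) / dt) + \<sigma> k else 0)
        + trap_weight K h k * (diff_quot F (D 0 0 (real k * h) (t0 + dt)) (D 0 0 (real k * h) t0) + s k)"
    "(\<Sum>k\<le>K. \<bar>\<rho> k\<bar>) \<le> consistency_const * (h\<^sup>2 + dt\<^sup>2)"
    "\<And>k. k \<le> K \<Longrightarrow> \<bar>s k\<bar> \<le> consistency_const * (h\<^sup>2 + dt\<^sup>2)"
    "\<And>k. k < K \<Longrightarrow> \<bar>s (Suc k) - s k\<bar> \<le> h * (consistency_const * (h\<^sup>2 + dt\<^sup>2))"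
    "\<And>k. k \<le> K \<Longrightarrow> \<bar>\<sigma> k\<bar> \<le> consistency_const * (h\<^sup>2 + dt\<^sup>2)"
proof -
  define E where "E = h\<^sup>2 + dt\<^sup>2"
  have E: "0 \<le> E" by (simp add: E_def)
  have h0: "0 < h" using h K pos by simp
  have Kh: "real K * h = L" using h K by simp
  have hL: "h \<le> L" using Kh K h0 mult_right_mono[of 1 "real K" h] by simp
  have node: "real k * h \<in> {0..L}" if "k \<le> K" for k
    using that h0 mult_right_mono[of "real k" "real K" h] by (simp add: Kh)
  have inner: "real k * h \<in> {h..L - h}" if "1 \<le> k" "k < K" for k
  proof -
    have "1 * h \<le> real k * h" "real (Suc k) * h \<le> real K * h"
      using that h0 by (intro mult_right_mono; simp)+
    then show ?thesis using Kh by (simp add: algebra_simps)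
  qed
  have succ: "real (Suc k) * h = real k * h + h" for k by (simp add: algebra_simps)
  have pred: "real (k - 1) * h = real k * h - h" if "0 < k" for k
    using that by (simp add: of_nat_diff algebra_simps)
  define ut where "ut k = (D 0 0 (real k * h) (t0 + dt) - D 0 0 (real k * h) t0) / dt" for k
  define g where "g k = pr (real k * h) (t0 + dt / 2)" for k
  define f where "f k = diff_quot F (D 0 0 (real k * h) (t0 + dt)) (D 0 0 (real k * h) t0)" for k
  define V where "V k = (D 0 0 (real k * h) (t0 + dt) + D 0 0 (real k * h) t0) / 2" for k
  \<comment> \<open>The nearest inner index. There is one because \<open>2 \<le> K\<close>, and
    neighbouring indices go to equal or neighbouring ones.\<close>
  define cl where "cl k = max 1 (min k (K - 1))" for k :: nat
  define s where "s k = residual h (real (cl k) * h)" for k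
  define \<rho> where "\<rho> k = trap_weight K h k * ut k - neumann_lap K g k / h" for k
  define \<sigma> where "\<sigma> k = (if k = 0 \<or> k = K
    then trap_weight K h k * g k + \<gamma> * (neumann_lap K V k / h) - \<gamma> * ut k
      - trap_weight K h k * (f k + s k) else 0)" for k
  have Vv: "V k = v 0 (real k * h)" for k by (simp add: V_def mean_derivs_def)
  have cl: "real (cl k) * h \<in> {h..L - h}" for k
    using K by (intro inner) (auto simp: cl_def)
  have s_res: "\<bar>s k\<bar> \<le> residual_const * E" for k
    unfolding s_def E_def using h0 cl by (rule residual_le)
  have weight: "trap_weight K h k = (if k = 0 \<or> k = K then h / 2 else h)" if "k \<le> K" for k
    using that K by (auto simp: trap_weight_def)
  show thesis
  proof (rule that[of \<rho> \<sigma> s])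
    fix k assume k: "k \<le> K"
    show "trap_weight K h k * ((D 0 0 (real k * h) (t0 + dt) - D 0 0 (real k * h) t0) / dt)
      = neumann_lap K (\<lambda>k. pr (real k * h) (t0 + dt / 2)) k / h + \<rho> k"
      unfolding \<rho>_def ut_def g_def[abs_def] by simp
    have "trap_weight K h k * g k = - \<gamma> * neumann_lap K V k / h
        + (if k = 0 \<or> k = K then \<gamma> * ut k + \<sigma> k else 0) + trap_weight K h k * (f k + s k)"
    proof (cases "k = 0 \<or> k = K")
      case True
      then show ?thesis by (simp add: \<sigma>_def)
    next
      case False
      then have k': "1 \<le> k" "k < K" using k by auto
      then have "cl k = k" by (auto simp: cl_def)
      moreover have "0 < k" using k' by simp
      then have "V (k - 1) = v 0 (real k * h - h)" by (simp only: Vv pred)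
      ultimately have "s k = g k + \<gamma> * (neumann_lap K V k / h\<^sup>2) - f k"
        using k' by (simp add: s_def residual_def neumann_lap_def g_def f_def Vv succ del: of_nat_Suc)
      then show ?thesis using False k h0
        by (simp add: weight power2_eq_square field_simps)
    qed
    then show "trap_weight K h k * pr (real k * h) (t0 + dt / 2)
      = - \<gamma> * neumann_lap K (\<lambda>k. (D 0 0 (real k * h) (t0 + dt) + D 0 0 (real k * h) t0) / 2) k / h
        + (if k = 0 \<or> k = K
           then \<gamma> * ((D 0 0 (real k * h) (t0 + dt) - D 0 0 (real k * h) t0) / dt) + \<sigma> k else 0)
        + trap_weight K h k * (diff_quot F (D 0 0 (real k * h) (t0 + dt)) (D 0 0 (real k * h) t0) + s k)"
      by (simp only: ut_def g_def V_def[abs_def] f_def)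
  next
    have "\<bar>\<rho> k\<bar> \<le> 2 * M * E * h + (if k = 0 \<or> k = K then (L + 1) * M * E else 0)" if k: "k \<le> K" for k
    proof -
      consider "k = 0" | "k = K" "k \<noteq> 0" | "1 \<le> k" "k < K" using k by linarith
      then show ?thesis
      proof cases
        case 1
        have "neumann_lap K g k = pr (0 + 1 * h) (t0 + dt / 2) - pr 0 (t0 + dt / 2)"
          using 1 K by (simp add: neumann_lap_def g_def)
        then show ?thesis
          using flux_residual_boundary[of h 1 0] h0 hL 1 k M_nonneg E
          by (simp add: \<rho>_def weight ut_def E_def add_increasing)
      next
        case 2
        have "neumann_lap K g k = pr (L + - 1 * h) (t0 + dt / 2) - pr L (t0 + dt / 2)"
          using 2 K pred[of K] by (simp add: neumann_lap_def g_def Kh)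
        then show ?thesis
          using flux_residual_boundary[of h "- 1" L] h0 hL 2 k M_nonneg E
          by (simp add: \<rho>_def weight ut_def E_def Kh add_increasing)
      next
        case 3
        let ?x = "real k * h"
        \<comment> \<open>The time difference of u and the second difference of p are compared with
          the same value u_t at the middle time, because p_xx = u_t.\<close>
        define A where "A = ut k - D 0 1 ?x (t0 + dt / 2)"
        define B where "B = (pr (?x + h) (t0 + dt / 2) - 2 * pr ?x (t0 + dt / 2) + pr (?x - h) (t0 + dt / 2)) / h\<^sup>2
          - D 0 1 ?x (t0 + dt / 2)"
        have A: "\<bar>A\<bar> \<le> M * dt\<^sup>2"
          using time_difference_error[of 0 0 ?x] node[OF k] by (simp add: A_def ut_def)
        have B: "\<bar>B\<bar> \<le> 2 * M * h\<^sup>2"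
          using second_difference_error[OF derivs_on_pr[OF times(4), of 4], of ?x h] inner[OF 3] h0
          by (simp add: B_def pr_derivs_def)
        have "0 < k" using 3 by simp
        then have "g (k - 1) = pr (?x - h) (t0 + dt / 2)" by (simp only: g_def pred)
        then have "neumann_lap K g k = pr (?x + h) (t0 + dt / 2) - 2 * pr ?x (t0 + dt / 2) + pr (?x - h) (t0 + dt / 2)"
          using 3 by (simp add: neumann_lap_def g_def succ del: of_nat_Suc)
        then have "B = neumann_lap K g k / h\<^sup>2 - D 0 1 ?x (t0 + dt / 2)" by (simp only: B_def)
        then have "\<rho> k = h * (A - B)"
          using 3 h0 by (simp add: \<rho>_def weight A_def power2_eq_square right_diff_distrib)
        moreover have "\<bar>A - B\<bar> \<le> 2 * M * E"
        proof -
          have "M * dt\<^sup>2 \<le> 2 * M * dt\<^sup>2" using M_nonneg by simp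
          then show ?thesis using A B unfolding E_def distrib_left by linarith
        qed
        ultimately have "\<bar>\<rho> k\<bar> \<le> h * (2 * M * E)" using h0 by (simp add: abs_mult)
        then show ?thesis using 3 by (simp add: mult_ac)
      qed
    qed
    then have "(\<Sum>k\<le>K. \<bar>\<rho> k\<bar>)
        \<le> (\<Sum>k\<le>K. 2 * M * E * h + (if k = 0 \<or> k = K then (L + 1) * M * E else 0))"
      by (intro sum_mono) auto
    also have "\<dots> = 2 * M * E * (L + h) + 2 * ((L + 1) * M * E)"
      using sum_boundary[of K "\<lambda>k. (L + 1) * M * E"] K
      by (simp add: sum.distrib Kh[symmetric] algebra_simps)
    also have "\<dots> \<le> 2 * M * E * (L + L) + 2 * ((L + 1) * M * E)"
      using hL M_nonneg E by (intro add_right_mono mult_left_mono) auto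
    also have "\<dots> = (6 * L + 2) * M * E" by (simp add: algebra_simps)
    also have "\<dots> \<le> consistency_const * E"
      using consistency_const_ge(1) E by (rule mult_right_mono)
    finally show "(\<Sum>k\<le>K. \<bar>\<rho> k\<bar>) \<le> consistency_const * (h\<^sup>2 + dt\<^sup>2)" unfolding E_def .
  next
    fix k
    have "residual_const * E \<le> consistency_const * E"
      using consistency_const_ge(2) E by (rule mult_right_mono)
    then show "\<bar>s k\<bar> \<le> consistency_const * (h\<^sup>2 + dt\<^sup>2)" using s_res[of k] by (simp add: E_def)
  next
    fix k assume k: "k < K"
    have "\<bar>real (cl (Suc k)) * h - real (cl k) * h\<bar> \<le> h"
    proof -
      have "cl (Suc k) = cl k \<or> cl (Suc k) = Suc (cl k)" unfolding cl_def by linarith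
      then show ?thesis using h0 by (auto simp: succ simp del: of_nat_Suc)
    qed
    then have "residual_const * E * \<bar>real (cl (Suc k)) * h - real (cl k) * h\<bar> \<le> consistency_const * E * h"
      using consistency_const_ge(2) residual_const_nonneg E by (intro mult_mono mult_nonneg_nonneg) auto
    then show "\<bar>s (Suc k) - s k\<bar> \<le> h * (consistency_const * (h\<^sup>2 + dt\<^sup>2))"
      using residual_Lipschitz[OF h0 cl cl, of "Suc k" k] by (simp add: s_def E_def mult_ac)
  next
    fix k assume k: "k \<le> K"
    let ?C = "\<gamma> * M * (3 + L) + L * residual_const"
    have "\<bar>\<sigma> k\<bar> \<le> ?C * E"
    proof -
      consider "k = 0" | "k = K" "k \<noteq> 0" | "1 \<le> k" "k < K" using k by linarith
      then show ?thesis
      proof cases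
        case 1
        have "neumann_lap K V k = v 0 (0 + 1 * h) - v 0 0"
          using 1 K by (simp add: neumann_lap_def Vv)
        then show ?thesis
          using pressure_residual_boundary[of h 1 0 "s k"] h0 hL 1 k s_res[of k] dynamic_bc(1)[OF times(4)]
          by (simp add: \<sigma>_def weight ut_def E_def g_def f_def)
      next
        case 2
        have "neumann_lap K V k = v 0 (L + - 1 * h) - v 0 L"
          using 2 K pred[of K] by (simp add: neumann_lap_def Vv Kh)
        then show ?thesis
          using pressure_residual_boundary[of h "- 1" L "s k"] h0 hL 2 k s_res[of k] dynamic_bc(2)[OF times(4)]
          by (simp add: \<sigma>_def weight ut_def E_def g_def f_def Kh)
      next
        case 3
        then show ?thesis
          using M_nonneg pos residual_const_nonneg E by (simp add: \<sigma>_def)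
      qed
    qed
    also have "?C * E \<le> consistency_const * E"
      using consistency_const_ge(3) E by (rule mult_right_mono)
    finally show "\<bar>\<sigma> k\<bar> \<le> consistency_const * (h\<^sup>2 + dt\<^sup>2)" unfolding E_def .
  qed
qed

end

end

section \<open>Error at the grid points\<close>

lemma energy_rate_nonneg:
  assumes "0 < L" "0 < \<gamma>" "0 \<le> R" "0 \<le> M" "0 \<le> G"
  shows "0 \<le> energy_rate L \<gamma> R M G"
  using assms by (auto simp: energy_rate_def Let_def intro!: mult_nonneg_nonneg add_nonneg_nonneg)

lemma L2_set_abs_sum4_le:
  assumes h: "0 < h" and "diff_norm K h a \<le> C" "diff_norm K h b \<le> C" "diff_norm K h c \<le> C" "diff_norm K h d \<le> C"
  shows "L2_set (\<lambda>k. \<bar>a (Suc k) - a k\<bar> + \<bar>b (Suc k) - b k\<bar> + \<bar>c (Suc k) - c k\<bar> + \<bar>d (Suc k) - d k\<bar>) {..<K}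
    / sqrt h \<le> 4 * C"
proof -
  have L: "L2_set (\<lambda>k. \<bar>e (Suc k) - e k :: real\<bar>) {..<K} = L2_set (\<lambda>k. e (Suc k) - e k) {..<K}" for e
    by (simp add: L2_set_def)
  have "L2_set (\<lambda>k. \<bar>a (Suc k) - a k\<bar> + \<bar>b (Suc k) - b k\<bar> + \<bar>c (Suc k) - c k\<bar> + \<bar>d (Suc k) - d k\<bar>) {..<K}
    \<le> L2_set (\<lambda>k. a (Suc k) - a k) {..<K} + L2_set (\<lambda>k. b (Suc k) - b k) {..<K}
      + L2_set (\<lambda>k. c (Suc k) - c k) {..<K} + L2_set (\<lambda>k. d (Suc k) - d k) {..<K}"
    by (rule order_trans[OF L2_set_triangle_ineq] add_mono)+ (simp_all add: L)
  from divide_right_mono[OF this, of "sqrt h"] h assms(2-) show ?thesis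
    by (simp add: diff_norm_def add_divide_distrib)
qed

context CH_regular
begin

text \<open>The mass of the error collects a flux residual in every step and can reach
  \<open>T * consistency_const\<close>; the summand 1 covers the residuals of a single step.\<close>

definition error_const :: real where
  "error_const = (1 + T) * consistency_const"

text \<open>The 4 counts the gradients in the weight \<open>g\<close> of the energy step: numerical
  and exact solution, each at two time levels.\<close>

definition growth_rate :: "real \<Rightarrow> real" where
  "growth_rate G = energy_rate L \<gamma> error_const M (4 * G)"

lemma error_const_nonneg: "0 \<le> error_const" "consistency_const \<le> error_const"
    "T * consistency_const \<le> error_const"
proof -
  have "0 \<le> consistency_const"
    using consistency_const_ge(2)[of T 0] residual_const_nonneg[of T 0] pos by simp
  then show "0 \<le> error_const" "consistency_const \<le> error_const" "T * consistency_const \<le> error_const"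
    using pos by (simp_all add: error_const_def algebra_simps)
qed

text \<open>No bound on \<open>P\<close> is assumed: the pressure error is estimated within each
  step, by its mean and by the dissipation in the energy identity.\<close>

lemma grid_error:
  fixes U P :: "nat \<Rightarrow> nat \<Rightarrow> real"
  assumes K: "2 \<le> K" and h: "h = L / real K" and dt: "0 < dt" and T: "T = real N * dt"
    and flux: "\<And>n k. n < N \<Longrightarrow> k \<le> K \<Longrightarrow>
      trap_weight K h k * ((U (Suc n) k - U n k) / dt) = neumann_lap K (P n) k / h"
    and pres: "\<And>n k. n < N \<Longrightarrow> k \<le> K \<Longrightarrow> trap_weight K h k * P n k
      = - \<gamma> * neumann_lap K (\<lambda>k. (U (Suc n) k + U n k) / 2) k / h
        + (if k = 0 \<or> k = K then \<gamma> * ((U (Suc n) k - U n k) / dt) else 0)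
        + trap_weight K h k * diff_quot F (U (Suc n) k) (U n k)"
    and init: "\<And>k. k \<le> K \<Longrightarrow> U 0 k = D 0 0 (real k * h) 0"
    and U_le: "\<And>n k. n \<le> N \<Longrightarrow> k \<le> K \<Longrightarrow> \<bar>U n k\<bar> \<le> r"
    and dU: "\<And>n. n \<le> N \<Longrightarrow> diff_norm K h (U n) \<le> G"
    and du: "\<And>n. n \<le> N \<Longrightarrow> diff_norm K h (\<lambda>k. D 0 0 (real k * h) (real n * dt)) \<le> G"
    and small: "growth_rate G * dt \<le> 1 / 2"
    and n: "n \<le> N" and k: "k \<le> K"
  shows "\<bar>U n k - D 0 0 (real k * h) (real n * dt)\<bar>
    \<le> (error_const / L + sqrt L * sqrt (exp (4 * growth_rate G * T))) * (h\<^sup>2 + dt\<^sup>2)"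
proof -
  define E where "E = h\<^sup>2 + dt\<^sup>2"
  have E: "0 \<le> E" by (simp add: E_def)
  have h0: "0 < h" using h K pos by simp
  have Kh: "L = real K * h" using h K by simp
  define u where "u n k = D 0 0 (real k * h) (real n * dt)" for n k
  define e where "e n k = U n k - u n k" for n k
  define g where "g n k = pr (real k * h) (real n * dt + dt / 2)" for n k
  define q where "q n k = P n k - g n k" for n k
  have node: "real k * h \<in> {0..L}" if "k \<le> K" for k
    using that h0 mult_right_mono[of "real k" "real K" h] by (simp add: Kh)
  have time: "real n * dt \<in> {0..T}" if "n \<le> N" for n
    using that dt mult_right_mono[of "real n" "real N" dt] by (simp add: T)
  have u_le: "\<bar>u n k\<bar> \<le> r" if "n \<le> N" "k \<le> K" for n k
    unfolding u_def using that by (intro D_range node time)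
  have G0: "0 \<le> G" using dU[of 0] diff_norm_nonneg[of h K "U 0"] h0 by simp
  have rate0: "0 \<le> growth_rate G"
    unfolding growth_rate_def using pos error_const_nonneg M_nonneg G0
    by (intro energy_rate_nonneg) auto
  have CE: "consistency_const * E \<le> error_const * E"
    using error_const_nonneg(2) E by (rule mult_right_mono)
  have residuals: "\<exists>\<rho> s \<sigma>. (\<forall>k\<le>K. trap_weight K h k * ((e (Suc n) k - e n k) / dt) = neumann_lap K (q n) k / h - \<rho> k) \<and>
    (\<forall>k\<le>K. trap_weight K h k * q n k = - \<gamma> * neumann_lap K (\<lambda>k. (e (Suc n) k + e n k) / 2) k / h
        + (if k = 0 \<or> k = K then \<gamma> * ((e (Suc n) k - e n k) / dt) - \<sigma> k else 0)
        + trap_weight K h k * (diff_quot F (U (Suc n) k) (U n k) - diff_quot F (u (Suc n) k) (u n k) - s k)) \<and>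
    (\<Sum>k\<le>K. \<bar>\<rho> k\<bar>) \<le> consistency_const * E \<and>
    (\<forall>k\<le>K. \<bar>s k\<bar> \<le> consistency_const * E) \<and>
    (\<forall>k<K. \<bar>s (Suc k) - s k\<bar> \<le> h * (consistency_const * E)) \<and>
    (\<forall>k\<le>K. \<bar>\<sigma> k\<bar> \<le> consistency_const * E)" if n: "n < N" for n
  proof -
    have t: "real n * dt + dt = real (Suc n) * dt" by (simp add: algebra_simps)
    have t0: "0 \<le> real n * dt" "real n * dt + dt \<le> T" using time[of "Suc n"] dt n t by auto
    obtain \<rho> s \<sigma> where
      A: "\<And>k. k \<le> K \<Longrightarrow> trap_weight K h k * ((u (Suc n) k - u n k) / dt) = neumann_lap K (g n) k / h + \<rho> k" and
      B: "\<And>k. k \<le> K \<Longrightarrow> trap_weight K h k * g n k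
        = - \<gamma> * neumann_lap K (\<lambda>k. (u (Suc n) k + u n k) / 2) k / h
        + (if k = 0 \<or> k = K then \<gamma> * ((u (Suc n) k - u n k) / dt) + \<sigma> k else 0)
        + trap_weight K h k * (diff_quot F (u (Suc n) k) (u n k) + s k)" and
      bounds: "(\<Sum>k\<le>K. \<bar>\<rho> k\<bar>) \<le> consistency_const * E"
        "\<And>k. k \<le> K \<Longrightarrow> \<bar>s k\<bar> \<le> consistency_const * E"
        "\<And>k. k < K \<Longrightarrow> \<bar>s (Suc k) - s k\<bar> \<le> h * (consistency_const * E)"
        "\<And>k. k \<le> K \<Longrightarrow> \<bar>\<sigma> k\<bar> \<le> consistency_const * E"
      by (rule consistency[OF dt t0 K h, unfolded t, folded u_def g_def E_def]) (rule that; assumption)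
    \<comment> \<open>The subtraction of the two pressure equations with every term opaque;
      \<open>b\<close> says whether the node is an end.\<close>
    have alg: "wq = - \<gamma> * (NU - Nu) / h + (if b then \<gamma> * (dU - du) - \<tau> else 0) + w * (f - f' - z)"
      if "wq = - \<gamma> * NU / h + (if b then \<gamma> * dU else 0) + w * f
        - (- \<gamma> * Nu / h + (if b then \<gamma> * du + \<tau> else 0) + w * (f' + z))"
      for wq NU Nu dU du \<tau> w f f' z :: real and b
      using that by (cases b) (simp_all add: algebra_simps diff_divide_distrib add_divide_distrib)
    have "trap_weight K h k * ((e (Suc n) k - e n k) / dt) = neumann_lap K (q n) k / h - \<rho> k" if k: "k \<le> K" for k
    proof -
      have "neumann_lap K (q n) k = neumann_lap K (P n) k - neumann_lap K (g n) k"
        by (simp add: neumann_lap_def q_def)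
      then have "neumann_lap K (q n) k / h - \<rho> k
          = trap_weight K h k * ((U (Suc n) k - U n k) / dt) - trap_weight K h k * ((u (Suc n) k - u n k) / dt)"
        using flux[OF n k] A[OF k] by (simp add: diff_divide_distrib)
      moreover have "(e (Suc n) k - e n k) / dt = (U (Suc n) k - U n k) / dt - (u (Suc n) k - u n k) / dt"
        by (simp add: e_def diff_divide_distrib)
      ultimately show ?thesis by (simp only: right_diff_distrib)
    qed
    moreover have "trap_weight K h k * q n k = - \<gamma> * neumann_lap K (\<lambda>k. (e (Suc n) k + e n k) / 2) k / h
        + (if k = 0 \<or> k = K then \<gamma> * ((e (Suc n) k - e n k) / dt) - \<sigma> k else 0)
        + trap_weight K h k * (diff_quot F (U (Suc n) k) (U n k) - diff_quot F (u (Suc n) k) (u n k) - s k)"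
      if k: "k \<le> K" for k
    proof -
      have NE: "neumann_lap K (\<lambda>k. (e (Suc n) k + e n k) / 2) k
        = neumann_lap K (\<lambda>k. (U (Suc n) k + U n k) / 2) k - neumann_lap K (\<lambda>k. (u (Suc n) k + u n k) / 2) k"
        by (simp add: neumann_lap_def e_def add_divide_distrib diff_divide_distrib)
      have de: "(e (Suc n) k - e n k) / dt = (U (Suc n) k - U n k) / dt - (u (Suc n) k - u n k) / dt"
        by (simp add: e_def diff_divide_distrib)
      have "trap_weight K h k * q n k = trap_weight K h k * P n k - trap_weight K h k * g n k"
        by (simp add: q_def right_diff_distrib)
      then show ?thesis
        unfolding pres[OF n k] B[OF k] NE de by (rule alg)
    qed
    ultimately show ?thesis using bounds by blast
  qed
  have e0: "e 0 k = 0" if "k \<le> K" for k using init[OF that] by (simp add: e_def u_def)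
  \<comment> \<open>Testing the flux equation with 1 removes the Laplacian, so the mass of the error
    changes only by \<open>dt\<close> times the sum of \<rho>.\<close>
  have mean': "\<bar>\<Sum>k\<le>K. trap_weight K h k * e n k\<bar> \<le> real n * dt * (consistency_const * E)" if "n \<le> N" for n
    using that
  proof (induction n)
    case 0
    then show ?case using e0 by simp
  next
    case (Suc n)
    then have n: "n < N" by simp
    obtain \<rho> where
      A: "\<forall>k\<le>K. trap_weight K h k * ((e (Suc n) k - e n k) / dt) = neumann_lap K (q n) k / h - \<rho> k" and
      \<rho>: "(\<Sum>k\<le>K. \<bar>\<rho> k\<bar>) \<le> consistency_const * E"
      using residuals[OF n] by (elim exE conjE) (rule that)
    have "(\<Sum>k\<le>K. trap_weight K h k * e (Suc n) k) - (\<Sum>k\<le>K. trap_weight K h k * e n k)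
        = dt * (\<Sum>k\<le>K. trap_weight K h k * ((e (Suc n) k - e n k) / dt))"
      unfolding sum_subtractf[symmetric] sum_distrib_left using dt
      by (intro sum.cong) (simp_all flip: right_diff_distrib)
    also have "(\<Sum>k\<le>K. trap_weight K h k * ((e (Suc n) k - e n k) / dt)) = - (\<Sum>k\<le>K. \<rho> k)"
      using sum_neumann_lap[of K "q n" "\<lambda>k. 1"] A
      by (simp add: sum_subtractf flip: sum_divide_distrib)
    finally have "\<bar>(\<Sum>k\<le>K. trap_weight K h k * e (Suc n) k) - (\<Sum>k\<le>K. trap_weight K h k * e n k)\<bar>
        = dt * \<bar>\<Sum>k\<le>K. \<rho> k\<bar>" using dt by (simp add: abs_mult)
    also have "\<dots> \<le> dt * (consistency_const * E)"
      using order_trans[OF sum_abs \<rho>] dt by (intro mult_left_mono) auto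
    finally show ?case using Suc by (simp add: algebra_simps)
  qed
  have mean: "\<bar>\<Sum>k\<le>K. trap_weight K h k * e n k\<bar> \<le> error_const * E" if "n \<le> N" for n
  proof -
    have "real n * dt * (consistency_const * E) \<le> T * (consistency_const * E)"
      using time[OF that] E consistency_const_ge(2)[of T 0] residual_const_nonneg[of T 0] pos
      by (intro mult_right_mono mult_nonneg_nonneg) auto
    also have "\<dots> \<le> error_const * E"
      using mult_right_mono[OF error_const_nonneg(3) E] by (simp add: mult.assoc)
    finally show ?thesis using mean'[OF that] by linarith
  qed
  define y where "y n = (diff_norm K h (e n))\<^sup>2" for n
  have step: "y (Suc n) - y n \<le> growth_rate G * dt * (E\<^sup>2 + y n + y (Suc n))" if n: "n < N" for n
  proof -
    obtain \<rho> s \<sigma> where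
      A: "\<forall>k\<le>K. trap_weight K h k * ((e (Suc n) k - e n k) / dt) = neumann_lap K (q n) k / h - \<rho> k" and
      B: "\<forall>k\<le>K. trap_weight K h k * q n k = - \<gamma> * neumann_lap K (\<lambda>k. (e (Suc n) k + e n k) / 2) k / h
        + (if k = 0 \<or> k = K then \<gamma> * ((e (Suc n) k - e n k) / dt) - \<sigma> k else 0)
        + trap_weight K h k * (diff_quot F (U (Suc n) k) (U n k) - diff_quot F (u (Suc n) k) (u n k) - s k)" and
      bounds: "(\<Sum>k\<le>K. \<bar>\<rho> k\<bar>) \<le> consistency_const * E"
        "\<forall>k\<le>K. \<bar>s k\<bar> \<le> consistency_const * E"
        "\<forall>k<K. \<bar>s (Suc k) - s k\<bar> \<le> h * (consistency_const * E)"
        "\<forall>k\<le>K. \<bar>\<sigma> k\<bar> \<le> consistency_const * E"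
      using residuals[OF n] by (elim exE conjE) (rule that)
    show ?thesis unfolding y_def growth_rate_def
  proof (rule energy_step[where \<rho> = "\<rho>" and s = "s" and \<sigma> = "\<sigma>" and q = "q n"
      and D = "\<lambda>k. diff_quot F (U (Suc n) k) (U n k) - diff_quot F (u (Suc n) k) (u n k)"
      and g = "\<lambda>k. \<bar>U (Suc n) (Suc k) - U (Suc n) k\<bar> + \<bar>U n (Suc k) - U n k\<bar>
        + \<bar>u (Suc n) (Suc k) - u (Suc n) k\<bar> + \<bar>u n (Suc k) - u n k\<bar>"])
    show "1 \<le> K" using K by simp
    show "0 < h" "L = real K * h" "0 < \<gamma>" "0 < dt" "0 \<le> E" "0 \<le> error_const" "0 \<le> M" "0 \<le> 4 * G"
      using h0 Kh pos dt E error_const_nonneg M_nonneg G0 by simp_all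
    show "(\<Sum>k\<le>K. \<bar>\<rho> k\<bar>) \<le> error_const * E" using bounds(1) CE by simp
    show "\<bar>\<Sum>k\<le>K. trap_weight K h k * e n k\<bar> \<le> error_const * E"
      "\<bar>\<Sum>k\<le>K. trap_weight K h k * e (Suc n) k\<bar> \<le> error_const * E"
      using mean n by simp_all
    show "L2_set (\<lambda>k. \<bar>U (Suc n) (Suc k) - U (Suc n) k\<bar> + \<bar>U n (Suc k) - U n k\<bar>
        + \<bar>u (Suc n) (Suc k) - u (Suc n) k\<bar> + \<bar>u n (Suc k) - u n k\<bar>) {..<K} / sqrt h \<le> 4 * G"
      using h0 dU[of n] dU[of "Suc n"] du[of n] du[of "Suc n"] n unfolding u_def[abs_def, symmetric]
      by (intro L2_set_abs_sum4_le) (auto simp: u_def[abs_def])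
  next
    fix k assume k: "k \<le> K"
    show "trap_weight K h k * ((e (Suc n) k - e n k) / dt) = neumann_lap K (q n) k / h - \<rho> k"
      using A k by blast
    show "trap_weight K h k * q n k = - \<gamma> * neumann_lap K (\<lambda>k. (e (Suc n) k + e n k) / 2) k / h
        + (if k = 0 \<or> k = K then \<gamma> * ((e (Suc n) k - e n k) / dt) - \<sigma> k else 0)
        + trap_weight K h k * (diff_quot F (U (Suc n) k) (U n k) - diff_quot F (u (Suc n) k) (u n k) - s k)"
      using B k by blast
    show "\<bar>s k\<bar> \<le> error_const * E" "\<bar>\<sigma> k\<bar> \<le> error_const * E"
      using bounds(2,4) k CE by (meson order_trans)+
    show "\<bar>diff_quot F (U (Suc n) k) (U n k) - diff_quot F (u (Suc n) k) (u n k)\<bar> \<le> M * (\<bar>e n k\<bar> + \<bar>e (Suc n) k\<bar>)"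
      using diff_quot_Lipschitz[of "U (Suc n) k" "U n k" "u (Suc n) k" "u n k"] U_le u_le n k
      by (simp add: e_def add.commute)
  next
    fix k assume k: "k < K"
    have "h * (consistency_const * E) \<le> h * (error_const * E)" using CE h0 by simp
    then show "\<bar>s (Suc k) - s k\<bar> \<le> h * (error_const * E)" using bounds(3) k by (meson order_trans)
    have r: "\<bar>U (Suc n) k\<bar> \<le> r" "\<bar>U n k\<bar> \<le> r" "\<bar>u (Suc n) k\<bar> \<le> r" "\<bar>u n k\<bar> \<le> r"
      "\<bar>U (Suc n) (Suc k)\<bar> \<le> r" "\<bar>U n (Suc k)\<bar> \<le> r" "\<bar>u (Suc n) (Suc k)\<bar> \<le> r" "\<bar>u n (Suc k)\<bar> \<le> r"
      using k n U_le u_le by auto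
    show "\<bar>diff_quot F (U (Suc n) (Suc k)) (U n (Suc k)) - diff_quot F (u (Suc n) (Suc k)) (u n (Suc k))
        - (diff_quot F (U (Suc n) k) (U n k) - diff_quot F (u (Suc n) k) (u n k))\<bar>
      \<le> M * (\<bar>e n (Suc k) - e n k\<bar> + \<bar>e (Suc n) (Suc k) - e (Suc n) k\<bar>) + M * (\<bar>e n k\<bar> + \<bar>e (Suc n) k\<bar>) *
        (\<bar>U (Suc n) (Suc k) - U (Suc n) k\<bar> + \<bar>U n (Suc k) - U n k\<bar>
        + \<bar>u (Suc n) (Suc k) - u (Suc n) k\<bar> + \<bar>u n (Suc k) - u n k\<bar>)"
      using diff_quot_four_point[OF r]
      unfolding e_def add.commute[of "\<bar>U (Suc n) k - u (Suc n) k\<bar>"]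
        add.commute[of "\<bar>U (Suc n) (Suc k) - u (Suc n) (Suc k) - (U (Suc n) k - u (Suc n) k)\<bar>"] .
  qed simp
  qed
  \<comment> \<open>The initial values are exact at the nodes, so Gronwall starts from zero.\<close>
  have "y 0 = 0" using h0 e0 by (simp add: y_def diff_norm_sq)
  then have "y n \<le> exp (4 * (growth_rate G * dt) * real n) * E\<^sup>2"
    using step n rate0 dt small by (intro discrete_Gronwall[where N = N]) (auto simp: y_def)
  also have "\<dots> \<le> exp (4 * growth_rate G * T) * E\<^sup>2"
  proof -
    have "4 * growth_rate G * (real n * dt) \<le> 4 * growth_rate G * T"
      using rate0 time[OF n] by (intro mult_left_mono) auto
    then show ?thesis by (intro mult_right_mono) (auto simp: mult_ac)
  qed
  finally have "sqrt (y n) \<le> sqrt (exp (4 * growth_rate G * T) * E\<^sup>2)" by (rule real_sqrt_le_mono)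
  then have dn: "diff_norm K h (e n) \<le> sqrt (exp (4 * growth_rate G * T)) * E"
    using h0 E diff_norm_nonneg[of h K "e n"] by (simp add: y_def real_sqrt_mult)
  have "\<bar>e n k\<bar> \<le> \<bar>\<Sum>k\<le>K. trap_weight K h k * e n k\<bar> / L + sqrt L * diff_norm K h (e n)"
    using discrete_Sobolev[OF h0 _ Kh k, of "e n"] K by simp
  also have "\<dots> \<le> error_const * E / L + sqrt L * (sqrt (exp (4 * growth_rate G * T)) * E)"
    using mean[OF n] dn pos by (intro add_mono divide_right_mono mult_left_mono) auto
  also have "\<dots> = (error_const / L + sqrt L * sqrt (exp (4 * growth_rate G * T))) * E"
    by (simp add: algebra_simps)
  finally show ?thesis unfolding e_def u_def E_def .
qed

end

section \<open>Regularity of the exact solution\<close>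

text \<open>This identifies the derivatives that \<open>CH_solution\<close> asserts to exist with
  the family \<open>D\<close>, also at the end points where both are one-sided.\<close>

lemma real_derivative_unique_Icc:
  fixes f g :: "real \<Rightarrow> real"
  assumes "a < b" "x \<in> {a..b}"
    and "(f has_real_derivative f') (at x within {a..b})"
    and "(g has_real_derivative g') (at x within {a..b})"
    and "\<And>y. y \<in> {a..b} \<Longrightarrow> f y = g y"
  shows "f' = g'"
proof -
  have "(f has_real_derivative g') (at x within {a..b})"
    by (rule has_field_derivative_transform_within[OF assms(4), of 1]) (use assms in auto)
  then show ?thesis
    using assms vector_derivative_unique_within_closed_interval[of a b x f f' g']
    by (simp add: has_real_derivative_iff_has_vector_derivative cbox_interval)
qed

lemma eq_on_Icc_if_eq_on_interior:
  fixes f g :: "real \<Rightarrow> real"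
  assumes "a < b" "continuous_on {a..b} f" "continuous_on {a..b} g"
    and "\<And>x. x \<in> {a<..<b} \<Longrightarrow> f x = g x" and "x \<in> {a..b}"
  shows "f x = g x"
proof -
  have cl: "closure {a<..<b} = {a..b}" using assms(1) by simp
  have "f x - g x = 0"
    by (rule continuous_constant_on_closure[of "{a<..<b}"])
      (use assms in \<open>auto simp: cl intro!: continuous_on_diff\<close>)
  then show ?thesis by simp
qed

text \<open>
  All boundary values are recovered from the interior equations by continuity, so that neither
  \<open>p\<close> nor its extension is needed any more.
\<close>

lemma CH_solution_pressure:
  assumes L: "0 < L" and T: "0 < T" and C4: "C_real 4 F" and sol: "CH_solution L T \<gamma> F u0 u p"
    and D0: "\<And>x t. x \<in> {0..L} \<Longrightarrow> t \<in> {0..T} \<Longrightarrow> D 0 0 x t = u x t"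
    and Dx: "\<And>i j x t. i + j < 5 \<Longrightarrow> x \<in> {0..L} \<Longrightarrow> t \<in> {0..T} \<Longrightarrow>
      ((\<lambda>y. D i j y t) has_real_derivative D (Suc i) j x t) (at x within {0..L})"
    and Dt: "\<And>i j x t. i + j < 5 \<Longrightarrow> x \<in> {0..L} \<Longrightarrow> t \<in> {0..T} \<Longrightarrow>
      ((\<lambda>s. D i j x s) has_real_derivative D i (Suc j) x t) (at t within {0..T})"
    and t: "t \<in> {0<..T}"
  shows "\<And>x. x \<in> {0..L} \<Longrightarrow>
      ((\<lambda>y. - \<gamma> * D 3 0 y t + (deriv ^^ 2) F (D 0 0 y t) * D 1 0 y t)
        has_real_derivative D 0 1 x t) (at x within {0..L})"
    and "\<And>x. x \<in> {0, L} \<Longrightarrow> - \<gamma> * D 3 0 x t + (deriv ^^ 2) F (D 0 0 x t) * D 1 0 x t = 0"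
    and "D 0 1 0 t = D 1 0 0 t" and "D 0 1 L t = - D 1 0 L t"
proof -
  have F: "((deriv ^^ i) F has_real_derivative (deriv ^^ Suc i) F x) (at x)" if "i < 4" for i x
    using C4 that by (auto simp: C_real_def)
  have F1: "(deriv F has_real_derivative (deriv ^^ 2) F x) (at x)"
    and F2: "((deriv ^^ 2) F has_real_derivative (deriv ^^ 3) F x) (at x)" for x
    using F[of 1 x] F[of 2 x] by (simp_all add: numeral_2_eq_2 numeral_3_eq_3)
  obtain ut ux uxx px pxx :: "real \<Rightarrow> real \<Rightarrow> real" where
    sol': "\<And>x. x \<in> {0..L} \<Longrightarrow> ((\<lambda>s. u x s) has_real_derivative ut x t) (at t within {0..T})"
      "\<And>x. x \<in> {0..L} \<Longrightarrow> ((\<lambda>y. u y t) has_real_derivative ux x t) (at x within {0..L})"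
      "\<And>x. x \<in> {0..L} \<Longrightarrow> ((\<lambda>y. p y t) has_real_derivative px x t) (at x within {0..L})"
      "\<And>x. x \<in> {0<..<L} \<Longrightarrow> ((\<lambda>y. ux y t) has_real_derivative uxx x t) (at x)"
      "\<And>x. x \<in> {0<..<L} \<Longrightarrow> ((\<lambda>y. px y t) has_real_derivative pxx x t) (at x)"
      "\<And>x. x \<in> {0<..<L} \<Longrightarrow> ut x t = pxx x t"
      "\<And>x. x \<in> {0<..<L} \<Longrightarrow> p x t = - \<gamma> * uxx x t + deriv F (u x t)"
      "ut 0 t = ux 0 t" "ut L t = - ux L t" "px 0 t = 0" "px L t = 0"
    using sol t unfolding CH_solution_def by blast
  have tT: "t \<in> {0..T}" using t by simp
  have dx: "((\<lambda>y. D i 0 y t) has_real_derivative D (Suc i) 0 x t) (at x within {0..L})"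
    if "i < 5" "x \<in> {0..L}" for i x using that tT by (intro Dx) auto
  have cont: "continuous_on {0..L} (\<lambda>y. D i j y t)" if "i + j < 5" for i j
    using Dx[OF that _ tT] by (rule DERIV_continuous_on)
  have ux: "ux x t = D 1 0 x t" if "x \<in> {0..L}" for x
    using real_derivative_unique_Icc[OF L that sol'(2)[OF that] dx[of 0 x]] that D0 tT by simp
  have ut: "ut x t = D 0 1 x t" if "x \<in> {0..L}" for x
    using real_derivative_unique_Icc[OF T tT sol'(1)[OF that] Dt[of 0 0 x t]] that D0 tT by simp
  have uxx: "uxx x t = D 2 0 x t" if x: "x \<in> {0<..<L}" for x
  proof -
    have "((\<lambda>y. D 1 0 y t) has_real_derivative uxx x t) (at x)"
      by (rule has_field_derivative_transform_within_open[OF sol'(4)[OF x] _ x]) (auto simp: ux)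
    moreover have "((\<lambda>y. D 1 0 y t) has_real_derivative D 2 0 x t) (at x)"
      using dx[of 1 x] x at_within_interior[of x "{0..L}"] by (simp add: interior_atLeastAtMost_real numeral_2_eq_2)
    ultimately show ?thesis by (rule DERIV_unique)
  qed
  define G where "G x = - \<gamma> * D 2 0 x t + deriv F (D 0 0 x t)" for x
  define G1 where "G1 x = - \<gamma> * D 3 0 x t + (deriv ^^ 2) F (D 0 0 x t) * D 1 0 x t" for x
  \<comment> \<open>The derivative of \<open>G1\<close> by the chain and product rules. As p_x is
    \<open>G1\<close> on the closed interval, \<open>G2\<close> is p_xx inside and equals u_t
    there.\<close>
  define G2 where "G2 x = - \<gamma> * D 4 0 x t
    + ((deriv ^^ 3) F (D 0 0 x t) * D 1 0 x t * D 1 0 x t + D 2 0 x t * (deriv ^^ 2) F (D 0 0 x t))" for x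
  have G: "(G has_real_derivative G1 x) (at x within {0..L})" if x: "x \<in> {0..L}" for x
    unfolding G_def[abs_def] G1_def
    using dx[OF _ x, of 0] dx[OF _ x, of 2]
    by (intro DERIV_add DERIV_cmult DERIV_chain2[OF F1]) (auto simp: numeral_3_eq_3 numeral_2_eq_2)
  have G1: "(G1 has_real_derivative G2 x) (at x within {0..L})" if x: "x \<in> {0..L}" for x
    unfolding G1_def[abs_def] G2_def
    using dx[OF _ x, of 0] dx[OF _ x, of 1] dx[OF _ x, of 3]
    by (intro DERIV_add DERIV_cmult DERIV_mult DERIV_chain2[OF F2]) (auto simp: eval_nat_numeral)
  have pG: "p x t = G x" if "x \<in> {0..L}" for x
  proof (rule eq_on_Icc_if_eq_on_interior[OF L _ _ _ that])
    show "continuous_on {0..L} (\<lambda>x. p x t)" by (rule DERIV_continuous_on, erule sol'(3))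
    show "continuous_on {0..L} G" by (rule DERIV_continuous_on, erule G)
    show "p x t = G x" if "x \<in> {0<..<L}" for x
      using sol'(7)[OF that] uxx[OF that] D0[of x t] that tT by (simp add: G_def)
  qed
  have px: "px x t = G1 x" if "x \<in> {0..L}" for x
    using real_derivative_unique_Icc[OF L that sol'(3)[OF that] G[OF that]] pG by simp
  have G2: "G2 x = D 0 1 x t" if "x \<in> {0..L}" for x
  proof (rule eq_on_Icc_if_eq_on_interior[OF L _ _ _ that])
    have "continuous_on {0..L} (\<lambda>x. (deriv ^^ i) F (D 0 0 x t))" if "i < 4" for i
    proof -
      have "continuous_on UNIV ((deriv ^^ i) F)" by (rule DERIV_continuous_on, rule F[OF that])
      then show ?thesis by (rule continuous_on_compose2) (auto intro: cont)
    qed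
    then show "continuous_on {0..L} G2" unfolding G2_def[abs_def] by (intro continuous_intros cont) auto
    show "continuous_on {0..L} (\<lambda>x. D 0 1 x t)" by (rule cont) simp
    show "G2 x = D 0 1 x t" if x: "x \<in> {0<..<L}" for x
    proof -
      have "(G1 has_real_derivative pxx x t) (at x)"
        by (rule has_field_derivative_transform_within_open[OF sol'(5)[OF x] _ x]) (auto simp: px)
      moreover have "(G1 has_real_derivative G2 x) (at x)"
        using G1[of x] x at_within_interior[of x "{0..L}"] by (simp add: interior_atLeastAtMost_real)
      ultimately have "G2 x = pxx x t" by (rule DERIV_unique[symmetric])
      then show ?thesis using sol'(6)[OF x] ut[of x] x by simp
    qed
  qed
  show "((\<lambda>y. - \<gamma> * D 3 0 y t + (deriv ^^ 2) F (D 0 0 y t) * D 1 0 y t)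
      has_real_derivative D 0 1 x t) (at x within {0..L})" if "x \<in> {0..L}" for x
    using G1[OF that] G2[OF that] by (simp add: G1_def[abs_def])
  show "- \<gamma> * D 3 0 x t + (deriv ^^ 2) F (D 0 0 x t) * D 1 0 x t = 0" if "x \<in> {0, L}" for x
    using that px[of x] sol'(10,11) L by (auto simp: G1_def)
  show "D 0 1 0 t = D 1 0 0 t" "D 0 1 L t = - D 1 0 L t"
    using sol'(8,9) ut[of 0] ut[of L] ux[of 0] ux[of L] L by simp_all
qed

text \<open>The sum of the absolute values of the individual bounds dominates each of them and is
  nonnegative even for an empty family.\<close>

lemma bounded_finite_family:
  fixes f :: "'a \<Rightarrow> 'b::topological_space \<Rightarrow> real"
  assumes "finite I" "compact S" "\<And>i. i \<in> I \<Longrightarrow> continuous_on S (f i)"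
  obtains B where "0 \<le> B" "\<And>i x. i \<in> I \<Longrightarrow> x \<in> S \<Longrightarrow> \<bar>f i x\<bar> \<le> B"
proof -
  have "\<forall>i\<in>I. \<exists>b. \<forall>x\<in>S. \<bar>f i x\<bar> \<le> b"
    using compact_imp_bounded[OF compact_continuous_image[OF assms(3) assms(2)]]
    by (simp add: bounded_iff)
  then obtain b where b: "\<forall>i\<in>I. \<forall>x\<in>S. \<bar>f i x\<bar> \<le> b i" using bchoice by metis
  show thesis
  proof (rule that[of "\<Sum>i\<in>I. \<bar>b i\<bar>"])
    fix i x assume i: "i \<in> I" "x \<in> S"
    have "\<bar>b i\<bar> \<le> (\<Sum>i\<in>I. \<bar>b i\<bar>)" using i assms(1) by (intro member_le_sum) auto
    moreover have "\<bar>f i x\<bar> \<le> b i" using b i by blast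
    ultimately show "\<bar>f i x\<bar> \<le> (\<Sum>i\<in>I. \<bar>b i\<bar>)" by linarith
  qed (simp add: sum_nonneg)
qed

text \<open>\<open>R\<close> will be \<open>C2\<close>. It enters \<open>r\<close> before the
  derivatives of \<open>F\<close> are bounded on \<open>{- r..r}\<close>, so \<open>M\<close> is
  fixed before any grid or numerical solution is chosen.\<close>

lemma CH_regular_exists:
  assumes pos: "0 < L" "0 < T" "0 < \<gamma>" and C4: "C_real 4 F"
    and sol: "CH_solution L T \<gamma> F u0 u p" and u: "C_rect 5 {0..L} {0..T} u"
  obtains D r M where "CH_regular F r M L T \<gamma> D" "R \<le> r" "0 \<le> r"
    "\<And>x t. x \<in> {0..L} \<Longrightarrow> t \<in> {0..T} \<Longrightarrow> D 0 0 x t = u x t"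
proof -
  obtain D :: "nat \<Rightarrow> nat \<Rightarrow> real \<Rightarrow> real \<Rightarrow> real" where
    D0: "\<And>x t. x \<in> {0..L} \<Longrightarrow> t \<in> {0..T} \<Longrightarrow> D 0 0 x t = u x t" and
    Dc: "\<And>i j. i + j \<le> 5 \<Longrightarrow> continuous_on ({0..L} \<times> {0..T}) (\<lambda>(x, t). D i j x t)" and
    Dx: "\<And>i j x t. i + j < 5 \<Longrightarrow> x \<in> {0..L} \<Longrightarrow> t \<in> {0..T} \<Longrightarrow>
      ((\<lambda>y. D i j y t) has_real_derivative D (Suc i) j x t) (at x within {0..L})" and
    Dt: "\<And>i j x t. i + j < 5 \<Longrightarrow> x \<in> {0..L} \<Longrightarrow> t \<in> {0..T} \<Longrightarrow>
      ((\<lambda>s. D i j x s) has_real_derivative D i (Suc j) x t) (at t within {0..T})"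
    using u unfolding C_rect_def by blast
  have fin: "finite {(i, j). i + j \<le> (5::nat)}"
    by (rule finite_subset[of _ "{..5} \<times> {..5}"]) auto
  obtain B where B: "0 \<le> B" "\<And>ij z. ij \<in> {(i, j). i + j \<le> 5} \<Longrightarrow> z \<in> {0..L} \<times> {0..T} \<Longrightarrow>
      \<bar>(case ij of (i, j) \<Rightarrow> \<lambda>(x, t). D i j x t) z\<bar> \<le> B"
    by (rule bounded_finite_family[OF fin, of "{0..L} \<times> {0..T}" "\<lambda>(i, j) (x, t). D i j x t"])
      (use Dc in \<open>auto intro!: compact_Times\<close>)
  have DB: "\<bar>D i j x t\<bar> \<le> B" if "i + j \<le> 5" "x \<in> {0..L}" "t \<in> {0..T}" for i j x t
    using B(2)[of "(i, j)" "(x, t)"] that by auto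
  define r where "r = max \<bar>R\<bar> B"
  have cF: "continuous_on {- r..r} ((deriv ^^ i) F)" if "i \<in> {..4}" for i
  proof (cases "i = 4")
    case True
    then show ?thesis using C4 by (auto simp: C_real_def intro: continuous_on_subset)
  next
    case False
    then have "i < 4" using that by auto
    then have d: "((deriv ^^ i) F has_real_derivative (deriv ^^ Suc i) F x) (at x)" for x
      using C4 unfolding C_real_def by blast
    show ?thesis by (rule DERIV_continuous_on, rule has_field_derivative_at_within, rule d)
  qed
  obtain B' where B': "0 \<le> B'" "\<And>i x. i \<in> {..4} \<Longrightarrow> x \<in> {- r..r} \<Longrightarrow> \<bar>(deriv ^^ i) F x\<bar> \<le> B'"
    by (rule bounded_finite_family[of "{..4}" "{- r..r}" "\<lambda>i. (deriv ^^ i) F"]) (use cF in auto)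
  note pr = CH_solution_pressure[OF pos(1,2) C4 sol D0 Dx Dt]
  have "CH_regular F r (B + B') L T \<gamma> D"
  proof
    show "C_real 4 F" by fact
    show "\<bar>(deriv ^^ i) F x\<bar> \<le> B + B'" if "i \<le> 4" "\<bar>x\<bar> \<le> r" for i x
      using B'(2)[of i x] that B(1) by (simp add: abs_le_iff)
    show "\<bar>D i j x t\<bar> \<le> B + B'" if "i + j \<le> 5" "x \<in> {0..L}" "t \<in> {0..T}" for i j x t
      using DB[OF that] B'(1) by simp
    show "\<bar>D 0 0 x t\<bar> \<le> r" if "x \<in> {0..L}" "t \<in> {0..T}" for x t
      using DB[of 0 0 x t] that by (simp add: r_def)
  qed (use pos Dx Dt pr in auto)
  then show thesis by (rule that) (auto simp: r_def D0)
qed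

section \<open>Elimination of ghost values and interpolation\<close>

text \<open>Vanishing flux reflects \<open>P\<close> at the ends. The dynamic conditions make the
  ghost value of the time average the reflected value minus \<open>2 * h\<close> times the velocity,
  with the same sign at both ends. The boundary weight halves the doubled differences and leaves
  \<gamma> times the velocity without a power of \<open>h\<close>.\<close>

lemma scheme_trap_weight:
  assumes scheme: "scheme \<gamma> F K N h dt U P" and K: "1 \<le> K" and h: "0 < h" and n: "n < N" and k: "k \<le> K"
  shows "trap_weight K h k * ((U (Suc n) (int k) - U n (int k)) / dt)
      = neumann_lap K (\<lambda>k. P n (int k)) k / h"
    and "trap_weight K h k * P n (int k)
      = - \<gamma> * neumann_lap K (\<lambda>k. (U (Suc n) (int k) + U n (int k)) / 2) k / h
        + (if k = 0 \<or> k = K then \<gamma> * ((U (Suc n) (int k) - U n (int k)) / dt) else 0)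
        + trap_weight K h k * diff_quot F (U (Suc n) (int k)) (U n (int k))"
proof -
  define V where "V k = (U (Suc n) k + U n k) / 2" for k
  define ut where "ut k = (U (Suc n) k - U n k) / dt" for k
  define f where "f k = diff_quot F (U (Suc n) k) (U n k)" for k
  have S: "ut (int k) = \<delta>two h (P n) (int k)" "P n (int k) = - \<gamma> * \<delta>two h V (int k) + f (int k)"
    "ut 0 = \<delta>one h V 0" "ut (int K) = - \<delta>one h V (int K)"
    "\<delta>one h (P n) 0 = 0" "\<delta>one h (P n) (int K) = 0"
    using scheme n k unfolding scheme_def Let_def V_def[abs_def] ut_def f_def by auto
  have V0: "V (- 1) = V 1 - 2 * h * ut 0" and P0: "P n (- 1) = P n 1"
    using S(3,5) h by (simp_all add: \<delta>one_def)
  have VK: "V (int K + 1) = V (int K - 1) - 2 * h * ut (int K)"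
    and PK: "P n (int K + 1) = P n (int K - 1)"
    using S(4,6) h by (simp_all add: \<delta>one_def)
  have idx: "int (k - 1) = int k - 1" "int (Suc k) = int k + 1" if "0 < k" for k using that by auto
  have alg1: "h / 2 * ((2 * a) / h\<^sup>2) = a / h" "h * (a / h\<^sup>2) = a / h" for a :: real
    using h by (simp_all add: power2_eq_square)
  have alg2: "h / 2 * (- \<gamma> * ((2 * a - 2 * h * b) / h\<^sup>2) + c) = - \<gamma> * a / h + \<gamma> * b + h / 2 * c"
    "h * (- \<gamma> * (a / h\<^sup>2) + c) = - \<gamma> * a / h + h * c" for a b c :: real
    using h by (simp_all add: power2_eq_square field_simps)
  consider "k = 0" | "k = K" "0 < k" | "0 < k" "k < K" using k by linarith
  then have "trap_weight K h k * ut (int k) = neumann_lap K (\<lambda>k. P n (int k)) k / h \<and>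
    trap_weight K h k * P n (int k) = - \<gamma> * neumann_lap K (\<lambda>k. V (int k)) k / h
        + (if k = 0 \<or> k = K then \<gamma> * ut (int k) else 0) + trap_weight K h k * f (int k)"
  proof cases
    case 1
    have ut: "ut 0 = 2 * (P n 1 - P n 0) / h\<^sup>2"
      using S(1) 1 P0 by (simp add: \<delta>two_def)
    have P: "P n 0 = - \<gamma> * ((2 * (V 1 - V 0) - 2 * h * ut 0) / h\<^sup>2) + f 0"
      using S(2) 1 V0 by (simp add: \<delta>two_def algebra_simps)
    have "h / 2 * ut 0 = (P n 1 - P n 0) / h" unfolding ut by (rule alg1(1))
    moreover have "h / 2 * P n 0 = - \<gamma> * (V 1 - V 0) / h + \<gamma> * ut 0 + h / 2 * f 0"
      by (subst P) (rule alg2(1))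
    moreover have w: "trap_weight K h 0 = h / 2" and l: "neumann_lap K (\<lambda>k. W (int k)) 0 = W 1 - W 0" for W
      using K by (simp_all add: trap_weight_def neumann_lap_def)
    ultimately show ?thesis unfolding 1 of_nat_0 w l by (simp only: simp_thms if_True)
  next
    case 2
    have ut: "ut (int K) = 2 * (P n (int K - 1) - P n (int K)) / h\<^sup>2"
      using S(1) 2 PK by (simp add: \<delta>two_def)
    have P: "P n (int K) = - \<gamma> * ((2 * (V (int K - 1) - V (int K)) - 2 * h * ut (int K)) / h\<^sup>2) + f (int K)"
    proof -
      have "\<delta>two h V (int K) = (2 * (V (int K - 1) - V (int K)) - 2 * h * ut (int K)) / h\<^sup>2"
        by (simp add: \<delta>two_def VK)
      then show ?thesis using S(2) 2 by simp
    qed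
    have "h / 2 * ut (int K) = (P n (int K - 1) - P n (int K)) / h" unfolding ut by (rule alg1(1))
    moreover have "h / 2 * P n (int K)
        = - \<gamma> * (V (int K - 1) - V (int K)) / h + \<gamma> * ut (int K) + h / 2 * f (int K)"
      by (subst P) (rule alg2(1))
    moreover have w: "trap_weight K h K = h / 2"
      and l: "neumann_lap K (\<lambda>k. W (int k)) K = W (int K - 1) - W (int K)" for W
      using 2 idx(1)[of K] by (simp_all add: trap_weight_def neumann_lap_def)
    ultimately show ?thesis unfolding 2(1) w l by (simp only: simp_thms if_True)
  next
    case 3
    have N: "neumann_lap K (\<lambda>k. W (int k)) k = W (int k + 1) - 2 * W (int k) + W (int k - 1)" for W :: "int \<Rightarrow> real"
      using 3 by (simp add: neumann_lap_def idx add.commute)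
    have w: "trap_weight K h k = h" using 3 by (simp add: trap_weight_def)
    have ut: "ut (int k) = neumann_lap K (\<lambda>k. P n (int k)) k / h\<^sup>2"
      unfolding N using S(1) by (simp only: \<delta>two_def)
    have P: "P n (int k) = - \<gamma> * (neumann_lap K (\<lambda>k. V (int k)) k / h\<^sup>2) + f (int k)"
      unfolding N using S(2) by (simp only: \<delta>two_def)
    have "h * ut (int k) = neumann_lap K (\<lambda>k. P n (int k)) k / h" unfolding ut by (rule alg1(2))
    moreover have "h * P n (int k) = - \<gamma> * neumann_lap K (\<lambda>k. V (int k)) k / h + h * f (int k)"
      by (subst P) (rule alg2(2))
    moreover have "(k = 0 \<or> k = K) = False" using 3 by simp
    ultimately show ?thesis unfolding w by (simp only: simp_thms if_False add_0_right)
  qed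
  then show "trap_weight K h k * ((U (Suc n) (int k) - U n (int k)) / dt)
      = neumann_lap K (\<lambda>k. P n (int k)) k / h"
    and "trap_weight K h k * P n (int k)
      = - \<gamma> * neumann_lap K (\<lambda>k. (U (Suc n) (int k) + U n (int k)) / 2) k / h
        + (if k = 0 \<or> k = K then \<gamma> * ((U (Suc n) (int k) - U n (int k)) / dt) else 0)
        + trap_weight K h k * diff_quot F (U (Suc n) (int k)) (U n (int k))"
    unfolding V_def ut_def f_def by simp_all
qed

lemma norm_D_eq_diff_norm:
  assumes "0 < h"
  shows "norm_D K h f = diff_norm K h (\<lambda>k. f (int k))"
proof -
  have "(\<Sum>k\<in>{0..int K - 1}. \<bar>\<delta>plus h f k\<bar>\<^sup>2 * h) = (\<Sum>k<K. \<bar>\<delta>plus h f (int k)\<bar>\<^sup>2 * h)"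
    by (rule sum.reindex_bij_witness[of _ int nat]) auto
  also have "\<dots> = (\<Sum>k<K. (f (int (Suc k)) - f (int k))\<^sup>2) / h"
    using assms unfolding sum_divide_distrib
    by (intro sum.cong) (simp_all add: \<delta>plus_def power_divide power2_eq_square add.commute)
  finally show ?thesis
    using assms by (simp add: norm_D_def diff_norm_def L2_set_def real_sqrt_divide)
qed

lemma abs_le_norm_Linf_d:
  assumes "k \<le> K"
  shows "\<bar>f (int k)\<bar> \<le> norm_Linf_d K f"
  unfolding norm_Linf_d_def using assms by (intro Max_ge) auto

lemma Max_max_leD:
  fixes a b :: "nat \<Rightarrow> real"
  assumes "(MAX n\<in>{0..N}. max (a n) (b n)) \<le> C" "n \<le> N"
  shows "a n \<le> C" "b n \<le> C"
proof -
  have "max (a n) (b n) \<le> (MAX n\<in>{0..N}. max (a n) (b n))"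
    using assms(2) by (intro Max_ge) auto
  also note assms(1)
  finally show "a n \<le> C" "b n \<le> C" by simp_all
qed

section \<open>Interpolation between the grid points\<close>

lemma cell_exists:
  fixes h x :: real
  assumes "0 < h" "1 \<le> K" "0 \<le> x" "x \<le> real K * h"
  shows "\<exists>k<K. x \<in> {real k * h..(real k + 1) * h}"
  using assms(2,4)
proof (induction K)
  case (Suc K)
  show ?case
  proof (cases "K \<noteq> 0 \<and> x \<le> real K * h")
    case True
    then show ?thesis using Suc.IH by (metis less_Suc_eq not_less_eq_eq One_nat_def le_0_eq not0_implies_Suc Suc_le_mono zero_le)
  next
    case False
    then have "real K * h \<le> x" using assms(3) by auto
    then show ?thesis using Suc.prems by (intro exI[of _ K]) (simp add: add.commute)
  qed
qed simp

text \<open>The floor takes countably many values, and for each of them the formula is affine in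
  \<open>x\<close>.\<close>

lemma borel_measurable_interpolant:
  "(\<lambda>x. interpolant K N h dt U x t) \<in> borel_measurable borel"
proof -
  have "(\<lambda>x. (\<lambda>i x. bilinear_cell h dt U (min i (int K - 1)) (nat (min \<lfloor>t / dt\<rfloor> (int N - 1))) x t)
      \<lfloor>x / h\<rfloor> x) \<in> borel_measurable borel"
    by (rule measurable_compose_countable) (simp_all add: bilinear_cell_def)
  then show ?thesis by (simp add: interpolant_def[abs_def])
qed

lemma derivs_on_subset:
  assumes "derivs_on m S f B" "S' \<subseteq> S"
  shows "derivs_on m S' f B"
  using assms unfolding derivs_on_def by (blast intro: has_field_derivative_subset)

text \<open>Interpolation first in time at the nodes, then in space. Convex combinations do not
  enlarge the nodal error \<open>c\<close>, and each interpolation of the exact solution adds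
  \<open>2 * M\<close> times the square of its step.\<close>

lemma (in CH_regular) interpolant_error:
  assumes K: "1 \<le> K" "h = L / real K" and dt: "0 < dt" "T = real N * dt"
    and err: "\<And>n k. n \<le> N \<Longrightarrow> k \<le> K \<Longrightarrow> \<bar>U n (int k) - D 0 0 (real k * h) (real n * dt)\<bar> \<le> c"
    and x: "x \<in> {0..L}" and t: "t \<in> {0..T}"
  shows "\<bar>interpolant K N h dt U x t - D 0 0 x t\<bar> \<le> c + 2 * M * (h\<^sup>2 + dt\<^sup>2)"
proof -
  have h: "0 < h" "real K * h = L" using K pos by simp_all
  have N: "1 \<le> N" using dt pos by (cases N) auto
  obtain k where k: "k < K" "x \<in> {real k * h..(real k + 1) * h}"
    using cell_exists[of h K x] h K x by auto
  obtain n where n: "n < N" "t \<in> {real n * dt..(real n + 1) * dt}"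
    using cell_exists[of dt N t] dt N t by auto
  define \<theta> where "\<theta> = x / h - real k"
  define \<mu> where "\<mu> = t / dt - real n"
  have \<theta>: "0 \<le> \<theta>" "\<theta> \<le> 1" "real k * h + \<theta> * h = x"
    using k(2) h by (auto simp: \<theta>_def field_simps)
  have \<mu>: "0 \<le> \<mu>" "\<mu> \<le> 1" "real n * dt + \<mu> * dt = t"
    using n(2) dt by (auto simp: \<mu>_def field_simps)
  have node: "real i * h \<in> {0..L}" if "i \<le> K" for i
    using that h mult_right_mono[of "real i" "real K" h] by simp
  have time: "real i * dt \<in> {0..T}" if "i \<le> N" for i
    using that dt mult_right_mono[of "real i" "real N" dt] by simp
  define W where "W i = (1 - \<mu>) * U n (int i) + \<mu> * U (Suc n) (int i)" for i
  have W: "\<bar>W i - D 0 0 (real i * h) t\<bar> \<le> c + 2 * M * dt\<^sup>2" if i: "i \<le> K" for i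
  proof -
    let ?u = "D 0 0 (real i * h)"
    have t1: "real n * dt + dt = real (Suc n) * dt" by (simp add: algebra_simps)
    have "derivs_on 2 {real n * dt..real n * dt + dt} (\<lambda>l. D 0 (0 + l) (real i * h)) M"
      by (rule derivs_on_subset[OF derivs_on_t[OF _ node[OF i]]])
        (use time[of n] time[of "Suc n"] n(1) in \<open>auto simp: algebra_simps\<close>)
    from linear_interpolation_error[OF this \<mu>(1,2)] dt \<mu>(3)
    have "\<bar>(1 - \<mu>) * ?u (real n * dt) + \<mu> * ?u (real (Suc n) * dt) - ?u t\<bar> \<le> 2 * M * dt\<^sup>2"
      unfolding t1[symmetric] by simp
    moreover have "\<bar>\<mu> * (U (Suc n) (int i) - ?u (real (Suc n) * dt)) + (1 - \<mu>) * (U n (int i) - ?u (real n * dt))\<bar> \<le> c"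
      using err[of n i] err[of "Suc n" i] n i \<mu> by (intro abs_convex_le) auto
    moreover have "W i - ?u t = (\<mu> * (U (Suc n) (int i) - ?u (real (Suc n) * dt)) + (1 - \<mu>) * (U n (int i) - ?u (real n * dt)))
        + ((1 - \<mu>) * ?u (real n * dt) + \<mu> * ?u (real (Suc n) * dt) - ?u t)"
      by (simp add: W_def algebra_simps)
    ultimately show ?thesis by linarith
  qed
  have x1: "real k * h + h = real (Suc k) * h" by (simp add: algebra_simps)
  have "derivs_on 2 {real k * h..real k * h + h} (\<lambda>l x. D (0 + l) 0 x t) M"
    by (rule derivs_on_subset[OF derivs_on_x[OF _ t]])
      (use node[of k] node[of "Suc k"] k(1) in \<open>auto simp: algebra_simps\<close>)
  from linear_interpolation_error[OF this \<theta>(1,2)] h \<theta>(3)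
  have "\<bar>(1 - \<theta>) * D 0 0 (real k * h) t + \<theta> * D 0 0 (real (Suc k) * h) t - D 0 0 x t\<bar> \<le> 2 * M * h\<^sup>2"
    unfolding x1[symmetric] by simp
  moreover have "\<bar>\<theta> * (W (Suc k) - D 0 0 (real (Suc k) * h) t) + (1 - \<theta>) * (W k - D 0 0 (real k * h) t)\<bar>
      \<le> c + 2 * M * dt\<^sup>2"
    using W[of k] W[of "Suc k"] k \<theta> by (intro abs_convex_le) auto
  moreover have "interpolant K N h dt U x t = (1 - \<theta>) * W k + \<theta> * W (Suc k)"
    unfolding interpolant_on_cell[OF h(1) dt(1) k(1) n(1) k(2) n(2)] bilinear_cell_split W_def
    by (simp add: \<theta>_def \<mu>_def algebra_simps)
  then have "interpolant K N h dt U x t - D 0 0 x t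
      = (\<theta> * (W (Suc k) - D 0 0 (real (Suc k) * h) t) + (1 - \<theta>) * (W k - D 0 0 (real k * h) t))
        + ((1 - \<theta>) * D 0 0 (real k * h) t + \<theta> * D 0 0 (real (Suc k) * h) t - D 0 0 x t)"
    by (simp add: algebra_simps)
  ultimately show ?thesis by (simp only: distrib_left)
qed

text \<open>Measurability is a real condition here, as \<open>esssup\<close> has the default value
  \<open>top\<close> for functions that are not measurable.\<close>

lemma norm_Linf_le:
  assumes "f \<in> borel_measurable (lebesgue_on S)" "\<And>x. x \<in> S \<Longrightarrow> \<bar>f x\<bar> \<le> c"
  shows "norm_Linf S f \<le> ereal c"
  unfolding norm_Linf_def
proof (rule esssup_I)
  show "(\<lambda>x. ereal \<bar>f x\<bar>) \<in> borel_measurable (lebesgue_on S)" using assms(1) by measurable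
  show "AE x in lebesgue_on S. ereal \<bar>f x\<bar> \<le> ereal c"
    using assms(2) by (intro AE_I2) simp
qed

theorem theorem5p1:
  fixes L T \<gamma> B C1 C2 :: real
    and F u0 :: "real \<Rightarrow> real"
    and u p :: "real \<Rightarrow> real \<Rightarrow> real"
  assumes "L > 0" and "T > 0" and "\<gamma> > 0"
    and "bdd_below (range F)"
    and "C_real 4 F"
    and "CH_solution L T \<gamma> F u0 u p"
    and "C_rect 5 {0..L} {0..T} u"
    and "0 < B"
    and "C3_const L F C1 C2 \<noteq> 0 \<longrightarrow> B < \<gamma> / (C3_const L F C1 C2)\<^sup>2"
  shows "\<exists>C::real. \<forall>(K::nat) (N::nat) (\<Delta>x::real) (\<Delta>t::real) u_ext p_ext U P.
    K \<ge> 1 \<longrightarrow> \<Delta>x = L / real K \<longrightarrow> \<Delta>t > 0 \<longrightarrow> T = real N * \<Delta>t \<longrightarrow>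
    extension_u L T \<Delta>x u u_ext \<longrightarrow>
    extension_p L T \<Delta>x p p_ext \<longrightarrow>
    scheme \<gamma> F K N \<Delta>x \<Delta>t U P \<longrightarrow>
    (\<forall>k\<in>{-1..int K + 1}. U 0 k = u_ext (of_int k * \<Delta>x) 0) \<longrightarrow>
    (MAX n\<in>{0..N}. max (norm_D K \<Delta>x (U n))
        (norm_D K \<Delta>x (\<lambda>k. u (of_int k * \<Delta>x) (real n * \<Delta>t)))) \<le> C1 \<longrightarrow>
    (MAX n\<in>{0..N}. max (norm_Linf_d K (U n))
        (norm_Linf_d K (\<lambda>k. u (of_int k * \<Delta>x) (real n * \<Delta>t)))) \<le> C2 \<longrightarrow>
    \<Delta>t < B \<longrightarrow>
    (\<forall>t\<in>{0..T}. norm_Linf {0<..<L} (\<lambda>x. interpolant K N \<Delta>x \<Delta>t U x t - u x t)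
        \<le> ereal (C * (\<Delta>x\<^sup>2 + \<Delta>t\<^sup>2)))"
proof -
  obtain D r M where reg: "CH_regular F r M L T \<gamma> D" and r: "C2 \<le> r" "0 \<le> r"
    and Du: "\<And>x t. x \<in> {0..L} \<Longrightarrow> t \<in> {0..T} \<Longrightarrow> D 0 0 x t = u x t"
    using CH_regular_exists[OF assms(1-3,5-7)] by metis
  interpret CH_regular F r M L T \<gamma> D by (rule reg)
  define c where "c = growth_rate C1"
  define A where "A = error_const / L + sqrt L * sqrt (exp (4 * c * T))"
  \<comment> \<open>\<open>A\<close> is the constant of \<open>grid_error\<close>. Where the error
    is only known to be at most \<open>2 * r\<close>, the second term serves \<open>K = 1\<close>,
    when \<open>h = L\<close>, and the third serves \<open>c * dt > 1 / 2\<close>, when (2 c dt)^2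
    exceeds 1. The last term is the interpolation error.\<close>
  define C where "C = A + 2 * r / L\<^sup>2 + 8 * r * c\<^sup>2 + 2 * M"
  have A: "0 \<le> A" using error_const_nonneg pos by (simp add: A_def)
  show ?thesis
  proof (intro exI[of _ C] allI impI ballI)
    fix K N :: nat and h dt t :: real and u_ext p_ext :: "real \<Rightarrow> real \<Rightarrow> real"
      and U P :: "nat \<Rightarrow> int \<Rightarrow> real"
    assume K: "K \<ge> 1" and h: "h = L / real K" and dt: "dt > 0" and T: "T = real N * dt"
      and ext: "extension_u L T h u u_ext" and scheme: "scheme \<gamma> F K N h dt U P"
      and init: "\<forall>k\<in>{-1..int K + 1}. U 0 k = u_ext (of_int k * h) 0"
      and C1: "(MAX n\<in>{0..N}. max (norm_D K h (U n))
        (norm_D K h (\<lambda>k. u (of_int k * h) (real n * dt)))) \<le> C1"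
      and C2: "(MAX n\<in>{0..N}. max (norm_Linf_d K (U n))
        (norm_Linf_d K (\<lambda>k. u (of_int k * h) (real n * dt)))) \<le> C2"
      and t: "t \<in> {0..T}"
    define E where "E = h\<^sup>2 + dt\<^sup>2"
    have E: "0 \<le> E" "h\<^sup>2 \<le> E" "dt\<^sup>2 \<le> E" by (simp_all add: E_def)
    have h0: "0 < h" and Kh: "real K * h = L" using h K pos by simp_all
    have node: "real k * h \<in> {0..L}" if "k \<le> K" for k
      using that h0 mult_right_mono[of "real k" "real K" h] by (simp add: Kh)
    have time: "real n * dt \<in> {0..T}" if "n \<le> N" for n
      using that dt mult_right_mono[of "real n" "real N" dt] by (simp add: T)
    have U_le: "\<bar>U n (int k)\<bar> \<le> r" if "n \<le> N" "k \<le> K" for n k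
      using abs_le_norm_Linf_d[OF that(2), of "U n"] Max_max_leD(1)[OF C2 that(1)] r(1) by linarith
    have dU: "diff_norm K h (\<lambda>k. U n (int k)) \<le> C1" if "n \<le> N" for n
      using Max_max_leD(1)[OF C1 that] norm_D_eq_diff_norm[OF h0] by simp
    have du: "diff_norm K h (\<lambda>k. D 0 0 (real k * h) (real n * dt)) \<le> C1" if n: "n \<le> N" for n
    proof -
      have "diff_norm K h (\<lambda>k. D 0 0 (real k * h) (real n * dt))
          = diff_norm K h (\<lambda>k. u (of_int (int k) * h) (real n * dt))"
        unfolding diff_norm_def using Du[OF node time[OF n]]
        by (intro arg_cong2[of _ _ _ _ "(/)"] L2_set_cong) (auto simp del: of_nat_Suc)
      then show ?thesis using Max_max_leD(2)[OF C1 n] norm_D_eq_diff_norm[OF h0] by simp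
    qed
    have init': "U 0 (int k) = D 0 0 (real k * h) 0" if k: "k \<le> K" for k
    proof -
      have "u_ext (real k * h) 0 = u (real k * h) 0"
        using ext node[OF k] pos unfolding extension_u_def by simp
      then show ?thesis using init k Du[OF node[OF k], of 0] pos by simp
    qed
    have err: "\<bar>U n (int k) - D 0 0 (real k * h) (real n * dt)\<bar> \<le> (C - 2 * M) * E"
      if n: "n \<le> N" and k: "k \<le> K" for n k
    proof -
      have terms: "0 \<le> A * E" "0 \<le> 2 * r / L\<^sup>2 * E" "0 \<le> 8 * r * c\<^sup>2 * E"
        using A E r by simp_all
      have CM: "(C - 2 * M) * E = A * E + 2 * r / L\<^sup>2 * E + 8 * r * c\<^sup>2 * E"
        by (simp add: C_def distrib_right)
      have trivial: "\<bar>U n (int k) - D 0 0 (real k * h) (real n * dt)\<bar> \<le> 2 * r"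
        using U_le[OF n k] D_range[OF node[OF k] time[OF n]] by linarith
      consider "K = 1" | "1 / 2 < c * dt" | "2 \<le> K" "c * dt \<le> 1 / 2" using K by linarith
      then show ?thesis
      proof cases
        case 1
        then have "2 * r = 2 * r / L\<^sup>2 * h\<^sup>2" using h pos by simp
        also have "\<dots> \<le> 2 * r / L\<^sup>2 * E" using E(2) r(2) by (intro mult_left_mono) auto
        finally show ?thesis unfolding CM using trivial terms by linarith
      next
        case 2
        have "1 \<le> (2 * (c * dt))\<^sup>2" using 2 by (intro one_le_power) simp
        then have "2 * r * 1 \<le> 2 * r * (2 * (c * dt))\<^sup>2" using r by (intro mult_left_mono) auto
        also have "\<dots> = 8 * r * c\<^sup>2 * dt\<^sup>2" by (simp add: power_mult_distrib)
        also have "\<dots> \<le> 8 * r * c\<^sup>2 * E" using E(3) r by (intro mult_left_mono) auto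
        finally show ?thesis unfolding CM using trivial terms by linarith
      next
        case 3
        have "\<bar>U n (int k) - D 0 0 (real k * h) (real n * dt)\<bar> \<le> A * E"
          unfolding A_def E_def c_def
          by (rule grid_error[where U = "\<lambda>n k. U n (int k)" and P = "\<lambda>n k. P n (int k)",
                OF 3(1) h dt T scheme_trap_weight(1)[OF scheme K h0] scheme_trap_weight(2)[OF scheme K h0]
                  init' U_le dU du 3(2)[unfolded c_def] n k])
        then show ?thesis unfolding CM using terms by linarith
      qed
    qed
    have "\<bar>interpolant K N h dt U x t - u x t\<bar> \<le> C * (h\<^sup>2 + dt\<^sup>2)" if "x \<in> {0<..<L}" for x
      using interpolant_error[OF K h dt T err, of x t] that t Du[of x t]
      by (simp add: E_def left_diff_distrib)
    moreover have "(\<lambda>x. interpolant K N h dt U x t - u x t) \<in> borel_measurable (lebesgue_on {0<..<L})"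
    proof (rule borel_measurable_diff)
      show "(\<lambda>x. interpolant K N h dt U x t) \<in> borel_measurable (lebesgue_on {0<..<L})"
        by (intro measurable_restrict_space1 measurable_completion)
          (simp add: borel_measurable_interpolant)
      have "continuous_on {0..L} (\<lambda>x. D 0 0 x t)"
        by (rule DERIV_continuous_on, rule deriv_x) (use t in auto)
      then have "continuous_on {0<..<L} (\<lambda>x. D 0 0 x t)" by (rule continuous_on_subset) auto
      then have "continuous_on {0<..<L} (\<lambda>x. u x t)"
        by (rule continuous_on_eq) (use Du t in auto)
      then show "(\<lambda>x. u x t) \<in> borel_measurable (lebesgue_on {0<..<L})"
        by (rule continuous_imp_measurable_on_sets_lebesgue) simp
    qed
    ultimately show "norm_Linf {0<..<L} (\<lambda>x. interpolant K N h dt U x t - u x t)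
        \<le> ereal (C * (h\<^sup>2 + dt\<^sup>2))"
      by (intro norm_Linf_le)
  qed
qed

end
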